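(* Let $g$ be the slice Riemannian metric on $\mathbb{B}$ and let $I^+(\mathbb{B},g)$ denote the group of orientation preserving isometries of $(\mathbb{B},g)$. The formula \[ (u,\epsilon,H(t))\cdot q=\epsilon\, u\,(1+\tanh(t)q)^{-1}(q+\tanh(t))\,\overline{u},\qquad q\in\mathbb{B}, \] where $u\in\mathrm{Sp}(1)$, $\epsilon\in\mathbb{Z}_2=\{\pm1\}$, $t\in\mathbb{R}$, defines an action of the group $\mathrm{Sp}(1)\times(\mathbb{Z}_2\ltimes \mathrm{SO}_0(1,1))$ on $\mathbb{B}$, and the set of transformations of $\mathbb{B}$ given by this action is exactly $I^+(\mathbb{B},g)$. Furthermore, this group of transformations coincides with the group generated by all diffeomorphisms of $\mathbb{B}$ induced, via the identification $\Phi$, by left translations $L_A(X)=AX$ or right translations $R_A(X)=XA$ of $\mathrm{Sp}(1,1)$ ($A\in\mathrm{Sp}(1,1)$) that commute with the left $\mathrm{Sp}(1)\times\{1\}$-action and the right $\mathrm{Sp}(1)I_2$-action on $\mathrm{Sp}(1,1)$.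
   Context: $\mathbb{H}$ denotes the quaternions, $\mathbb{B}=\{q\in\mathbb{H}:|q|<1\}$, $\mathrm{Sp}(1)=\{u\in\mathbb{H}:|u|=1\}$. Let $I_{1,1}=\operatorname{diag}(1,-1)$ and $\mathrm{Sp}(1,1)=\{A\in M_2(\mathbb{H}):A^*I_{1,1}A=I_{1,1}\}$, where $A^*$ is the conjugate transpose. For $t\in\mathbb{R}$, $H(t)=\begin{pmatrix}\cosh t&\sinh t\\ \sinh t&\cosh t\end{pmatrix}$, and $\mathrm{SO}_0(1,1)=\{H(t):t\in\mathbb{R}\}$. The group $\mathbb{Z}_2\ltimes\mathrm{SO}_0(1,1)$ is the set $\{\pm1\}\times\mathrm{SO}_0(1,1)$ with product $(\epsilon_1,H(t_1))\star(\epsilon_2,H(t_2))=(\epsilon_1\epsilon_2,H(\epsilon_2t_1+t_2))$. Slice Riemannian metric: for $q\in\mathbb{B}$ and tangent vectors $\alpha,\beta\in T_q\mathbb{B}=\mathbb{H}$, \[ g_q(\alpha,\beta)=\frac{\operatorname{Re}\big((\alpha-q\alpha q)\overline{(\beta-q\beta q)}\big)}{|1-q^2|^2(1-|q|^2)^2}. \] Slice regular functions and regular Möbius transformations: the slice regular functions on $\mathbb{B}$ are exactly the functions $f(q)=\sum_{n\ge0}q^na_n$ ($a_n\in\mathbb{H}$) with the series converging on $\mathbb{B}$. The $*$-product is $(\sum q^na_n)*(\sum q^nb_n)=\sum_n q^n\sum_{k=0}^n a_kb_{n-k}$; $f^c(q)=\sum q^n\overline{a_n}$, $f^s=f*f^c$,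 and $f^{-*}=(f^s)^{-1}f^c$ (pointwise product, off the zero set of $f^s$). For $a,b\in\mathbb{H}$ let $\ell_{a,b}(q)=qa+b$. For $A=\begin{pmatrix}a&c\\ b&d\end{pmatrix}\in\mathrm{Sp}(1,1)$ the regular Möbius transformation is $\mathcal{F}_A=\ell_{c,d}^{-*}*\ell_{a,b}$, which is a diffeomorphism of $\mathbb{B}$ onto $\mathbb{B}$. Identification $\Phi$: the subgroup $\mathrm{Sp}(1)\times\{1\}=\{\operatorname{diag}(u,1):u\in\mathrm{Sp}(1)\}$ acts on $\mathrm{Sp}(1,1)$ by left multiplication and $\mathrm{Sp}(1)I_2=\{uI_2:u\in\mathrm{Sp}(1)\}$ acts by right multiplication. It is known that $\Phi:(\mathrm{Sp}(1)\times\{1\})\backslash\mathrm{Sp}(1,1)/\mathrm{Sp}(1)I_2\to\mathbb{B}$, $[A]\mapsto(\mathcal{F}_{A^{-1}})^{-1}(0)$, is a well-defined diffeomorphism. A diffeomorphism $\widetilde f$ of $\mathrm{Sp}(1,1)$ commuting with both actions induces the diffeomorphism $f$ of $\mathbb{B}$ determined by $f(\Phi([X]))=\Phi([\widetilde f(X)])$. *)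

theory Defs
  imports "HOL-Analysis.Analysis"
begin

section \<open>Quaternions modelled as real^4 (components 1,2,3,4 = 1,i,j,k)\<close>

type_synonym quat = "real^4"

definition qone :: quat where "qone = vector [1, 0, 0, 0]"

definition qmul :: "quat \<Rightarrow> quat \<Rightarrow> quat" where
  "qmul a b = vector
     [a$1*b$1 - a$2*b$2 - a$3*b$3 - a$4*b$4,
      a$1*b$2 + a$2*b$1 + a$3*b$4 - a$4*b$3,
      a$1*b$3 - a$2*b$4 + a$3*b$1 + a$4*b$2,
      a$1*b$4 + a$2*b$3 - a$3*b$2 + a$4*b$1]"

definition qcnj :: "quat \<Rightarrow> quat" where
  "qcnj a = vector [a$1, - a$2, - a$3, - a$4]"

definition qRe :: "quat \<Rightarrow> real" where "qRe a = a$1"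

definition qinv :: "quat \<Rightarrow> quat" where
  "qinv a = (1 / (norm a)^2) *\<^sub>R qcnj a"

primrec qpow :: "quat \<Rightarrow> nat \<Rightarrow> quat" where
  "qpow q 0 = qone"
| "qpow q (Suc n) = qmul q (qpow q n)"

definition Bq :: "quat set" where "Bq = ball 0 1"

definition Sp1 :: "quat set" where "Sp1 = {u. norm u = 1}"

definition slice_metric :: "quat \<Rightarrow> quat \<Rightarrow> quat \<Rightarrow> real" where
  "slice_metric q \<alpha> \<beta> =
     qRe (qmul (\<alpha> - qmul q (qmul \<alpha> q)) (qcnj (\<beta> - qmul q (qmul \<beta> q))))
     / ((norm (qone - qmul q q))^2 * (1 - (norm q)^2)^2)"

primrec iter_dd :: "quat list \<Rightarrow> (quat \<Rightarrow> quat) \<Rightarrow> quat \<Rightarrow> quat" where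
  "iter_dd [] f = f"
| "iter_dd (v # vs) f = (\<lambda>x. frechet_derivative (iter_dd vs f) (at x) v)"

definition smooth_on :: "quat set \<Rightarrow> (quat \<Rightarrow> quat) \<Rightarrow> bool" where
  "smooth_on S f \<longleftrightarrow> (\<forall>vs. iter_dd vs f differentiable_on S)"

definition diffeo_B :: "(quat \<Rightarrow> quat) \<Rightarrow> bool" where
  "diffeo_B f \<longleftrightarrow> bij_betw f Bq Bq \<and> smooth_on Bq f \<and> smooth_on Bq (inv_into Bq f)"

definition isometry_B :: "(quat \<Rightarrow> quat) \<Rightarrow> bool" where
  "isometry_B f \<longleftrightarrow> diffeo_B f \<and>
     (\<forall>q\<in>Bq. \<forall>\<alpha> \<beta>. slice_metric (f q) (frechet_derivative f (at q) \<alpha>)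
                                         (frechet_derivative f (at q) \<beta>)
                     = slice_metric q \<alpha> \<beta>)"

definition orient_pres_B :: "(quat \<Rightarrow> quat) \<Rightarrow> bool" where
  "orient_pres_B f \<longleftrightarrow> (\<forall>q\<in>Bq. det (matrix (frechet_derivative f (at q))) > 0)"

text \<open>I^+(B,g), as a set of maps (only their values on B matter).\<close>
definition Iso_plus :: "(quat \<Rightarrow> quat) set" where
  "Iso_plus = {f. isometry_B f \<and> orient_pres_B f}"

section \<open>The action of Sp(1) x (Z_2 semidirect SO_0(1,1)); H(t) is recorded by t\<close>

definition act :: "quat \<Rightarrow> real \<Rightarrow> real \<Rightarrow> quat \<Rightarrow> quat" where
  "act u \<epsilon> t q = \<epsilon> *\<^sub>R qmul (qmul u (qmul (qinv (qone + tanh t *\<^sub>R q)) (q + tanh t *\<^sub>R qone)))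
                           (qcnj u)"

definition grp_mult :: "quat \<times> real \<times> real \<Rightarrow> quat \<times> real \<times> real \<Rightarrow> quat \<times> real \<times> real" where
  "grp_mult x y = (case x of (u1, e1, t1) \<Rightarrow> case y of (u2, e2, t2) \<Rightarrow>
                     (qmul u1 u2, e1 * e2, e2 * t1 + t2))"

definition grp :: "(quat \<times> real \<times> real) set" where
  "grp = {(u, e, t). u \<in> Sp1 \<and> e \<in> {1, -1}}"

definition act_maps :: "(quat \<Rightarrow> quat) set" where
  "act_maps = {act u e t | u e t. (u, e, t) \<in> grp}"

type_synonym qmat = "quat^2^2"

definition qmat_mul :: "qmat \<Rightarrow> qmat \<Rightarrow> qmat" where
  "qmat_mul A B = (\<chi> i j. \<Sum>k\<in>UNIV. qmul (A$i$k) (B$k$j))"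

definition qmat_adj :: "qmat \<Rightarrow> qmat" where
  "qmat_adj A = (\<chi> i j. qcnj (A$j$i))"

definition qmat_diag :: "quat \<Rightarrow> quat \<Rightarrow> qmat" where
  "qmat_diag x y = (\<chi> i j. if i = j then (if i = 1 then x else y) else 0)"

definition I11 :: qmat where "I11 = qmat_diag qone (- qone)"

definition Sp11 :: "qmat set" where
  "Sp11 = {A. qmat_mul (qmat_adj A) (qmat_mul I11 A) = I11}"

definition sp11_inv :: "qmat \<Rightarrow> qmat" where
  "sp11_inv A = qmat_mul I11 (qmat_mul (qmat_adj A) I11)"

text \<open>Polynomial slice regular functions as finitely supported coefficient sequences.\<close>
definition seval :: "(nat \<Rightarrow> quat) \<Rightarrow> quat \<Rightarrow> quat" where
  "seval a q = (\<Sum>n\<in>{n. a n \<noteq> 0}. qmul (qpow q n) (a n))"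

definition sstar :: "(nat \<Rightarrow> quat) \<Rightarrow> (nat \<Rightarrow> quat) \<Rightarrow> nat \<Rightarrow> quat" where
  "sstar a b n = (\<Sum>k\<le>n. qmul (a k) (b (n - k)))"

definition scnj :: "(nat \<Rightarrow> quat) \<Rightarrow> nat \<Rightarrow> quat" where
  "scnj a n = qcnj (a n)"

definition ssym :: "(nat \<Rightarrow> quat) \<Rightarrow> nat \<Rightarrow> quat" where
  "ssym a = sstar a (scnj a)"

definition ell :: "quat \<Rightarrow> quat \<Rightarrow> nat \<Rightarrow> quat" where
  "ell a b n = (if n = 0 then b else if n = 1 then a else 0)"

text \<open>f^{-*} * g, using f^{-*} * g = (f^s)^{-1} (f^c * g) (f^s has real coefficients).\<close>
definition star_inv_star :: "(nat \<Rightarrow> quat) \<Rightarrow> (nat \<Rightarrow> quat) \<Rightarrow> quat \<Rightarrow> quat" where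
  "star_inv_star f g q = qmul (qinv (seval (ssym f) q)) (seval (sstar (scnj f) g) q)"

definition regMob :: "qmat \<Rightarrow> quat \<Rightarrow> quat" where
  "regMob A = star_inv_star (ell (A$1$2) (A$2$2)) (ell (A$1$1) (A$2$1))"

definition Phi :: "qmat \<Rightarrow> quat" where
  "Phi X = (THE p. p \<in> Bq \<and> regMob (sp11_inv X) p = 0)"

definition commutes_actions :: "(qmat \<Rightarrow> qmat) \<Rightarrow> bool" where
  "commutes_actions F \<longleftrightarrow>
     (\<forall>u\<in>Sp1. \<forall>X\<in>Sp11.
        F (qmat_mul (qmat_diag u qone) X) = qmat_mul (qmat_diag u qone) (F X) \<and>
        F (qmat_mul X (qmat_diag u u)) = qmat_mul (F X) (qmat_diag u u))"

definition induced_by :: "(qmat \<Rightarrow> qmat) \<Rightarrow> (quat \<Rightarrow> quat) \<Rightarrow> bool" where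
  "induced_by F f \<longleftrightarrow> (\<forall>X\<in>Sp11. f (Phi X) = Phi (F X))"

definition translation_maps :: "(quat \<Rightarrow> quat) set" where
  "translation_maps = {f. \<exists>A\<in>Sp11.
      (commutes_actions (\<lambda>X. qmat_mul A X) \<and> induced_by (\<lambda>X. qmat_mul A X) f) \<or>
      (commutes_actions (\<lambda>X. qmat_mul X A) \<and> induced_by (\<lambda>X. qmat_mul X A) f)}"

inductive_set gen_group :: "(quat \<Rightarrow> quat) set \<Rightarrow> (quat \<Rightarrow> quat) set" for S where
  gen: "f \<in> S \<Longrightarrow> f \<in> gen_group S"
| ident: "id \<in> gen_group S"
| comp: "f \<in> gen_group S \<Longrightarrow> h \<in> gen_group S \<Longrightarrow> f \<circ> h \<in> gen_group S"
| inv: "f \<in> gen_group S \<Longrightarrow> inv_into Bq f \<in> gen_group S"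

definition same_on_B :: "(quat \<Rightarrow> quat) set \<Rightarrow> (quat \<Rightarrow> quat) set \<Rightarrow> bool" where
  "same_on_B S T \<longleftrightarrow> (\<forall>f\<in>S. \<exists>h\<in>T. \<forall>q\<in>Bq. f q = h q) \<and> (\<forall>h\<in>T. \<exists>f\<in>S. \<forall>q\<in>Bq. f q = h q)"

end

theory Submission
  imports Defs
begin

text \<open>
  On each slice the metric is a quarter of the hyperbolic metric, and the sphere of imaginary units
  carries a warping factor that stays bounded. Consequently the points of the real axis, and only they,
  are poles: from a real point every minimising path stays in a slice and extends to a minimising ray,
  whereas a minimising path from a nonreal point to the real axis cannot be extended far beyond it,
  because rotating the imaginary unit costs at most \<open>\<pi>\<close> and a negligible amount over a long distance.
  Hence every isometry preserves the real axis. After composition with an element of the action it fixes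
  \<open>0\<close> and \<open>1/2\<close>, so it preserves norms and real parts. It then preserves the radial vector field, which
  makes it linear, and an orientation preserving linear isometry fixing \<open>1\<close> is conjugation by a
  unit quaternion.

  On the group side, \<open>\<Phi>\<close> maps a matrix with second row \<open>(b, d)\<close> to \<open>b d\<^sup>-\<^sup>1\<close>. A left translation commuting
  with the actions is given by a diagonal matrix and induces a conjugation; a right translation commuting
  with them is given by a real matrix and induces a map \<open>q \<mapsto> \<plusminus>(1 + \<tau> q)\<^sup>-\<^sup>1 (q + \<tau>)\<close>.
\<close>

section \<open>Quaternion algebra\<close>

text \<open>Being a pole is a purely metric property, so no geodesic equation or curvature is
  needed, only explicit bounds for distances; lower bounds are computed from the origin alone. That
  a nonreal \<open>p\<close> is no pole rests on a right angle. A translation along the real axis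
  makes \<open>p\<close> purely imaginary. After rotation of the imaginary unit, \<open>p\<close>
  and any \<open>y\<close> lie in one hyperbolic half-plane, and the direction of \<open>p\<close>
  is normal to its boundary, so the angle between them at 0 is at most a right angle. If
  \<open>p\<close> has distance \<open>\<rho>\<close> from 0 and \<open>y\<close> at most
  \<open>r\<close>, the half-plane distance \<open>l\<close> therefore satisfies
  \<open>cosh l \<le> cosh \<rho> * cosh r\<close>. For large \<open>r\<close> this keeps
  \<open>l\<close> below about \<open>r + ln (cosh \<rho>)\<close>, hence below
  \<open>r + \<rho>\<close> by a fixed amount, whereas the rotation only replaces \<open>l\<close>
  by \<open>sqrt (l^2 + pi^2)\<close>. In the normalisation, \<open>1/2\<close> stands for any
  second real point: the distances to it and to 0 determine the norm and the real part.\<close>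

lemma qmul_nth [simp]:
  "qmul a b $ 1 = a$1*b$1 - a$2*b$2 - a$3*b$3 - a$4*b$4"
  "qmul a b $ 2 = a$1*b$2 + a$2*b$1 + a$3*b$4 - a$4*b$3"
  "qmul a b $ 3 = a$1*b$3 - a$2*b$4 + a$3*b$1 + a$4*b$2"
  "qmul a b $ 4 = a$1*b$4 + a$2*b$3 - a$3*b$2 + a$4*b$1"
  by (simp_all add: qmul_def vector_def)

lemma qone_nth [simp]: "qone $ 1 = 1" "qone $ 2 = 0" "qone $ 3 = 0" "qone $ 4 = 0"
  by (simp_all add: qone_def vector_def)

lemma qcnj_nth [simp]:
  "qcnj a $ 1 = a$1" "qcnj a $ 2 = - a$2" "qcnj a $ 3 = - a$3" "qcnj a $ 4 = - a$4"
  by (simp_all add: qcnj_def vector_def)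

lemma quat_eq_iff: "(a::quat) = b \<longleftrightarrow> a$1 = b$1 \<and> a$2 = b$2 \<and> a$3 = b$3 \<and> a$4 = b$4"
  by (simp add: vec_eq_iff forall_4)

lemma inner_quat: "(a::quat) \<bullet> b = a$1*b$1 + a$2*b$2 + a$3*b$3 + a$4*b$4"
  by (simp add: inner_vec_def sum_4)

lemma norm_quat_sq: "(norm (a::quat))\<^sup>2 = (a$1)\<^sup>2 + (a$2)\<^sup>2 + (a$3)\<^sup>2 + (a$4)\<^sup>2"
  by (simp only: power2_norm_eq_inner inner_quat) (simp add: power2_eq_square)

lemma qmul_assoc: "qmul (qmul a b) c = qmul a (qmul b c)"
  by (simp add: quat_eq_iff algebra_simps)

lemma qmul_one [simp]: "qmul qone a = a" "qmul a qone = a"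
  by (simp_all add: quat_eq_iff)

text \<open>In finite dimension bilinearity gives boundedness. The interpretation supplies the
  distributive laws and the product rule \<open>qmul.FDERIV\<close>.\<close>

interpretation qmul: bounded_bilinear qmul
proof (rule bilinear_conv_bounded_bilinear[THEN iffD1])
  show "bilinear qmul"
    unfolding bilinear_def
    by (intro conjI allI; rule linearI) (simp_all add: quat_eq_iff algebra_simps)
qed

lemmas qmul_simps = qmul.add_left qmul.add_right qmul.diff_left qmul.diff_right
  qmul.scaleR_left qmul.scaleR_right

lemma qcnj_mul: "qcnj (qmul a b) = qmul (qcnj b) (qcnj a)"
  by (simp add: quat_eq_iff algebra_simps)

lemma linear_qcnj: "linear qcnj"
  by (rule linearI) (simp_all add: quat_eq_iff)

lemma qcnj_add: "qcnj (a + b) = qcnj a + qcnj b"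
  and qcnj_scaleR: "qcnj (r *\<^sub>R a) = r *\<^sub>R qcnj a"
  and qcnj_minus: "qcnj (- a) = - qcnj a"
  and qcnj_qcnj [simp]: "qcnj (qcnj a) = a"
  and qcnj_qone [simp]: "qcnj qone = qone"
  and qcnj_zero [simp]: "qcnj 0 = 0"
  by (simp_all add: quat_eq_iff)

lemma qmul_qcnj_right: "qmul a (qcnj a) = (norm a)\<^sup>2 *\<^sub>R qone"
  and qmul_qcnj_left: "qmul (qcnj a) a = (norm a)\<^sup>2 *\<^sub>R qone"
  unfolding norm_quat_sq by (simp_all add: quat_eq_iff power2_eq_square algebra_simps)

lemma qRe_qmul_qcnj: "qRe (qmul a (qcnj b)) = a \<bullet> b"
  by (simp add: qRe_def inner_quat)

lemma norm_qmul: "norm (qmul a b) = norm a * norm b"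
proof -
  have "(norm (qmul a b))\<^sup>2 = (norm a * norm b)\<^sup>2"
    unfolding power_mult_distrib norm_quat_sq qmul_nth by algebra
  then show ?thesis
    by (simp add: power2_eq_iff_nonneg)
qed

lemma norm_qcnj [simp]: "norm (qcnj a) = norm a"
  by (rule power2_eq_imp_eq) (simp_all add: norm_quat_sq)

lemma norm_qone [simp]: "norm qone = 1"
  by (rule power2_eq_imp_eq) (simp_all add: norm_quat_sq)

lemma qone_neq_0 [simp]: "qone \<noteq> 0"
  using norm_qone by force

lemma inner_qmul_left: "qmul p a \<bullet> qmul p b = (norm p)\<^sup>2 * (a \<bullet> b)"
  and inner_qmul_right: "qmul a p \<bullet> qmul b p = (norm p)\<^sup>2 * (a \<bullet> b)"
  unfolding inner_quat norm_quat_sq qmul_nth by algebra+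

lemma qmul_eq_0: "qmul a b = 0 \<longleftrightarrow> a = 0 \<or> b = 0"
  by (metis mult_eq_0_iff norm_eq_zero norm_qmul)

lemma norm_qinv: "norm (qinv a) = inverse (norm a)"
  by (simp add: qinv_def power2_eq_square field_simps)

lemma qinv_zero [simp]: "qinv 0 = 0"
  by (simp add: qinv_def)

lemma qinv_eq_0: "qinv a = 0 \<longleftrightarrow> a = 0"
  by (metis inverse_nonzero_iff_nonzero norm_eq_zero norm_qinv)

lemma qmul_qinv: "a \<noteq> 0 \<Longrightarrow> qmul a (qinv a) = qone"
  and qinv_qmul: "a \<noteq> 0 \<Longrightarrow> qmul (qinv a) a = qone"
  by (simp_all add: qinv_def qmul_simps qmul_qcnj_right qmul_qcnj_left)

lemma qmul_qinv_assoc: "a \<noteq> 0 \<Longrightarrow> qmul a (qmul (qinv a) b) = b"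
  and qinv_qmul_assoc: "a \<noteq> 0 \<Longrightarrow> qmul (qinv a) (qmul a b) = b"
  by (simp_all add: qmul_assoc[symmetric] qmul_qinv qinv_qmul)

lemma qmul_right_cancel: "a \<noteq> 0 \<Longrightarrow> qmul b a = qmul c a \<longleftrightarrow> b = c"
  by (metis qmul_assoc qmul_one(2) qmul_qinv)

lemma qinv_qmul_distrib: "qinv (qmul a b) = qmul (qinv b) (qinv a)"
  by (simp add: qinv_def qcnj_mul norm_qmul qmul_simps power_mult_distrib)

lemma qinv_scaleR: "qinv (r *\<^sub>R a) = inverse r *\<^sub>R qinv a"
  by (simp add: qinv_def qcnj_scaleR power_mult_distrib power2_eq_square divide_simps)

lemma qinv_qone [simp]: "qinv qone = qone"
  by (simp add: qinv_def)

lemma qinv_unit: "norm u = 1 \<Longrightarrow> qinv u = qcnj u"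
  by (simp add: qinv_def)

lemma qmul_qcnj_unit:
  assumes "norm u = 1"
  shows "qmul u (qcnj u) = qone" "qmul (qcnj u) u = qone"
    "qmul u (qmul (qcnj u) a) = a" "qmul (qcnj u) (qmul u a) = a"
  using assms by (simp_all add: qmul_qcnj_right qmul_qcnj_left qmul_assoc[symmetric])

section \<open>The action by regular Moebius transformations and its invariance of the slice metric\<close>

lemma Bq_iff: "q \<in> Bq \<longleftrightarrow> norm q < 1"
  by (simp add: Bq_def)

lemma open_Bq [simp]: "open Bq"
  by (simp add: Bq_def)

lemma Bq_norm_sq: "q \<in> Bq \<longleftrightarrow> (norm q)\<^sup>2 < 1"
  by (simp add: Bq_iff abs_square_less_1)

lemma nth_1_le_norm: "\<bar>(q::quat)$1\<bar> \<le> norm q"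
  by (rule component_le_norm_cart)

lemma nth_1_sq_le: "((q::quat)$1)\<^sup>2 \<le> (norm q)\<^sup>2"
  by (simp add: norm_quat_sq)

text \<open>The parameter is \<open>tanh t\<close> instead of \<open>t\<close>, which makes the
  identities below rational in it. Numerator and denominator are real-affine in \<open>q\<close> and
  hence commute.\<close>

definition mob :: "real \<Rightarrow> quat \<Rightarrow> quat" where
  "mob \<tau> q = qmul (qinv (qone + \<tau> *\<^sub>R q)) (q + \<tau> *\<^sub>R qone)"

lemma act_mob: "act u e t q = e *\<^sub>R qmul (qmul u (mob (tanh t) q)) (qcnj u)"
  by (simp add: act_def mob_def)

section \<open>The maps \<open>mob\<close> and the group law of the action\<close>

lemma one_add_scaleR_neq_0:
  assumes "\<bar>\<tau>\<bar> < 1" "q \<in> Bq"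
  shows "qone + \<tau> *\<^sub>R q \<noteq> 0"
proof
  assume "qone + \<tau> *\<^sub>R q = 0"
  then have "norm (\<tau> *\<^sub>R q) = norm qone"
    by (metis add_eq_0_iff norm_minus_cancel)
  moreover have "\<bar>\<tau>\<bar> * norm q < 1 * 1"
    by (rule mult_strict_mono') (use assms in \<open>auto simp: Bq_iff\<close>)
  ultimately show False
    by simp
qed

lemma norm_one_add_scaleR: "(norm (qone + \<tau> *\<^sub>R q))\<^sup>2 = 1 + 2 * \<tau> * q$1 + \<tau>\<^sup>2 * (norm q)\<^sup>2"
  unfolding norm_quat_sq by (simp add: power2_eq_square algebra_simps)

lemma norm_add_scaleR_one: "(norm (q + \<tau> *\<^sub>R qone))\<^sup>2 = (norm q)\<^sup>2 + 2 * \<tau> * q$1 + \<tau>\<^sup>2"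
  unfolding norm_quat_sq by (simp add: power2_eq_square algebra_simps)

text \<open>The terms linear in \<open>\<tau>\<close> cancel in the difference of the squared norms
  of denominator and numerator, and the rest factors. Besides the invariance of the ball, this
  formula later recovers a real part from norms.\<close>

lemma norm_mob:
  assumes "\<bar>\<tau>\<bar> < 1" "q \<in> Bq"
  shows "1 - (norm (mob \<tau> q))\<^sup>2 = (1 - \<tau>\<^sup>2) * (1 - (norm q)\<^sup>2) / (norm (qone + \<tau> *\<^sub>R q))\<^sup>2"
proof -
  define d where "d = (norm (qone + \<tau> *\<^sub>R q))\<^sup>2"
  have d: "d \<noteq> 0"
    using one_add_scaleR_neq_0[OF assms] by (simp add: d_def)
  have "(norm (mob \<tau> q))\<^sup>2 = (norm (q + \<tau> *\<^sub>R qone))\<^sup>2 / d"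
    by (simp add: mob_def norm_qmul norm_qinv d_def power_mult_distrib divide_inverse power_inverse)
  moreover have "d - (norm (q + \<tau> *\<^sub>R qone))\<^sup>2 = (1 - \<tau>\<^sup>2) * (1 - (norm q)\<^sup>2)"
    unfolding d_def norm_one_add_scaleR norm_add_scaleR_one by algebra
  ultimately show ?thesis
    unfolding d_def[symmetric] using d by (simp add: field_simps)
qed

lemma mob_in_Bq:
  assumes "\<bar>\<tau>\<bar> < 1" "q \<in> Bq"
  shows "mob \<tau> q \<in> Bq"
proof -
  have "0 < 1 - \<tau>\<^sup>2" "0 < 1 - (norm q)\<^sup>2"
    using assms by (simp_all add: abs_square_less_1 Bq_norm_sq)
  then have "0 < 1 - (norm (mob \<tau> q))\<^sup>2"
    using one_add_scaleR_neq_0[OF assms] by (simp add: norm_mob[OF assms])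
  then show ?thesis
    by (simp add: Bq_norm_sq)
qed

text \<open>Numerator and denominator of the outer map share the left factor \<open>qinv D\<close>,
  which cancels, as does the real factor \<open>k\<close>. What remains is the addition theorem of
  \<open>tanh\<close>.\<close>

lemma mob_mob:
  assumes "\<bar>\<sigma>\<bar> < 1" "\<bar>\<tau>\<bar> < 1" "q \<in> Bq"
  shows "mob \<sigma> (mob \<tau> q) = mob ((\<sigma> + \<tau>) / (1 + \<sigma> * \<tau>)) q"
proof -
  define D N where "D = qone + \<tau> *\<^sub>R q" and "N = q + \<tau> *\<^sub>R qone"
  define k where "k = 1 + \<sigma> * \<tau>"
  have D: "D \<noteq> 0"
    unfolding D_def using assms one_add_scaleR_neq_0 by blast
  have "\<bar>\<sigma>\<bar> * \<bar>\<tau>\<bar> < 1 * 1"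
    by (rule mult_strict_mono') (use assms in auto)
  then have k: "k \<noteq> 0"
    unfolding k_def by (metis abs_minus_cancel abs_mult abs_one add_eq_0_iff less_irrefl mult_1)
  have kc: "k * ((\<sigma> + \<tau>) / k) = \<sigma> + \<tau>"
    using k by simp
  have "qone + \<sigma> *\<^sub>R qmul (qinv D) N = qmul (qinv D) (D + \<sigma> *\<^sub>R N)"
    "qmul (qinv D) N + \<sigma> *\<^sub>R qone = qmul (qinv D) (N + \<sigma> *\<^sub>R D)"
    by (simp_all add: qmul_simps qinv_qmul D)
  then have "mob \<sigma> (mob \<tau> q) = qmul (qmul (qinv (D + \<sigma> *\<^sub>R N)) (qinv (qinv D))) (qmul (qinv D) (N + \<sigma> *\<^sub>R D))"
    by (simp add: mob_def D_def[symmetric] N_def[symmetric] qinv_qmul_distrib)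
  also have "\<dots> = qmul (qinv (D + \<sigma> *\<^sub>R N)) (N + \<sigma> *\<^sub>R D)"
    by (simp add: qmul_assoc qinv_qmul_assoc qinv_eq_0 D)
  also have "D + \<sigma> *\<^sub>R N = k *\<^sub>R (qone + ((\<sigma> + \<tau>) / k) *\<^sub>R q)"
    by (simp only: scaleR_add_right scaleR_scaleR kc) (simp add: D_def N_def k_def algebra_simps)
  also have "N + \<sigma> *\<^sub>R D = k *\<^sub>R (q + ((\<sigma> + \<tau>) / k) *\<^sub>R qone)"
    by (simp only: scaleR_add_right scaleR_scaleR kc) (simp add: D_def N_def k_def algebra_simps)
  also have "qmul (qinv (k *\<^sub>R a)) (k *\<^sub>R b) = qmul (qinv a) b" for a b
    using k by (simp add: qinv_scaleR qmul.scaleR_left qmul.scaleR_right)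
  finally show ?thesis
    by (simp only: mob_def k_def)
qed

lemma mob_0 [simp]: "mob 0 q = q"
  by (simp add: mob_def)

lemma qinv_conj: "norm u = 1 \<Longrightarrow> qinv (qmul (qmul u a) (qcnj u)) = qmul (qmul u (qinv a)) (qcnj u)"
  by (simp add: qinv_qmul_distrib qinv_unit qmul_assoc)

lemma conj_mul:
  "norm u = 1 \<Longrightarrow> qmul (qmul (qmul u a) (qcnj u)) (qmul (qmul u b) (qcnj u)) = qmul (qmul u (qmul a b)) (qcnj u)"
  by (simp add: qmul_assoc qmul_qcnj_unit)

lemma conj_one: "norm u = 1 \<Longrightarrow> qmul (qmul u qone) (qcnj u) = qone"
  by (simp add: qmul_qcnj_unit)

lemma norm_conj: "norm u = 1 \<Longrightarrow> norm (qmul (qmul u a) (qcnj u)) = norm a"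
  by (simp add: norm_qmul)

lemma mob_conj:
  assumes "norm u = 1"
  shows "mob \<tau> (qmul (qmul u q) (qcnj u)) = qmul (qmul u (mob \<tau> q)) (qcnj u)"
proof -
  have "qone + \<tau> *\<^sub>R qmul (qmul u q) (qcnj u) = qmul (qmul u (qone + \<tau> *\<^sub>R q)) (qcnj u)"
    "qmul (qmul u q) (qcnj u) + \<tau> *\<^sub>R qone = qmul (qmul u (q + \<tau> *\<^sub>R qone)) (qcnj u)"
    using conj_one[OF assms] by (simp_all add: qmul.add_left qmul.add_right qmul.scaleR_left qmul.scaleR_right)
  then show ?thesis
    by (simp add: mob_def qinv_conj conj_mul assms)
qed

text \<open>The passage from \<open>\<tau>\<close> to \<open>e * \<tau>\<close> is the source of the
  twist \<open>e2 * t1\<close> in \<open>grp_mult\<close>.\<close>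

lemma mob_sign:
  assumes "e \<in> {1, -1}"
  shows "mob \<tau> (e *\<^sub>R q) = e *\<^sub>R mob (e * \<tau>) q"
proof -
  have "- q + \<tau> *\<^sub>R qone = - (q - \<tau> *\<^sub>R qone)"
    by simp
  then show ?thesis
    using assms by (auto simp: mob_def simp flip: qmul.minus_right)
qed

lemma tanh_abs_less_1: "\<bar>tanh (t::real)\<bar> < 1"
  using tanh_real_bounds[of t] by auto

lemma act_in_Bq:
  assumes "(u, e, t) \<in> grp" "q \<in> Bq"
  shows "act u e t q \<in> Bq"
proof -
  have "norm u = 1" "\<bar>e\<bar> = 1"
    using assms by (auto simp: grp_def Sp1_def)
  then show ?thesis
    using mob_in_Bq[OF tanh_abs_less_1 assms(2)] by (simp add: act_mob norm_qmul Bq_iff)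
qed

lemma act_act:
  assumes "(u, e, t) \<in> grp" "(u', e', t') \<in> grp" "q \<in> Bq"
  shows "act (qmul u u') (e * e') (e' * t + t') q = act u e t (act u' e' t' q)"
proof -
  have u: "norm u = 1" "norm u' = 1" and e: "e' \<in> {1, -1}"
    using assms by (auto simp: grp_def Sp1_def)
  have t: "e' * tanh t = tanh (e' * t)"
    using e by auto
  have "cosh (e' * t) \<noteq> 0" "cosh t' \<noteq> 0"
    using cosh_real_pos[of "e' * t"] cosh_real_pos[of t'] by auto
  then have "tanh (e' * t + t') = (tanh (e' * t) + tanh t') / (1 + tanh (e' * t) * tanh t')"
    by (rule tanh_add)
  then have "mob (tanh (e' * t + t')) q = mob (tanh (e' * t)) (mob (tanh t') q)"
    by (simp add: mob_mob tanh_abs_less_1 assms(3))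
  then have "act u e t (act u' e' t' q)
      = e *\<^sub>R qmul (qmul u (e' *\<^sub>R qmul (qmul u' (mob (tanh (e' * t + t')) q)) (qcnj u'))) (qcnj u)"
    by (simp only: act_mob mob_sign[OF e] mob_conj[OF u(2)] t)
  then show ?thesis
    by (simp add: act_mob qcnj_mul qmul_assoc qmul_simps)
qed

lemma grp_mult_closed: "x \<in> grp \<Longrightarrow> y \<in> grp \<Longrightarrow> grp_mult x y \<in> grp"
  by (auto simp: grp_def grp_mult_def Sp1_def norm_qmul)

lemma act_identity [simp]: "act qone 1 0 q = q"
  by (simp add: act_mob)

lemma grp_inverse: "(u, e, t) \<in> grp \<Longrightarrow> (qcnj u, e, - (e * t)) \<in> grp"
  by (auto simp: grp_def Sp1_def)

lemma act_inverse:
  assumes "(u, e, t) \<in> grp" "q \<in> Bq"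
  shows "act u e t (act (qcnj u) e (- (e * t)) q) = q"
    "act (qcnj u) e (- (e * t)) (act u e t q) = q"
proof -
  have "norm u = 1" "e * e = 1"
    using assms by (auto simp: grp_def Sp1_def)
  then show "act u e t (act (qcnj u) e (- (e * t)) q) = q"
    "act (qcnj u) e (- (e * t)) (act u e t q) = q"
    using assms by (simp_all add: act_act[symmetric] grp_inverse qmul_qcnj_unit flip: mult.assoc)
qed

section \<open>Invariance of the slice metric under the action\<close>

lemma slice_metric_inner:
  "slice_metric q \<alpha> \<beta> = (\<alpha> - qmul q (qmul \<alpha> q)) \<bullet> (\<beta> - qmul q (qmul \<beta> q))
     / ((norm (qone - qmul q q))\<^sup>2 * (1 - (norm q)\<^sup>2)\<^sup>2)"
  by (simp add: slice_metric_def qRe_qmul_qcnj)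

lemma norm_one_minus_sq:
  "(norm (qone - qmul q q))\<^sup>2 = (1 - (norm q)\<^sup>2)\<^sup>2 + 4 * ((norm q)\<^sup>2 - (q$1)\<^sup>2)"
  unfolding norm_quat_sq by (simp add: power2_eq_square algebra_simps)

text \<open>The last two summands of the numerator vanish on tangent vectors orthogonal to the slice of \<open>q\<close>.\<close>
lemma slice_metric_explicit:
  "slice_metric q \<alpha> \<beta> =
     ((1 - (norm q)\<^sup>2)\<^sup>2 * (\<alpha> \<bullet> \<beta>) + 4 * ((norm q)\<^sup>2 - (q$1)\<^sup>2) * (\<alpha>$1 * \<beta>$1)
       + 4 * (q \<bullet> \<alpha> - q$1 * \<alpha>$1) * (q \<bullet> \<beta> - q$1 * \<beta>$1))
     / (((1 - (norm q)\<^sup>2)\<^sup>2 + 4 * ((norm q)\<^sup>2 - (q$1)\<^sup>2)) * (1 - (norm q)\<^sup>2)\<^sup>2)"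
proof -
  have "(\<alpha> - qmul q (qmul \<alpha> q)) \<bullet> (\<beta> - qmul q (qmul \<beta> q)) =
      (1 - (norm q)\<^sup>2)\<^sup>2 * (\<alpha> \<bullet> \<beta>) + 4 * ((norm q)\<^sup>2 - (q$1)\<^sup>2) * (\<alpha>$1 * \<beta>$1)
       + 4 * (q \<bullet> \<alpha> - q$1 * \<alpha>$1) * (q \<bullet> \<beta> - q$1 * \<beta>$1)"
    unfolding norm_quat_sq inner_quat vector_minus_component qmul_nth by algebra
  then show ?thesis
    by (simp only: slice_metric_inner norm_one_minus_sq)
qed

lemma slice_metric_conj:
  assumes "norm u = 1"
  shows "slice_metric (qmul (qmul u q) (qcnj u)) (qmul (qmul u \<alpha>) (qcnj u)) (qmul (qmul u \<beta>) (qcnj u))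
    = slice_metric q \<alpha> \<beta>"
proof -
  let ?c = "\<lambda>a. qmul (qmul u a) (qcnj u)"
  have diff: "?c a - ?c b = ?c (a - b)" for a b
    by (simp add: qmul_simps)
  have "qone - ?c (qmul q q) = ?c (qone - qmul q q)"
    by (simp add: qmul.diff_left qmul.diff_right qmul_qcnj_unit assms)
  then show ?thesis
    by (simp add: slice_metric_inner conj_mul[OF assms] diff norm_conj[OF assms]
        inner_qmul_left inner_qmul_right assms)
qed

lemma slice_metric_sign:
  "e \<in> {1, -1} \<Longrightarrow> slice_metric (e *\<^sub>R q) (e *\<^sub>R \<alpha>) (e *\<^sub>R \<beta>) = slice_metric q \<alpha> \<beta>"
  by (auto simp: slice_metric_explicit)

lemma qinv_commute:
  assumes "qmul a b = qmul b a"
  shows "qmul a (qinv b) = qmul (qinv b) a"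
proof (cases "b = 0")
  case False
  have "qmul (qmul a (qinv b)) b = qmul (qmul (qinv b) a) b"
    using False by (simp add: qmul_assoc qinv_qmul assms qinv_qmul_assoc)
  then show ?thesis
    using False qmul_right_cancel by blast
qed (simp add: qmul.zero_left qmul.zero_right)

text \<open>The tangent vectors are images under the derivative of \<open>mob \<tau>\<close>. In
  \<open>D x D - N x N\<close> the mixed terms cancel, leaving \<open>(1 - \<tau>^2)\<close> times
  \<open>x - q x q\<close>. As \<open>R\<close> and \<open>N\<close> commute, the operator in the
  metric is thus only multiplied by \<open>R R\<close> on both sides and by a real factor, and
  numerator and denominator of the metric both acquire
  \<open>(1 - \<tau>^2)^4 * norm R ^ 8\<close>.\<close>

lemma slice_metric_mob:
  assumes "\<bar>\<tau>\<bar> < 1" "q \<in> Bq"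
  defines "R \<equiv> qinv (qone + \<tau> *\<^sub>R q)"
  shows "slice_metric (mob \<tau> q) ((1 - \<tau>\<^sup>2) *\<^sub>R qmul R (qmul \<alpha> R)) ((1 - \<tau>\<^sup>2) *\<^sub>R qmul R (qmul \<beta> R))
    = slice_metric q \<alpha> \<beta>"
proof -
  define D N where "D = qone + \<tau> *\<^sub>R q" and "N = q + \<tau> *\<^sub>R qone"
  have D: "D \<noteq> 0"
    unfolding D_def using assms one_add_scaleR_neq_0 by blast
  have R: "R = qinv D"
    by (simp add: R_def D_def)
  have "qmul N D = qmul D N"
    by (simp add: D_def N_def qmul_simps algebra_simps)
  then have NR: "qmul N R = qmul R N"
    unfolding R by (rule qinv_commute)
  have M: "mob \<tau> q = qmul R N"
    by (simp add: mob_def R_def N_def)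
  have NR': "qmul N (qmul R x) = qmul R (qmul N x)" for x
    by (simp add: qmul_assoc[symmetric] NR)
  have *: "(1 - \<tau>\<^sup>2) *\<^sub>R qmul R (qmul x R) - qmul (mob \<tau> q) (qmul ((1 - \<tau>\<^sup>2) *\<^sub>R qmul R (qmul x R)) (mob \<tau> q))
      = (1 - \<tau>\<^sup>2)\<^sup>2 *\<^sub>R qmul (qmul R R) (qmul (x - qmul q (qmul x q)) (qmul R R))" for x
  proof -
    have x: "x = qmul R (qmul (qmul D (qmul x D)) R)"
      by (simp add: R qmul_assoc qmul_qinv D qinv_qmul_assoc)
    have 1: "qmul R (qmul x R) = qmul (qmul R R) (qmul (qmul D (qmul x D)) (qmul R R))"
      by (subst x) (simp add: qmul_assoc)
    have 2: "qmul (mob \<tau> q) (qmul (qmul R (qmul x R)) (mob \<tau> q))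
      = qmul (qmul R R) (qmul (qmul N (qmul x N)) (qmul R R))"
      by (simp add: M qmul_assoc NR NR')
    have 3: "qmul D (qmul x D) - qmul N (qmul x N) = (1 - \<tau>\<^sup>2) *\<^sub>R (x - qmul q (qmul x q))"
      by (simp add: D_def N_def qmul_simps algebra_simps power2_eq_square)
    have "(1 - \<tau>\<^sup>2) *\<^sub>R qmul R (qmul x R) - qmul (mob \<tau> q) (qmul ((1 - \<tau>\<^sup>2) *\<^sub>R qmul R (qmul x R)) (mob \<tau> q))
      = (1 - \<tau>\<^sup>2) *\<^sub>R (qmul R (qmul x R) - qmul (mob \<tau> q) (qmul (qmul R (qmul x R)) (mob \<tau> q)))"
      by (simp add: qmul_simps scaleR_diff_right)
    also have "\<dots> = (1 - \<tau>\<^sup>2) *\<^sub>R qmul (qmul R R) (qmul (qmul D (qmul x D) - qmul N (qmul x N)) (qmul R R))"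
      by (simp only: 2 qmul.diff_left qmul.diff_right 1[symmetric])
    finally show ?thesis
      unfolding 3 by (simp add: qmul.scaleR_left qmul.scaleR_right power2_eq_square)
  qed
  have "qone - qmul (mob \<tau> q) (mob \<tau> q) = qmul (qmul R R) (qmul D D - qmul N N)"
  proof -
    have "qmul R (qmul R (qmul D D)) = qone"
      by (simp add: R qinv_qmul_assoc qinv_qmul D)
    then show ?thesis
      by (simp add: M qmul_assoc NR NR' qmul.diff_left qmul.diff_right)
  qed
  also have "qmul D D - qmul N N = (1 - \<tau>\<^sup>2) *\<^sub>R (qone - qmul q q)"
    by (simp add: D_def N_def qmul_simps algebra_simps power2_eq_square)
  finally have "norm (qone - qmul (mob \<tau> q) (mob \<tau> q)) = (norm R)\<^sup>2 * \<bar>1 - \<tau>\<^sup>2\<bar> * norm (qone - qmul q q)"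
    by (simp add: norm_qmul power2_eq_square)
  then have n1: "(norm (qone - qmul (mob \<tau> q) (mob \<tau> q)))\<^sup>2
      = ((norm R)\<^sup>2)\<^sup>2 * (1 - \<tau>\<^sup>2)\<^sup>2 * (norm (qone - qmul q q))\<^sup>2"
    by (simp add: power_mult_distrib)
  have n2: "1 - (norm (mob \<tau> q))\<^sup>2 = (1 - \<tau>\<^sup>2) * (1 - (norm q)\<^sup>2) * (norm R)\<^sup>2"
    using norm_mob[OF assms(1,2)] by (simp add: R_def norm_qinv power_inverse divide_inverse)
  have "norm R \<noteq> 0" "1 - \<tau>\<^sup>2 \<noteq> 0"
    using D abs_square_less_1[of \<tau>] assms(1) by (auto simp: R qinv_eq_0)
  then have k: "(1 - \<tau>\<^sup>2) ^ 4 * norm R ^ 8 \<noteq> 0"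
    by simp
  have "slice_metric (mob \<tau> q) ((1 - \<tau>\<^sup>2) *\<^sub>R qmul R (qmul \<alpha> R)) ((1 - \<tau>\<^sup>2) *\<^sub>R qmul R (qmul \<beta> R))
      = ((1 - \<tau>\<^sup>2) ^ 4 * norm R ^ 8) * ((\<alpha> - qmul q (qmul \<alpha> q)) \<bullet> (\<beta> - qmul q (qmul \<beta> q)))
      / (((1 - \<tau>\<^sup>2) ^ 4 * norm R ^ 8) * ((norm (qone - qmul q q))\<^sup>2 * (1 - (norm q)\<^sup>2)\<^sup>2))"
    unfolding slice_metric_inner * n1 n2
    by (simp add: inner_qmul_left inner_qmul_right norm_qmul power_mult_distrib)
       (simp add: numeral_eq_Suc mult_ac)
  then show ?thesis
    using k by (simp add: slice_metric_inner)
qed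

section \<open>Derivatives of the action\<close>

lemma has_derivative_qinv:
  assumes "a \<noteq> 0"
  shows "(qinv has_derivative (\<lambda>\<alpha>. - qmul (qinv a) (qmul \<alpha> (qinv a)))) (at a)"
proof -
  have qinv: "qinv = (\<lambda>x. inverse (x \<bullet> x) *\<^sub>R qcnj x)"
    by (simp add: fun_eq_iff qinv_def power2_norm_eq_inner divide_inverse)
  have cnj: "(qcnj has_derivative qcnj) (at a)"
    by (simp add: linear_qcnj linear_imp_has_derivative)
  have a: "a \<bullet> a \<noteq> 0"
    using assms by simp
  have "(qinv has_derivative (\<lambda>\<alpha>. inverse (a \<bullet> a) *\<^sub>R qcnj \<alpha>
      + (- (inverse (a \<bullet> a) * (a \<bullet> \<alpha> + \<alpha> \<bullet> a) * inverse (a \<bullet> a))) *\<^sub>R qcnj a)) (at a)"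
    unfolding qinv by (rule derivative_intros cnj a)+
  moreover have "inverse (a \<bullet> a) *\<^sub>R qcnj \<alpha>
      + (- (inverse (a \<bullet> a) * (a \<bullet> \<alpha> + \<alpha> \<bullet> a) * inverse (a \<bullet> a))) *\<^sub>R qcnj a
      = - qmul (qinv a) (qmul \<alpha> (qinv a))" for \<alpha>
  proof -
    \<comment> \<open>Multiply \<open>cnj a * \<alpha> + cnj \<alpha> * a = 2 * (a \<bullet>
      \<alpha>)\<close> by \<open>cnj a\<close> on the right.\<close>
    have "qmul (qcnj a) (qmul \<alpha> (qcnj a)) = (2 * (a \<bullet> \<alpha>)) *\<^sub>R qcnj a - (a \<bullet> a) *\<^sub>R qcnj \<alpha>"
      by (simp add: quat_eq_iff inner_quat algebra_simps)
    then have "- qmul (qinv a) (qmul \<alpha> (qinv a))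
        = (inverse (a \<bullet> a) * inverse (a \<bullet> a)) *\<^sub>R ((a \<bullet> a) *\<^sub>R qcnj \<alpha> - (2 * (a \<bullet> \<alpha>)) *\<^sub>R qcnj a)"
      by (simp add: qinv qmul.scaleR_left qmul.scaleR_right scaleR_diff_right mult.assoc)
    also have "\<dots> = inverse (a \<bullet> a) *\<^sub>R qcnj \<alpha>
      + (- (inverse (a \<bullet> a) * (a \<bullet> \<alpha> + \<alpha> \<bullet> a) * inverse (a \<bullet> a))) *\<^sub>R qcnj a"
      using a by (simp add: scaleR_diff_right inner_commute[of \<alpha>] mult_ac)
    finally show ?thesis
      by simp
  qed
  ultimately show ?thesis
    by simp
qed

lemma has_derivative_mob:
  assumes "\<bar>\<tau>\<bar> < 1" "q \<in> Bq"
  defines "R \<equiv> qinv (qone + \<tau> *\<^sub>R q)"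
  shows "(mob \<tau> has_derivative (\<lambda>\<alpha>. (1 - \<tau>\<^sup>2) *\<^sub>R qmul R (qmul \<alpha> R))) (at q)"
proof -
  define D N where "D = qone + \<tau> *\<^sub>R q" and "N = q + \<tau> *\<^sub>R qone"
  have D: "D \<noteq> 0"
    unfolding D_def using assms one_add_scaleR_neq_0 by blast
  have R: "R = qinv D"
    by (simp add: R_def D_def)
  have "((\<lambda>q. qone + \<tau> *\<^sub>R q) has_derivative (\<lambda>\<alpha>. \<tau> *\<^sub>R \<alpha>)) (at q)"
    by (auto intro!: derivative_eq_intros)
  then have "((\<lambda>q. qinv (qone + \<tau> *\<^sub>R q)) has_derivative (\<lambda>\<alpha>. - qmul R (qmul (\<tau> *\<^sub>R \<alpha>) R))) (at q)"
    using has_derivative_compose[OF _ has_derivative_qinv] D unfolding R D_def by blast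
  moreover have "((\<lambda>q. q + \<tau> *\<^sub>R qone) has_derivative (\<lambda>\<alpha>. \<alpha>)) (at q)"
    by (auto intro!: derivative_eq_intros)
  ultimately have "((\<lambda>q. qmul (qinv (qone + \<tau> *\<^sub>R q)) (q + \<tau> *\<^sub>R qone)) has_derivative
      (\<lambda>\<alpha>. qmul R \<alpha> + qmul (- qmul R (qmul (\<tau> *\<^sub>R \<alpha>) R)) N)) (at q)"
    unfolding R_def N_def by (rule qmul.FDERIV)
  moreover have "qmul R \<alpha> + qmul (- qmul R (qmul (\<tau> *\<^sub>R \<alpha>) R)) N = (1 - \<tau>\<^sup>2) *\<^sub>R qmul R (qmul \<alpha> R)" for \<alpha>
  proof -
    \<comment> \<open>The product rule yields \<open>R \<alpha> (1 - \<tau> R N)\<close>; this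
      identity turns the bracket into \<open>(1 - \<tau>^2) R\<close> and the derivative into a
      two-sided product.\<close>
    have "D - \<tau> *\<^sub>R N = (1 - \<tau>\<^sup>2) *\<^sub>R qone"
      by (simp add: D_def N_def algebra_simps power2_eq_square)
    then have "qone - \<tau> *\<^sub>R qmul R N = (1 - \<tau>\<^sup>2) *\<^sub>R R"
      by (metis D R qinv_qmul qmul.diff_right qmul.scaleR_right qmul_one(2))
    then have "qmul \<alpha> (qone - \<tau> *\<^sub>R qmul R N) = (1 - \<tau>\<^sup>2) *\<^sub>R qmul \<alpha> R"
      by (simp add: qmul.scaleR_right)
    then have "qmul R (qmul \<alpha> (qone - \<tau> *\<^sub>R qmul R N)) = (1 - \<tau>\<^sup>2) *\<^sub>R qmul R (qmul \<alpha> R)"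
      by (simp add: qmul.scaleR_right)
    then show ?thesis
      by (simp add: qmul_simps qmul.minus_left qmul_assoc)
  qed
  ultimately show ?thesis
    unfolding mob_def[abs_def] by simp
qed

text \<open>The form of a two-sided multiplication serves twice: the metric identity comes with it,
  and its determinant is positive for all nonzero \<open>P\<close> and \<open>R\<close>.\<close>

lemma act_derivative:
  assumes "(u, e, t) \<in> grp" "q \<in> Bq"
  obtains P R where "P \<noteq> 0" "R \<noteq> 0" "(act u e t has_derivative (\<lambda>\<alpha>. qmul P (qmul \<alpha> R))) (at q)"
    "\<And>\<alpha> \<beta>. slice_metric (act u e t q) (qmul P (qmul \<alpha> R)) (qmul P (qmul \<beta> R)) = slice_metric q \<alpha> \<beta>"
proof -
  define \<tau> where "\<tau> = tanh t"
  define D where "D = qinv (qone + \<tau> *\<^sub>R q)"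
  define P where "P = (e * (1 - \<tau>\<^sup>2)) *\<^sub>R qmul u D"
  define R where "R = qmul D (qcnj u)"
  have u: "norm u = 1" and e: "e \<in> {1, -1}"
    using assms by (auto simp: grp_def Sp1_def)
  have \<tau>: "\<bar>\<tau>\<bar> < 1"
    by (simp add: \<tau>_def tanh_abs_less_1)
  have D: "D \<noteq> 0"
    using one_add_scaleR_neq_0[OF \<tau> assms(2)] by (simp add: D_def qinv_eq_0)
  have "u \<noteq> 0" "qcnj u \<noteq> 0" "1 - \<tau>\<^sup>2 \<noteq> 0" "e \<noteq> 0"
    using u e \<tau> norm_qcnj[of u] abs_square_less_1[of \<tau>] by fastforce+
  then have "P \<noteq> 0" "R \<noteq> 0"
    using D by (auto simp: P_def R_def qmul_eq_0)
  moreover have PR: "qmul P (qmul \<alpha> R) = e *\<^sub>R qmul (qmul u ((1 - \<tau>\<^sup>2) *\<^sub>R qmul D (qmul \<alpha> D))) (qcnj u)" for \<alpha>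
    by (simp add: P_def R_def qmul.scaleR_left qmul.scaleR_right qmul_assoc)
  have "bounded_linear (\<lambda>x. e *\<^sub>R qmul (qmul u x) (qcnj u))"
    by (intro bounded_linear_scaleR_right[THEN bounded_linear_compose]
        bounded_linear_compose[OF qmul.bounded_linear_left qmul.bounded_linear_right])
  from bounded_linear.has_derivative[OF this has_derivative_mob[OF \<tau> assms(2)]]
  have "(act u e t has_derivative (\<lambda>\<alpha>. qmul P (qmul \<alpha> R))) (at q)"
    unfolding PR D_def by (simp add: act_mob[abs_def] \<tau>_def)
  moreover have "slice_metric (act u e t q) (qmul P (qmul \<alpha> R)) (qmul P (qmul \<beta> R)) = slice_metric q \<alpha> \<beta>" for \<alpha> \<beta>
    unfolding PR act_mob slice_metric_sign[OF e] slice_metric_conj[OF u]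
    using slice_metric_mob[OF \<tau> assms(2)] by (simp add: \<tau>_def D_def)
  ultimately show thesis
    using that by blast
qed

section \<open>Smoothness and orientation\<close>

text \<open>Rational functions without poles in the ball. The class is closed under directional
  derivatives, so one induction over the list of directions yields smoothness of every
  order.\<close>

inductive_set ratl :: "(quat \<Rightarrow> real) set" where
  const: "(\<lambda>x. c) \<in> ratl"
| coord: "(\<lambda>x. x $ i) \<in> ratl"
| add: "f \<in> ratl \<Longrightarrow> g \<in> ratl \<Longrightarrow> (\<lambda>x. f x + g x) \<in> ratl"
| mult: "f \<in> ratl \<Longrightarrow> g \<in> ratl \<Longrightarrow> (\<lambda>x. f x * g x) \<in> ratl"
| inverse: "f \<in> ratl \<Longrightarrow> (\<And>x. x \<in> Bq \<Longrightarrow> f x \<noteq> 0) \<Longrightarrow> (\<lambda>x. inverse (f x)) \<in> ratl"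

lemma ratl_minus: "f \<in> ratl \<Longrightarrow> (\<lambda>x. - f x) \<in> ratl"
  using ratl.mult[OF ratl.const[of "-1"], of f] by simp

lemma ratl_diff: "f \<in> ratl \<Longrightarrow> g \<in> ratl \<Longrightarrow> (\<lambda>x. f x - g x) \<in> ratl"
  using ratl.add[OF _ ratl_minus, of f g] by simp

lemma ratl_derivative:
  assumes "f \<in> ratl"
  shows "\<exists>F. (\<forall>v. (\<lambda>x. F x v) \<in> ratl) \<and> (\<forall>x\<in>Bq. (f has_derivative F x) (at x))"
  using assms
proof induction
  case (const c)
  show ?case
    by (rule exI[of _ "\<lambda>x v. 0"]) (auto intro: ratl.const)
next
  case (coord i)
  show ?case
    by (rule exI[of _ "\<lambda>x v. v $ i"])
      (auto intro!: ratl.const bounded_linear_imp_has_derivative bounded_linear_vec_nth)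
next
  case (add f g)
  then obtain F G where "\<And>v. (\<lambda>x. F x v) \<in> ratl" "\<And>x. x \<in> Bq \<Longrightarrow> (f has_derivative F x) (at x)"
    and "\<And>v. (\<lambda>x. G x v) \<in> ratl" "\<And>x. x \<in> Bq \<Longrightarrow> (g has_derivative G x) (at x)"
    by blast
  then show ?case
    by (intro exI[of _ "\<lambda>x v. F x v + G x v"]) (auto intro: ratl.add has_derivative_add)
next
  case (mult f g)
  then obtain F G where F: "\<And>v. (\<lambda>x. F x v) \<in> ratl" "\<And>x. x \<in> Bq \<Longrightarrow> (f has_derivative F x) (at x)"
    and G: "\<And>v. (\<lambda>x. G x v) \<in> ratl" "\<And>x. x \<in> Bq \<Longrightarrow> (g has_derivative G x) (at x)"
    by blast
  have "(\<lambda>x. f x * G x v + F x v * g x) \<in> ratl" for v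
    by (rule ratl.add[OF ratl.mult[OF mult.hyps(1) G(1)] ratl.mult[OF F(1) mult.hyps(2)]])
  then show ?case
    using F(2) G(2) by (intro exI[of _ "\<lambda>x v. f x * G x v + F x v * g x"]) (auto intro: has_derivative_mult)
next
  case (inverse f)
  then obtain F where F: "\<And>v. (\<lambda>x. F x v) \<in> ratl" "\<And>x. x \<in> Bq \<Longrightarrow> (f has_derivative F x) (at x)"
    by blast
  have "(\<lambda>x. - (inverse (f x) * F x v * inverse (f x))) \<in> ratl" for v
    by (intro ratl_minus ratl.mult ratl.inverse F inverse.hyps) auto
  moreover have "((\<lambda>x. inverse (f x)) has_derivative (\<lambda>v. - (inverse (f x) * F x v * inverse (f x)))) (at x)"
    if "x \<in> Bq" for x
    using Deriv.has_derivative_inverse[OF inverse.hyps(2)[OF that] F(2)[OF that]] .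
  ultimately show ?case
    by (intro exI[of _ "\<lambda>x v. - (inverse (f x) * F x v * inverse (f x))"]) blast
qed

lemma has_derivative_cart:
  fixes f :: "'a::real_normed_vector \<Rightarrow> real^'n"
  assumes "\<And>i. ((\<lambda>x. f x $ i) has_derivative (\<lambda>v. F v $ i)) (at x)"
  shows "(f has_derivative F) (at x)"
  by (subst has_derivative_componentwise_within)
    (auto simp: Basis_vec_def inner_axis intro: assms)

text \<open>Agreement is required on the ball only, since outside it the map may fail to be
  differentiable and \<open>frechet_derivative\<close> has an arbitrary value.\<close>

definition ratl_on_Bq :: "(quat \<Rightarrow> quat) \<Rightarrow> bool" where
  "ratl_on_Bq f \<longleftrightarrow> (\<forall>i. \<exists>g\<in>ratl. \<forall>x\<in>Bq. f x $ i = g x)"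

lemma ratl_on_Bq_derivative:
  assumes "ratl_on_Bq f"
  shows "f differentiable_on Bq" and "ratl_on_Bq (\<lambda>x. frechet_derivative f (at x) v)"
proof -
  obtain g where g: "\<And>i. g i \<in> ratl" "\<And>i x. x \<in> Bq \<Longrightarrow> f x $ i = g i x"
    using assms unfolding ratl_on_Bq_def by metis
  define G where "G i = (SOME F. (\<forall>v. (\<lambda>x. F x v) \<in> ratl) \<and> (\<forall>x\<in>Bq. (g i has_derivative F x) (at x)))" for i
  have G: "(\<lambda>x. G i x v) \<in> ratl" "x \<in> Bq \<Longrightarrow> (g i has_derivative G i x) (at x)" for i v x
    using someI_ex[OF ratl_derivative[OF g(1)[of i]]] unfolding G_def by blast+
  have f: "(f has_derivative (\<lambda>v. \<chi> i. G i x v)) (at x)" if x: "x \<in> Bq" for x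
  proof (rule has_derivative_cart)
    fix i
    show "((\<lambda>x. f x $ i) has_derivative (\<lambda>v. (\<chi> i. G i x v) $ i)) (at x)"
      using has_derivative_transform_within_open[OF G(2)[OF x] open_Bq x, of i "\<lambda>x. f x $ i"] g(2)
      by simp
  qed
  then show "f differentiable_on Bq"
    unfolding differentiable_on_def by (metis differentiableI differentiable_at_withinI)
  have "frechet_derivative f (at x) v = (\<chi> i. G i x v)" if "x \<in> Bq" for x
    using fun_cong[OF frechet_derivative_at[OF f[OF that]], of v] by simp
  then show "ratl_on_Bq (\<lambda>x. frechet_derivative f (at x) v)"
    unfolding ratl_on_Bq_def by (intro allI bexI[OF _ G(1)[of _ v]]) auto
qed

lemma ratl_on_Bq_smooth:
  assumes "ratl_on_Bq f"
  shows "smooth_on Bq f"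
proof -
  have "ratl_on_Bq (iter_dd vs f)" for vs
    by (induction vs) (auto simp: assms intro: ratl_on_Bq_derivative(2))
  then show ?thesis
    unfolding smooth_on_def using ratl_on_Bq_derivative(1) by blast
qed

lemma ratl_nth_qmul:
  assumes "\<And>i. (\<lambda>x. f x $ i) \<in> ratl" "\<And>i. (\<lambda>x. g x $ i) \<in> ratl"
  shows "(\<lambda>x. qmul (f x) (g x) $ i) \<in> ratl"
proof -
  have "(\<lambda>x. qmul (f x) (g x) $ 1) \<in> ratl" "(\<lambda>x. qmul (f x) (g x) $ 2) \<in> ratl"
    "(\<lambda>x. qmul (f x) (g x) $ 3) \<in> ratl" "(\<lambda>x. qmul (f x) (g x) $ 4) \<in> ratl"
    unfolding qmul_nth by (intro ratl.add ratl_diff ratl.mult assms)+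
  then show ?thesis
    using exhaust_4[of i] by auto
qed

lemma ratl_on_Bq_act:
  assumes "(u, e, t) \<in> grp"
  shows "ratl_on_Bq (act u e t)"
proof -
  define \<tau> where "\<tau> = tanh t"
  have add: "(\<lambda>x. (a + b *\<^sub>R x) $ i) \<in> ratl" for a and b :: real and i :: 4
    by (auto intro!: ratl.intros)
  have "(\<lambda>x. qcnj (qone + \<tau> *\<^sub>R x) $ 1) \<in> ratl" "(\<lambda>x. qcnj (qone + \<tau> *\<^sub>R x) $ 2) \<in> ratl"
    "(\<lambda>x. qcnj (qone + \<tau> *\<^sub>R x) $ 3) \<in> ratl" "(\<lambda>x. qcnj (qone + \<tau> *\<^sub>R x) $ 4) \<in> ratl"
    unfolding qcnj_nth by (intro ratl_minus add)+
  then have cnj: "(\<lambda>x. qcnj (qone + \<tau> *\<^sub>R x) $ i) \<in> ratl" for i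
    using exhaust_4[of i] by auto
  have "(\<lambda>x. (norm (qone + \<tau> *\<^sub>R x))\<^sup>2) \<in> ratl"
    unfolding norm_quat_sq unfolding power2_eq_square by (intro ratl.add ratl.mult add)
  then have "(\<lambda>x. inverse ((norm (qone + \<tau> *\<^sub>R x))\<^sup>2)) \<in> ratl"
    by (rule ratl.inverse) (use one_add_scaleR_neq_0 tanh_abs_less_1 \<tau>_def in auto)
  then have inv: "(\<lambda>x. qinv (qone + \<tau> *\<^sub>R x) $ i) \<in> ratl" for i
    unfolding qinv_def by (auto simp: divide_inverse intro!: ratl.mult cnj)
  have add': "(\<lambda>x. (x + \<tau> *\<^sub>R qone) $ i) \<in> ratl" for i
    by (auto intro!: ratl.intros)
  have "(\<lambda>x. act u e t x $ i) \<in> ratl" for i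
    unfolding act_def \<tau>_def[symmetric] vector_scaleR_component real_scaleR_def
    by (rule ratl.mult ratl.const ratl_nth_qmul inv add')+
  then show ?thesis
    unfolding ratl_on_Bq_def by (metis (mono_tags, lifting))
qed

text \<open>On an open set equality passes to all iterated derivatives. This transfers smoothness to
  \<open>inv_into Bq\<close>, which is known to be an action map only on the ball.\<close>

lemma smooth_on_cong:
  assumes "open S" "\<And>x. x \<in> S \<Longrightarrow> f x = g x" "smooth_on S f"
  shows "smooth_on S g"
proof -
  have eq: "\<forall>x\<in>S. iter_dd vs f x = iter_dd vs g x" for vs
  proof (induction vs)
    case (Cons v vs)
    have "frechet_derivative (iter_dd vs f) (at x) = frechet_derivative (iter_dd vs g) (at x)" if "x \<in> S" for x
    proof -
      have "((iter_dd vs f) has_derivative D) (at x) \<longleftrightarrow> ((iter_dd vs g) has_derivative D) (at x)" for D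
        using has_derivative_transform_within_open[OF _ assms(1) that] Cons by (metis (no_types, lifting))
      then show ?thesis
        unfolding frechet_derivative_def by simp
    qed
    then show ?case
      by simp
  qed (simp add: assms)
  show ?thesis
    using assms(3) unfolding smooth_on_def differentiable_on_def differentiable_def
    by (metis (no_types, lifting) eq has_derivative_transform)
qed

lemma inv_into_act:
  assumes "(u, e, t) \<in> grp" "q \<in> Bq"
  shows "inv_into Bq (act u e t) q = act (qcnj u) e (- (e * t)) q"
proof (rule inv_into_f_eq)
  show "inj_on (act u e t) Bq"
    by (rule inj_on_inverseI) (rule act_inverse(2)[OF assms(1)])
qed (use assms act_inverse act_in_Bq grp_inverse in auto)

lemma bij_act:
  assumes "(u, e, t) \<in> grp"
  shows "bij_betw (act u e t) Bq Bq"
  by (rule bij_betwI[where g = "act (qcnj u) e (- (e * t))"])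
    (use assms act_inverse act_in_Bq grp_inverse in auto)

lemma diffeo_act:
  assumes "(u, e, t) \<in> grp"
  shows "diffeo_B (act u e t)"
proof -
  have "smooth_on Bq (inv_into Bq (act u e t))"
    using smooth_on_cong[OF open_Bq _ ratl_on_Bq_smooth[OF ratl_on_Bq_act[OF grp_inverse[OF assms]]]]
      inv_into_act[OF assms] by metis
  then show ?thesis
    unfolding diffeo_B_def using bij_act assms ratl_on_Bq_smooth ratl_on_Bq_act by blast
qed

section \<open>Orientation\<close>

lemma linear_qmul_left: "linear (\<lambda>x. qmul p x)" and linear_qmul_right: "linear (\<lambda>x. qmul x p)"
  by (simp_all add: bounded_linear.linear qmul.bounded_linear_left qmul.bounded_linear_right)

text \<open>The determinant of \<open>f\<close> is a positive multiple of a square, hence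
  nonnegative, and injectivity excludes zero.\<close>

lemma det_pos_of_square_root:
  fixes f g :: "real^'n \<Rightarrow> real^'n"
  assumes "linear f" "linear g" "\<And>x. g (g x) = c *\<^sub>R f x" "c > 0" "\<And>x. f x = 0 \<Longrightarrow> x = 0"
  shows "det (matrix f) > 0"
proof -
  have "matrix g ** matrix g = matrix (\<lambda>x. c *\<^sub>R f x)"
    using matrix_compose[OF assms(2,2)] by (simp add: o_def assms(3))
  also have "\<dots> = matrix ((*\<^sub>R) c) ** matrix f"
    using matrix_compose[OF assms(1), of "(*\<^sub>R) c"] by (simp add: o_def linear_scale_self)
  finally have "det (matrix g) * det (matrix g) = c ^ CARD('n) * det (matrix f)"
    by (metis det_matrix_scaleR det_mul)
  then have "0 \<le> c ^ CARD('n) * det (matrix f)"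
    by (metis zero_le_square)
  then have "0 \<le> det (matrix f)"
    using assms(4) zero_less_power[of c "CARD('n)"] by (simp add: zero_le_mult_iff) (use zero_less_power[of c "CARD('n)"] in linarith)
  moreover have "det (matrix f) \<noteq> 0"
  proof
    assume "det (matrix f) = 0"
    then show False
      using assms(1,5) by (metis det_nz_iff_inj linear_injective_0)
  qed
  ultimately show ?thesis
    by simp
qed

text \<open>A left or right multiplication is, up to a positive factor, the square of another one, because
  \<^term>\<open>p + norm p *\<^sub>R qone\<close> squares to a positive multiple of \<^term>\<open>p\<close> unless \<^term>\<open>p\<close> is a
  nonpositive real number.\<close>
lemma det_qmul_pos:
  assumes "p \<noteq> 0"
  shows "det (matrix (\<lambda>x. qmul p x)) > 0" and "det (matrix (\<lambda>x. qmul x p)) > 0"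
proof -
  have "\<exists>r c. c > 0 \<and> qmul r r = c *\<^sub>R p"
  proof (cases "p $ 1 + norm p = 0")
    case True
    then have "(p $ 1)\<^sup>2 = (norm p)\<^sup>2"
      by (metis add_eq_0_iff2 power2_minus)
    then have "p $ 2 = 0 \<and> p $ 3 = 0 \<and> p $ 4 = 0"
      unfolding norm_quat_sq by (smt (verit) zero_le_power2 power2_eq_iff zero_eq_power2)
    then have p: "p = (p $ 1) *\<^sub>R qone"
      by (simp add: quat_eq_iff)
    have "p $ 1 < 0"
      using True assms by (smt (verit) zero_less_norm_iff)
    \<comment> \<open>A negative real \<open>p\<close> is a positive multiple of -1, the square of
      the unit \<open>i = axis 2 1\<close>.\<close>
    moreover have "qmul (axis 2 1) (axis 2 1) = - qone"
      by (simp add: quat_eq_iff axis_def)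
    moreover have "(- 1 / p $ 1) *\<^sub>R p = - qone"
      using \<open>p $ 1 < 0\<close> by (subst (2) p) simp
    ultimately show ?thesis
      by (intro exI[of _ "axis 2 1"] exI[of _ "- 1 / p $ 1"]) simp
  next
    case False
    then have "p $ 1 + norm p > 0"
      using nth_1_le_norm[of p] by linarith
    moreover have "qmul (p + norm p *\<^sub>R qone) (p + norm p *\<^sub>R qone) = (2 * (p $ 1 + norm p)) *\<^sub>R p"
      using norm_quat_sq[of p] unfolding quat_eq_iff by (simp add: algebra_simps power2_eq_square)
    ultimately show ?thesis
      by (intro exI[of _ "p + norm p *\<^sub>R qone"] exI[of _ "2 * (p $ 1 + norm p)"]) simp
  qed
  then obtain r c where r: "c > 0" "qmul r r = c *\<^sub>R p"
    by blast
  have "qmul r (qmul r x) = c *\<^sub>R qmul p x" "qmul (qmul x r) r = c *\<^sub>R qmul x p" for x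
    using r(2) by (metis qmul_assoc qmul.scaleR_left, metis qmul_assoc qmul.scaleR_right)
  then show "det (matrix (\<lambda>x. qmul p x)) > 0" and "det (matrix (\<lambda>x. qmul x p)) > 0"
    by (auto intro!: det_pos_of_square_root[OF linear_qmul_left linear_qmul_left _ r(1)]
        det_pos_of_square_root[OF linear_qmul_right linear_qmul_right _ r(1)] simp: qmul_eq_0 assms)
qed

lemma det_qmul_qmul_pos:
  assumes "p \<noteq> 0" "r \<noteq> 0"
  shows "det (matrix (\<lambda>x. qmul p (qmul x r))) > 0"
proof -
  have "matrix (\<lambda>x. qmul p (qmul x r)) = matrix (\<lambda>x. qmul p x) ** matrix (\<lambda>x. qmul x r)"
    using matrix_compose[OF linear_qmul_right linear_qmul_left] by (simp add: o_def)
  then show ?thesis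
    using det_qmul_pos assms by (simp add: det_mul)
qed

lemma frechet_derivative_eqI: "(f has_derivative F) (at x) \<Longrightarrow> frechet_derivative f (at x) = F"
  by (metis frechet_derivative_at)

lemma act_in_Iso_plus:
  assumes "(u, e, t) \<in> grp"
  shows "act u e t \<in> Iso_plus"
proof -
  have "slice_metric (act u e t q) (frechet_derivative (act u e t) (at q) \<alpha>)
      (frechet_derivative (act u e t) (at q) \<beta>) = slice_metric q \<alpha> \<beta>"
    "det (matrix (frechet_derivative (act u e t) (at q))) > 0" if "q \<in> Bq" for q \<alpha> \<beta>
    using act_derivative[OF assms that] det_qmul_qmul_pos by (metis frechet_derivative_eqI)+
  then show ?thesis
    unfolding Iso_plus_def isometry_B_def orient_pres_B_def using diffeo_act[OF assms] by blast
qed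

section \<open>Distances and poles\<close>

lemma tanh_surj:
  assumes "\<bar>x::real\<bar> < 1"
  obtains t where "tanh t = x" "0 \<le> x \<Longrightarrow> 0 \<le> t"
proof -
  \<comment> \<open>\<open>ln y\<close> is the inverse hyperbolic tangent of
    \<open>x\<close>.\<close>
  define y where "y = sqrt ((1 + x) / (1 - x))"
  have y: "y\<^sup>2 = (1 + x) / (1 - x)" "y > 0"
    using assms by (auto simp: y_def)
  have "tanh (ln y) = (y\<^sup>2 - 1) / (y\<^sup>2 + 1)"
    using y(2) by (rule tanh_ln_real)
  also have "\<dots> = x"
    using assms unfolding y(1) by (simp add: field_simps)
  finally show thesis
    using that[of "ln y"] by (metis tanh_real_nonneg_iff)
qed

lemma one_minus_tanh_sq_pos: "0 < 1 - (tanh (t::real))\<^sup>2"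
  using tanh_abs_less_1[of t] by (simp add: abs_square_less_1)

lemma cosh_double_tanh: "cosh (2 * a) = (1 + (tanh a)\<^sup>2) / (1 - (tanh a)\<^sup>2)" for a :: real
proof -
  have c: "cosh a \<noteq> 0" "cosh a ^ 2 - sinh a ^ 2 = 1"
    by (auto simp: hyperbolic_pythagoras)
  have "1 - (tanh a)\<^sup>2 = 1 / (cosh a)\<^sup>2"
    using c(1) by (simp add: tanh_def power_divide diff_divide_eq_iff c(2))
  moreover have "1 + (tanh a)\<^sup>2 = ((cosh a)\<^sup>2 + (sinh a)\<^sup>2) / (cosh a)\<^sup>2"
    using c(1) by (simp add: tanh_def field_simps)
  ultimately show ?thesis
    using c(1) by (simp add: cosh_double)
qed

text \<open>The hyperbolic cosine of the distance from the origin with respect to four times the slice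
  metric, which coincides with that of the Poincare metric of curvature -1.\<close>
definition cosh_dist :: "quat \<Rightarrow> real" where
  "cosh_dist q = (1 + (norm q)\<^sup>2) / (1 - (norm q)\<^sup>2)"

lemma cosh_dist_ge_1: "q \<in> Bq \<Longrightarrow> 1 \<le> cosh_dist q"
  unfolding Bq_norm_sq cosh_dist_def by (simp add: field_simps)

lemma cosh_dist_tanh: "norm e = 1 \<Longrightarrow> cosh_dist (tanh (a/2) *\<^sub>R e) = cosh a"
  using cosh_double_tanh[of "a/2"] by (simp add: cosh_dist_def)

text \<open>A substitute for \<open>dist x y \<le> L\<close> with respect to four times the slice metric: bounding the speed of
  a path on the unit interval instead of its length avoids integrals.\<close>
definition reach :: "real \<Rightarrow> quat \<Rightarrow> quat \<Rightarrow> bool" where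
  "reach L x y \<longleftrightarrow> (\<exists>c c'. c 0 = x \<and> c 1 = y \<and> (\<forall>t\<in>{0..1}. c t \<in> Bq \<and>
     (c has_vector_derivative c' t) (at t within {0..1}) \<and> 4 * slice_metric (c t) (c' t) (c' t) \<le> L\<^sup>2))"

lemma reachI:
  assumes "c 0 = x" "c 1 = y" "\<And>t. t \<in> {0..1} \<Longrightarrow> c t \<in> Bq"
    "\<And>t. t \<in> {0..1} \<Longrightarrow> (c has_vector_derivative c' t) (at t within {0..1})"
    "\<And>t. t \<in> {0..1} \<Longrightarrow> 4 * slice_metric (c t) (c' t) (c' t) \<le> L\<^sup>2"
  shows "reach L x y"
  unfolding reach_def by (rule exI[of _ c], rule exI[of _ c']) (simp add: assms)

lemma reach_in_Bq: "reach L x y \<Longrightarrow> x \<in> Bq" "reach L x y \<Longrightarrow> y \<in> Bq"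
  unfolding reach_def by force+

lemma reach_mono: "reach L x y \<Longrightarrow> 0 \<le> L \<Longrightarrow> L \<le> M \<Longrightarrow> reach M x y"
  unfolding reach_def using order_trans[OF _ power_mono[of L M 2]] by fast

section \<open>Paths under reversal and under isometries\<close>

lemma slice_metric_minus: "slice_metric q (- \<alpha>) (- \<beta>) = slice_metric q \<alpha> \<beta>"
  by (simp add: slice_metric_explicit algebra_simps)

lemma reach_sym:
  assumes "reach L x y"
  shows "reach L y x"
proof -
  obtain c c' where c: "c 0 = x" "c 1 = y" "\<And>t. t \<in> {0..1} \<Longrightarrow> c t \<in> Bq"
    "\<And>t. t \<in> {0..1} \<Longrightarrow> (c has_vector_derivative c' t) (at t within {0..1})"
    "\<And>t. t \<in> {0..1} \<Longrightarrow> 4 * slice_metric (c t) (c' t) (c' t) \<le> L\<^sup>2"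
    using assms unfolding reach_def by blast
  have "((c \<circ> (\<lambda>t. 1 - t)) has_vector_derivative (- 1) *\<^sub>R c' (1 - t)) (at t within {0..1})"
    if "t \<in> {0..1}" for t
  proof (rule vector_diff_chain_within)
    show "((\<lambda>t. 1 - t) has_vector_derivative - 1) (at t within {0..1})"
      by (auto intro!: derivative_eq_intros)
    have "(\<lambda>t::real. 1 - t) ` {0..1} = {0..1}"
      by (auto simp: image_iff intro: bexI[of _ "1 - _"])
    then show "(c has_vector_derivative c' (1 - t)) (at (1 - t) within (\<lambda>t. 1 - t) ` {0..1})"
      using c(4)[of "1 - t"] that by auto
  qed
  then show ?thesis
    using c by (intro reachI[where c = "c \<circ> (\<lambda>t. 1 - t)" and c' = "\<lambda>t. (- 1) *\<^sub>R c' (1 - t)"])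
      (auto simp: slice_metric_minus)
qed

text \<open>An isometry together with its inverse, differentiable once. Unlike
  \<open>isometry_B\<close>, this passes to inverses and compositions by the chain rule alone,
  without higher derivatives. The metric condition is imposed on \<open>f\<close>; for
  \<open>k\<close> it follows.\<close>

definition isometry_pair :: "(quat \<Rightarrow> quat) \<Rightarrow> (quat \<Rightarrow> quat) \<Rightarrow> bool" where
  "isometry_pair f k \<longleftrightarrow> (\<forall>q\<in>Bq. f q \<in> Bq \<and> k (f q) = q \<and> f differentiable at q) \<and>
     (\<forall>q\<in>Bq. k q \<in> Bq \<and> f (k q) = q \<and> k differentiable at q) \<and>
     (\<forall>q\<in>Bq. \<forall>\<alpha> \<beta>. slice_metric (f q) (frechet_derivative f (at q) \<alpha>) (frechet_derivative f (at q) \<beta>)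
        = slice_metric q \<alpha> \<beta>)"

lemma isometry_pairD:
  assumes "isometry_pair f k" "q \<in> Bq"
  shows "f q \<in> Bq" "k (f q) = q" "k q \<in> Bq" "f (k q) = q"
    "(f has_derivative frechet_derivative f (at q)) (at q)"
    "(k has_derivative frechet_derivative k (at q)) (at q)"
    "slice_metric (f q) (frechet_derivative f (at q) \<alpha>) (frechet_derivative f (at q) \<beta>) = slice_metric q \<alpha> \<beta>"
  using assms unfolding isometry_pair_def frechet_derivative_works by blast+

lemma isometry_pair_inverse:
  assumes "isometry_pair f k"
  shows "isometry_pair k f"
proof -
  have "slice_metric (k q) (frechet_derivative k (at q) \<alpha>) (frechet_derivative k (at q) \<beta>) = slice_metric q \<alpha> \<beta>"
    if q: "q \<in> Bq" for q \<alpha> \<beta>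
  proof -
    note D = isometry_pairD[OF assms]
    have "(f \<circ> k has_derivative frechet_derivative f (at (k q)) \<circ> frechet_derivative k (at q)) (at q)"
      by (rule diff_chain_at[OF D(6)[OF q] D(5)[OF D(3)[OF q]]])
    then have "((\<lambda>x. x) has_derivative frechet_derivative f (at (k q)) \<circ> frechet_derivative k (at q)) (at q)"
      by (rule has_derivative_transform_within_open[OF _ open_Bq q]) (simp add: D)
    then have "frechet_derivative f (at (k q)) \<circ> frechet_derivative k (at q) = (\<lambda>x. x)"
      using has_derivative_unique has_derivative_ident by blast
    then have "frechet_derivative f (at (k q)) (frechet_derivative k (at q) v) = v" for v
      by (metis comp_apply)
    then show ?thesis
      using D(7)[OF D(3)[OF q]] D(4)[OF q] by metis
  qed
  then show ?thesis
    using assms unfolding isometry_pair_def by blast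
qed

lemma isometry_pair_comp:
  assumes "isometry_pair f k" "isometry_pair f' k'"
  shows "isometry_pair (f' \<circ> f) (k \<circ> k')"
proof -
  note D = isometry_pairD[OF assms(1)] and D' = isometry_pairD[OF assms(2)]
  have d: "(f' \<circ> f has_derivative frechet_derivative f' (at (f q)) \<circ> frechet_derivative f (at q)) (at q)"
    if "q \<in> Bq" for q
    by (rule diff_chain_at[OF D(5)[OF that] D'(5)[OF D(1)[OF that]]])
  have d': "(k \<circ> k' has_derivative frechet_derivative k (at (k' q)) \<circ> frechet_derivative k' (at q)) (at q)"
    if "q \<in> Bq" for q
    by (rule diff_chain_at[OF D'(6)[OF that] D(6)[OF D'(3)[OF that]]])
  have "f' \<circ> f differentiable at q" "k \<circ> k' differentiable at q" if "q \<in> Bq" for q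
    using d[OF that] d'[OF that] by (blast intro: differentiableI)+
  then show ?thesis
    unfolding isometry_pair_def using D D' by (simp add: frechet_derivative_eqI[OF d])
qed

lemma isometry_B_pair: "isometry_B f \<Longrightarrow> isometry_pair f (inv_into Bq f)"
proof -
  assume f: "isometry_B f"
  have smooth: "h differentiable at q" if "smooth_on Bq h" "q \<in> Bq" for h q
    using that differentiable_on_eq_differentiable_at[OF open_Bq, of h]
    unfolding smooth_on_def by (metis iter_dd.simps(1))
  have bij: "bij_betw f Bq Bq"
    using f unfolding isometry_B_def diffeo_B_def by blast
  show "isometry_pair f (inv_into Bq f)"
    using f bij_betw_apply[OF bij] bij_betw_apply[OF bij_betw_inv_into[OF bij]] smooth
      bij_betw_inv_into_left[OF bij] bij_betw_inv_into_right[OF bij]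
    unfolding isometry_B_def isometry_pair_def diffeo_B_def by blast
qed

lemma act_isometry_pair:
  assumes "(u, e, t) \<in> grp"
  shows "isometry_pair (act u e t) (act (qcnj u) e (- (e * t)))"
proof -
  have "act u e t differentiable at q" if "(u, e, t) \<in> grp" "q \<in> Bq" for u e t q
    using act_derivative[OF that] by (metis differentiableI)
  then show ?thesis
    unfolding isometry_pair_def
    using act_in_Iso_plus[OF assms] act_inverse[OF assms] act_in_Bq assms grp_inverse[OF assms]
    unfolding Iso_plus_def isometry_B_def by blast
qed

lemma reach_isometry:
  assumes "isometry_pair f k" "reach L x y"
  shows "reach L (f x) (f y)"
proof -
  note D = isometry_pairD[OF assms(1)]
  obtain c c' where c: "c 0 = x" "c 1 = y" "\<And>t. t \<in> {0..1} \<Longrightarrow> c t \<in> Bq"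
    "\<And>t. t \<in> {0..1} \<Longrightarrow> (c has_vector_derivative c' t) (at t within {0..1})"
    "\<And>t. t \<in> {0..1} \<Longrightarrow> 4 * slice_metric (c t) (c' t) (c' t) \<le> L\<^sup>2"
    using assms unfolding reach_def by blast
  have "((f \<circ> c) has_vector_derivative frechet_derivative f (at (c t)) (c' t)) (at t within {0..1})"
    if t: "t \<in> {0..1}" for t
  proof -
    have lin: "linear (frechet_derivative f (at (c t)))"
      using D(5) c(3)[OF t] has_derivative_linear by blast
    have "((f \<circ> c) has_derivative frechet_derivative f (at (c t)) \<circ> (\<lambda>s. s *\<^sub>R c' t)) (at t within {0..1})"
      using c(4)[OF t] D(5)[OF c(3)[OF t]] unfolding has_vector_derivative_def
      by (intro diff_chain_within) (auto intro: has_derivative_at_withinI)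
    then show ?thesis
      by (simp add: has_vector_derivative_def o_def linear_scale[OF lin])
  qed
  then show ?thesis
    using c D by (intro reachI[where c = "f \<circ> c" and c' = "\<lambda>t. frechet_derivative f (at (c t)) (c' t)"]) auto
qed

text \<open>Pair \<open>\<alpha> - q \<alpha> q\<close> with \<open>q (1 - q^2)\<close>: the result
  is \<open>q \<bullet> \<alpha>\<close> times the squared norm of \<open>1 - q^2\<close>, and
  Cauchy-Schwarz applies. The bound says that the distance from the origin changes no faster than
  the speed of a path.\<close>

lemma inner_sq_le_slice_metric:
  assumes "q \<in> Bq"
  shows "(q \<bullet> \<alpha>)\<^sup>2 \<le> (norm q)\<^sup>2 * (1 - (norm q)\<^sup>2)\<^sup>2 * slice_metric q \<alpha> \<alpha>"
proof -
  define N where "N = \<alpha> - qmul q (qmul \<alpha> q)"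
  define W where "W = (norm (qone - qmul q q))\<^sup>2"
  define m where "m = (1 - (norm q)\<^sup>2)\<^sup>2"
  have m: "m > 0" and W: "W > 0"
    using assms unfolding W_def m_def norm_one_minus_sq Bq_norm_sq
    by (auto intro!: add_pos_nonneg simp: nth_1_sq_le)
  have "N \<bullet> qmul q (qone - qmul q q) = (q \<bullet> \<alpha>) * W"
    unfolding N_def W_def norm_quat_sq inner_quat vector_minus_component qmul_nth qone_nth by algebra
  moreover have "(N \<bullet> qmul q (qone - qmul q q))\<^sup>2 \<le> (N \<bullet> N) * ((norm q)\<^sup>2 * W)"
    using Cauchy_Schwarz_ineq[of N "qmul q (qone - qmul q q)"]
    by (simp add: W_def norm_qmul power_mult_distrib flip: power2_norm_eq_inner)
  ultimately have "(q \<bullet> \<alpha>)\<^sup>2 * W * W \<le> (norm q)\<^sup>2 * (N \<bullet> N) * W"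
    by (simp add: power_mult_distrib power2_eq_square mult_ac)
  then have "(q \<bullet> \<alpha>)\<^sup>2 * W \<le> (norm q)\<^sup>2 * (N \<bullet> N)"
    using W by simp
  moreover have "slice_metric q \<alpha> \<alpha> = (N \<bullet> N) / (W * m)"
    by (simp add: slice_metric_inner N_def W_def m_def)
  ultimately show ?thesis
    using m W by (simp add: m_def[symmetric] pos_le_divide_eq)
qed

text \<open>Along the path, \<open>T = cosh_dist\<close> satisfies
  \<open>|T'| \<le> L * sqrt (T^2 - 1)\<close>, which says that \<open>arcosh T\<close> has
  Lipschitz constant \<open>L\<close>.\<close>

lemma reach_lower_bound:
  assumes "reach L 0 y" "0 \<le> L"
  shows "cosh_dist y \<le> cosh L"
proof -
  obtain c c' where c: "c 0 = 0" "c 1 = y" "\<And>t. t \<in> {0..1} \<Longrightarrow> c t \<in> Bq"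
    "\<And>t. t \<in> {0..1} \<Longrightarrow> (c has_vector_derivative c' t) (at t within {0..1})"
    "\<And>t. t \<in> {0..1} \<Longrightarrow> 4 * slice_metric (c t) (c' t) (c' t) \<le> L\<^sup>2"
    using assms unfolding reach_def by blast
  define T where "T t = cosh_dist (c t)" for t
  define T' where "T' t = 4 * (c t \<bullet> c' t) / (1 - (norm (c t))\<^sup>2)\<^sup>2" for t
  have n: "1 - (norm (c t))\<^sup>2 > 0" if "t \<in> {0..1}" for t
    using c(3)[OF that] by (simp add: Bq_norm_sq)
  have T: "(T has_field_derivative T' t) (at t within {0..1})" if t: "t \<in> {0..1}" for t
  proof -
    have "((\<lambda>t. c t \<bullet> c t) has_vector_derivative (c t \<bullet> c' t + c' t \<bullet> c t)) (at t within {0..1})"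
      using bounded_bilinear.has_vector_derivative[OF bounded_bilinear_inner c(4)[OF t] c(4)[OF t]] .
    then have N: "((\<lambda>t. c t \<bullet> c t) has_field_derivative 2 * (c t \<bullet> c' t)) (at t within {0..1})"
      by (simp add: has_real_derivative_iff_has_vector_derivative inner_commute)
    have "((\<lambda>t. (1 + c t \<bullet> c t) / (1 - c t \<bullet> c t)) has_field_derivative
        ((0 + 2 * (c t \<bullet> c' t)) * (1 - c t \<bullet> c t) - (1 + c t \<bullet> c t) * (0 - 2 * (c t \<bullet> c' t)))
        / ((1 - c t \<bullet> c t) * (1 - c t \<bullet> c t))) (at t within {0..1})"
      using n[OF t] by (intro DERIV_divide DERIV_add DERIV_diff DERIV_const N) (simp add: power2_norm_eq_inner)
    then show ?thesis
      unfolding T_def[abs_def] T'_def cosh_dist_def power2_norm_eq_inner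
      by (simp add: power2_eq_square algebra_simps)
  qed
  have T'_le: "\<bar>T' t\<bar> \<le> L * sqrt ((T t)\<^sup>2 - 1)" if t: "t \<in> {0..1}" for t
  proof -
    define N where "N = (norm (c t))\<^sup>2"
    have N: "1 - N > 0" "N \<ge> 0"
      using n[OF t] by (auto simp: N_def)
    have TN: "(T t)\<^sup>2 - 1 = 4 * N / (1 - N)\<^sup>2"
    proof -
      have "((1 + N) / (1 - N))\<^sup>2 - 1 = ((1 + N)\<^sup>2 - (1 - N)\<^sup>2) / (1 - N)\<^sup>2"
        using N by (simp add: power_divide diff_divide_distrib)
      also have "(1 + N)\<^sup>2 - (1 - N)\<^sup>2 = 4 * N"
        by algebra
      finally show ?thesis
        unfolding T_def cosh_dist_def N_def .
    qed
    have "(c t \<bullet> c' t)\<^sup>2 \<le> N * (1 - N)\<^sup>2 * slice_metric (c t) (c' t) (c' t)"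
      unfolding N_def by (rule inner_sq_le_slice_metric[OF c(3)[OF t]])
    also have "\<dots> \<le> N * (1 - N)\<^sup>2 * (L\<^sup>2 / 4)"
      using c(5)[OF t] N by (intro mult_left_mono) auto
    finally have "16 * (c t \<bullet> c' t)\<^sup>2 / ((1 - N)\<^sup>2)\<^sup>2 \<le> 16 * (N * (1 - N)\<^sup>2 * (L\<^sup>2 / 4)) / ((1 - N)\<^sup>2)\<^sup>2"
      by (intro divide_right_mono) (simp_all add: mult_ac)
    also have "\<dots> = L\<^sup>2 * ((T t)\<^sup>2 - 1)"
    proof -
      have eq: "16 * (N * m * (l / 4)) / m\<^sup>2 = l * (4 * N / m)" if "m \<noteq> 0" for m l :: real
        using that by (simp add: power2_eq_square)
      then show ?thesis
        unfolding TN using N by (intro eq) simp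
    qed
    finally have "(T' t)\<^sup>2 \<le> L\<^sup>2 * ((T t)\<^sup>2 - 1)"
      by (simp add: T'_def N_def power_divide power_mult_distrib)
    then show ?thesis
      using assms(2) by (metis abs_le_square_iff abs_of_nonneg real_sqrt_abs real_sqrt_le_mono real_sqrt_mult real_sqrt_pow2_iff)
  qed
  have T1: "T t \<ge> 1" if "t \<in> {0..1}" for t
    using cosh_dist_ge_1[OF c(3)[OF that]] by (simp add: T_def)
  \<comment> \<open>The path starts at \<open>T 0 = 1\<close>, where \<open>arcosh\<close> is not
    differentiable. Adding \<open>\<epsilon>\<close> avoids this point and only enlarges the square
    root; afterwards \<open>\<epsilon>\<close> tends to 0.\<close>
  have step: "T 1 + \<epsilon> \<le> cosh (arcosh (1 + \<epsilon>) + L)" if \<epsilon>: "\<epsilon> > 0" for \<epsilon>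
  proof -
    have "norm (arcosh (T 1 + \<epsilon>) - arcosh (T 0 + \<epsilon>)) \<le> L * norm (1 - 0 :: real)"
    proof (rule field_differentiable_bound[where f = "\<lambda>t. arcosh (T t + \<epsilon>)" and S = "{0..1}"
          and f' = "\<lambda>t. T' t / sqrt ((T t + \<epsilon>)\<^sup>2 - 1)"])
      fix t :: real assume t: "t \<in> {0..1}"
      have gt: "T t + \<epsilon> > 1"
        using T1[OF t] \<epsilon> by simp
      show "((\<lambda>t. arcosh (T t + \<epsilon>)) has_field_derivative T' t / sqrt ((T t + \<epsilon>)\<^sup>2 - 1)) (at t within {0..1})"
      proof -
        have "((\<lambda>t. T t + \<epsilon>) has_field_derivative T' t) (at t within {0..1})"
          using DERIV_add[OF T[OF t] DERIV_const] by simp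
        from DERIV_chain2[OF arcosh_real_has_field_derivative[OF gt] this] show ?thesis
          by simp
      qed
      have pos: "sqrt ((T t + \<epsilon>)\<^sup>2 - 1) > 0"
        using gt by (simp add: one_less_power)
      have "(T t)\<^sup>2 \<le> (T t + \<epsilon>)\<^sup>2"
        using T1[OF t] \<epsilon> by (intro power_mono) auto
      then have "L * sqrt ((T t)\<^sup>2 - 1) \<le> L * sqrt ((T t + \<epsilon>)\<^sup>2 - 1)"
        using assms(2) by (intro mult_left_mono) auto
      then show "norm (T' t / sqrt ((T t + \<epsilon>)\<^sup>2 - 1)) \<le> L"
        using T'_le[OF t] pos by (simp add: divide_le_eq)
    qed auto
    moreover have "T 0 = 1"
      by (simp add: T_def cosh_dist_def c(1))
    ultimately have "arcosh (T 1 + \<epsilon>) \<le> arcosh (1 + \<epsilon>) + L"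
      by simp
    moreover have "0 \<le> arcosh (T 1 + \<epsilon>)"
      using T1[of 1] \<epsilon> by (intro arcosh_nonneg_real) auto
    ultimately have "cosh (arcosh (T 1 + \<epsilon>)) \<le> cosh (arcosh (1 + \<epsilon>) + L)"
      by (subst cosh_real_nonneg_le_iff) auto
    then show ?thesis
      using T1[of 1] \<epsilon> by simp
  qed
  have arc: "(arcosh \<longlongrightarrow> 0) (at_right (1::real))"
    by (rule tendsto_arcosh_at_left_1)
  have "((\<lambda>x. cosh (arcosh x + L)) \<longlongrightarrow> cosh (0 + L)) (at_right 1)"
    by (intro tendsto_intros arc)
  moreover have "eventually (\<lambda>x. T 1 \<le> cosh (arcosh x + L)) (at_right 1)"
  proof (rule eventually_at_right_less[THEN eventually_mono])
    fix x :: real assume "1 < x"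
    then show "T 1 \<le> cosh (arcosh x + L)"
      using step[of "x - 1"] by simp
  qed
  ultimately have "T 1 \<le> cosh (0 + L)"
    by (intro tendsto_lowerbound) auto
  then show ?thesis
    by (simp add: T_def c(2))
qed

text \<open>A diameter lies in one slice, so the numerator contains the factor that belongs to
  \<open>1 - q^2\<close>, and the two cancel. The result is independent of the direction
  \<open>e\<close>.\<close>

lemma slice_metric_radial:
  assumes "norm e = 1" "\<bar>\<mu>\<bar> < 1"
  shows "slice_metric (\<mu> *\<^sub>R e) (\<nu> *\<^sub>R e) (\<nu> *\<^sub>R e) = \<nu>\<^sup>2 / (1 - \<mu>\<^sup>2)\<^sup>2"
proof -
  define w where "w = 1 - (e $ 1)\<^sup>2"
  have e: "e \<bullet> e = 1"
    using assms(1) by (simp flip: power2_norm_eq_inner)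
  have "w \<ge> 0"
    using nth_1_sq_le[of e] assms(1) by (simp add: w_def)
  moreover have m: "1 - \<mu>\<^sup>2 > 0"
    using assms(2) by (simp add: abs_square_less_1)
  ultimately have pos: "(1 - \<mu>\<^sup>2)\<^sup>2 + 4 * (\<mu>\<^sup>2 * w) > 0"
    by (intro add_pos_nonneg) auto
  have "slice_metric (\<mu> *\<^sub>R e) (\<nu> *\<^sub>R e) (\<nu> *\<^sub>R e)
    = ((1 - \<mu>\<^sup>2)\<^sup>2 * \<nu>\<^sup>2 + 4 * (\<mu>\<^sup>2 * w) * (\<nu> * e $ 1)\<^sup>2 + 4 * (\<mu> * \<nu> * w)\<^sup>2)
      / (((1 - \<mu>\<^sup>2)\<^sup>2 + 4 * (\<mu>\<^sup>2 * w)) * (1 - \<mu>\<^sup>2)\<^sup>2)"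
    using e assms(1) by (simp add: slice_metric_explicit w_def power2_eq_square algebra_simps)
  also have "(1 - \<mu>\<^sup>2)\<^sup>2 * \<nu>\<^sup>2 + 4 * (\<mu>\<^sup>2 * w) * (\<nu> * e $ 1)\<^sup>2 + 4 * (\<mu> * \<nu> * w)\<^sup>2
      = \<nu>\<^sup>2 * ((1 - \<mu>\<^sup>2)\<^sup>2 + 4 * (\<mu>\<^sup>2 * w))"
    unfolding w_def by algebra
  finally show ?thesis
    using pos m by simp
qed

text \<open>Radial motion at unit speed. The halves come from the factor four: the point
  \<open>tanh (a/2) *\<^sub>R e\<close> lies at distance \<open>a\<close> from 0 for
  \<open>a \<ge> 0\<close>.\<close>

lemma reach_radial:
  assumes "norm e = 1"
  shows "reach r (tanh (a/2) *\<^sub>R e) (tanh ((a + r)/2) *\<^sub>R e)"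
proof (rule reachI[where c = "\<lambda>t. tanh ((a + t * r)/2) *\<^sub>R e"
      and c' = "\<lambda>t. ((1 - (tanh ((a + t * r)/2))\<^sup>2) * (r/2)) *\<^sub>R e"])
  fix t :: real assume "t \<in> {0..1}"
  have t: "\<bar>tanh ((a + t * r)/2)\<bar> < 1"
    by (rule tanh_abs_less_1)
  then show "tanh ((a + t * r)/2) *\<^sub>R e \<in> Bq"
    using assms by (simp add: Bq_iff)
  show "((\<lambda>t. tanh ((a + t * r)/2) *\<^sub>R e) has_vector_derivative ((1 - (tanh ((a + t * r)/2))\<^sup>2) * (r/2)) *\<^sub>R e)
      (at t within {0..1})"
    by (auto intro!: derivative_eq_intros has_vector_derivative_scaleR[THEN has_vector_derivative_eq_rhs] simp flip: has_real_derivative_iff_has_vector_derivative)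
  show "4 * slice_metric (tanh ((a + t * r)/2) *\<^sub>R e) (((1 - (tanh ((a + t * r)/2))\<^sup>2) * (r/2)) *\<^sub>R e)
      (((1 - (tanh ((a + t * r)/2))\<^sup>2) * (r/2)) *\<^sub>R e) \<le> r\<^sup>2"
    using one_minus_tanh_sq_pos[of "(a + t * r)/2"]
    by (simp add: slice_metric_radial[OF assms t] power_mult_distrib power_divide)
qed auto

lemma Bq_radial:
  assumes "x \<in> Bq"
  obtains a e where "0 \<le> a" "norm e = 1" "x = tanh (a/2) *\<^sub>R e"
proof -
  obtain e where e: "norm e = 1" "x = norm x *\<^sub>R e"
  proof (cases "x = 0")
    case False
    then show ?thesis
      by (intro that[of "x /\<^sub>R norm x"]) auto
  qed (use that[of qone] in auto)
  obtain t where "tanh t = norm x" "0 \<le> t"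
    using tanh_surj[of "norm x"] assms by (auto simp: Bq_iff)
  then show ?thesis
    using that[of "2 * t" e] e by simp
qed

lemma reach_0_iff:
  assumes "x \<in> Bq" "0 \<le> L"
  shows "reach L 0 x \<longleftrightarrow> cosh_dist x \<le> cosh L"
proof
  obtain a e where a: "0 \<le> a" "norm e = 1" "x = tanh (a/2) *\<^sub>R e"
    using Bq_radial[OF assms(1)] .
  assume "cosh_dist x \<le> cosh L"
  then have "a \<le> L"
    using a assms(2) by (simp add: cosh_dist_tanh cosh_real_nonneg_le_iff)
  moreover have "reach a 0 x"
    using reach_radial[OF a(2), of a 0] a(3) by simp
  ultimately show "reach L 0 x"
    using a(1) reach_mono by blast
qed (use reach_lower_bound assms in blast)

text \<open>Every minimising path issuing from \<open>p\<close> extends to a minimising ray. The variable \<open>l\<close> ranges over the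
  lower bounds for the distance from \<open>p\<close> to \<open>x\<close>.\<close>
definition pole :: "quat \<Rightarrow> bool" where
  "pole p \<longleftrightarrow> (\<forall>x\<in>Bq. \<forall>l. (\<forall>L\<ge>0. reach L p x \<longrightarrow> l \<le> L) \<longrightarrow>
     (\<forall>r\<ge>0. \<exists>y. reach r x y \<and> (\<forall>L\<ge>0. reach L p y \<longrightarrow> l + r \<le> L)))"

lemma pole_isometry:
  assumes f: "isometry_pair f k" and p: "p \<in> Bq" "pole p"
  shows "pole (f p)"
  unfolding pole_def
proof (intro ballI allI impI)
  note D = isometry_pairD[OF f] and k = isometry_pair_inverse[OF f]
  fix x l r assume x: "x \<in> Bq" and l: "\<forall>L\<ge>0. reach L (f p) x \<longrightarrow> l \<le> L" and r: "0 \<le> (r::real)"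
  have "\<forall>L\<ge>0. reach L p (k x) \<longrightarrow> l \<le> L"
    using l reach_isometry[OF f, of _ p "k x"] D(4)[OF x] by simp
  then obtain y where y: "reach r (k x) y" "\<forall>L\<ge>0. reach L p y \<longrightarrow> l + r \<le> L"
    using p(2) D(3)[OF x] r unfolding pole_def by blast
  have "reach r x (f y)"
    using reach_isometry[OF f y(1)] D(4)[OF x] by simp
  moreover have "\<forall>L\<ge>0. reach L (f p) (f y) \<longrightarrow> l + r \<le> L"
    using y(2) reach_isometry[OF k, of _ "f p" "f y"] D(2)[OF p(1)] D(2)[OF reach_in_Bq(2)[OF y(1)]] by auto
  ultimately show "\<exists>y. reach r x y \<and> (\<forall>L\<ge>0. reach L (f p) y \<longrightarrow> l + r \<le> L)"
    by blast
qed

text \<open>Radii attain the lower bound for the distance from 0, so the required \<open>y\<close>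
  lies further out on the radius through \<open>x\<close>.\<close>

lemma pole_0: "pole 0"
  unfolding pole_def
proof (intro ballI allI impI)
  fix x l r assume x: "x \<in> Bq" and l: "\<forall>L\<ge>0. reach L 0 x \<longrightarrow> l \<le> L" and r: "0 \<le> (r::real)"
  obtain a e where a: "0 \<le> a" "norm e = 1" "x = tanh (a/2) *\<^sub>R e"
    using Bq_radial[OF x] .
  have "l \<le> a"
    using reach_radial[OF a(2), of a 0] a l by simp
  moreover have "a + r \<le> L" if "0 \<le> L" "reach L 0 (tanh ((a + r)/2) *\<^sub>R e)" for L
    using reach_lower_bound[OF that(2,1)] a r that(1)
    by (simp add: cosh_dist_tanh cosh_real_nonneg_le_iff)
  ultimately show "\<exists>y. reach r x y \<and> (\<forall>L\<ge>0. reach L 0 y \<longrightarrow> l + r \<le> L)"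
    using reach_radial[OF a(2), of r a] a(3) by force
qed

section \<open>The real axis is the set of poles\<close>

text \<open>In the coordinates \<open>(T, A, B)\<close> on the hyperboloid \<open>T\<^sup>2 = 1 + A\<^sup>2 + B\<^sup>2\<close> and a unit imaginary
  quaternion \<open>J\<close>, four times the slice metric is the sum of the hyperbolic metric of a half-plane
  and of \<open>B\<^sup>2 / (1 + B\<^sup>2)\<close> times the round metric of the sphere of the \<open>J\<close>'s.\<close>
lemma slice_metric_hyperboloid:
  fixes J K :: quat
  assumes "T \<ge> 1" "T\<^sup>2 = 1 + A\<^sup>2 + B\<^sup>2" "T * \<tau> = A * a + B * b"
    and "J $ 1 = 0" "norm J = 1" "K $ 1 = 0" "J \<bullet> K = 0"
  defines "q \<equiv> (1 / (1 + T)) *\<^sub>R (A *\<^sub>R qone + B *\<^sub>R J)"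
    and "\<alpha> \<equiv> (1 / (1 + T)) *\<^sub>R (a *\<^sub>R qone + b *\<^sub>R J + B *\<^sub>R K) - (\<tau> / (1 + T)\<^sup>2) *\<^sub>R (A *\<^sub>R qone + B *\<^sub>R J)"
  shows "4 * slice_metric q \<alpha> \<alpha> = a\<^sup>2 + b\<^sup>2 - \<tau>\<^sup>2 + B\<^sup>2 / (1 + B\<^sup>2) * (K \<bullet> K)"
    and "(norm q)\<^sup>2 = (T - 1) / (T + 1)" and "q \<in> Bq"
proof -
  \<comment> \<open>\<open>q\<close> is the stereographic image of \<open>(T, A, B)\<close> with
    scale \<open>s\<close>; \<open>a1\<close> and \<open>b1\<close> are the derivatives of
    \<open>s * A\<close> and \<open>s * B\<close>, because \<open>s\<close> has derivative
    \<open>- \<tau> * s^2\<close>.\<close>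
  define s where "s = 1 / (1 + T)"
  define a1 where "a1 = s * a - \<tau> * s\<^sup>2 * A"
  define b1 where "b1 = s * b - \<tau> * s\<^sup>2 * B"
  have s: "s > 0" "s * (1 + T) = 1"
    using assms(1) by (auto simp: s_def)
  have J: "J \<bullet> J = 1" "qone \<bullet> J = 0" "qone \<bullet> K = 0" "J \<bullet> qone = 0" "K \<bullet> qone = 0" "K \<bullet> J = 0"
    using assms(4-7) by (auto simp: inner_quat[of qone] inner_quat[of _ qone] inner_commute simp flip: power2_norm_eq_inner)
  have one: "qone \<bullet> qone = 1"
    by (simp add: inner_quat)
  have q: "q = (s * A) *\<^sub>R qone + (s * B) *\<^sub>R J"
    by (simp add: q_def s_def scaleR_add_right)
  have \<alpha>: "\<alpha> = a1 *\<^sub>R qone + b1 *\<^sub>R J + (s * B) *\<^sub>R K"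
    by (simp add: \<alpha>_def s_def a1_def b1_def algebra_simps power_divide)
  have n: "(norm q)\<^sup>2 = s\<^sup>2 * (A\<^sup>2 + B\<^sup>2)"
    unfolding power2_norm_eq_inner q using J one assms(7) by (simp add: inner_add_left inner_add_right power2_eq_square algebra_simps)
  also have "A\<^sup>2 + B\<^sup>2 = (T - 1) * (1 + T)"
    using assms(2) by (simp add: power2_eq_square algebra_simps)
  finally have n': "(norm q)\<^sup>2 = s * (T - 1)"
    using s(2) by (simp add: power2_eq_square)
  then show "(norm q)\<^sup>2 = (T - 1) / (T + 1)"
    by (simp add: s_def add.commute)
  then show "q \<in> Bq"
    using assms(1) by (simp add: Bq_norm_sq)
  have m: "1 - (norm q)\<^sup>2 = 2 * s"
    unfolding n' using s(2) by (simp add: algebra_simps)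
  have q1: "q $ 1 = s * A" and \<alpha>1: "\<alpha> $ 1 = a1"
    using assms(4,6) by (simp_all add: q \<alpha>)
  have w: "(norm q)\<^sup>2 - (q $ 1)\<^sup>2 = s\<^sup>2 * B\<^sup>2"
    unfolding n q1 by (simp add: power_mult_distrib algebra_simps)
  have q\<alpha>: "q \<bullet> \<alpha> - q $ 1 * \<alpha> $ 1 = s * B * b1"
    unfolding q1 \<alpha>1 unfolding q \<alpha> using J one assms(7) by (simp add: inner_add_left inner_add_right algebra_simps)
  have \<alpha>\<alpha>: "\<alpha> \<bullet> \<alpha> = a1\<^sup>2 + b1\<^sup>2 + s\<^sup>2 * B\<^sup>2 * (K \<bullet> K)"
    unfolding \<alpha> using J one assms(7) by (simp add: inner_add_left inner_add_right power2_eq_square algebra_simps)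
  have "slice_metric q \<alpha> \<alpha> = ((2 * s)\<^sup>2 * (a1\<^sup>2 + b1\<^sup>2 + s\<^sup>2 * B\<^sup>2 * (K \<bullet> K)) + 4 * (s\<^sup>2 * B\<^sup>2) * (a1 * a1)
      + 4 * (s * B * b1) * (s * B * b1)) / (((2 * s)\<^sup>2 + 4 * (s\<^sup>2 * B\<^sup>2)) * (2 * s)\<^sup>2)"
    by (simp only: slice_metric_explicit m w \<alpha>\<alpha> q\<alpha>[unfolded \<alpha>1] \<alpha>1)
  also have "\<dots> = (4 * s\<^sup>2) * ((1 + B\<^sup>2) * (a1\<^sup>2 + b1\<^sup>2) + s\<^sup>2 * B\<^sup>2 * (K \<bullet> K)) / ((4 * s\<^sup>2) * ((1 + B\<^sup>2) * (4 * s\<^sup>2)))"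
    by (rule arg_cong2[where f = "(/)"]) (simp_all add: power2_eq_square algebra_simps)
  also have "\<dots> = ((1 + B\<^sup>2) * (a1\<^sup>2 + b1\<^sup>2) + s\<^sup>2 * B\<^sup>2 * (K \<bullet> K)) / ((1 + B\<^sup>2) * (4 * s\<^sup>2))"
    by (rule mult_divide_mult_cancel_left) (use s in simp)
  also have "4 * \<dots> = (a1\<^sup>2 + b1\<^sup>2) / s\<^sup>2 + B\<^sup>2 / (1 + B\<^sup>2) * (K \<bullet> K)"
  proof -
    have "4 * (((1 + B\<^sup>2) * p + S * B\<^sup>2 * k) / ((1 + B\<^sup>2) * (4 * S))) = p / S + B\<^sup>2 / (1 + B\<^sup>2) * k"
      if "S > 0" for p S k
    proof -
      have "1 + B\<^sup>2 \<noteq> 0"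
        using zero_le_power2[of B] by linarith
      then show ?thesis
        using that by (simp add: divide_simps) (simp add: algebra_simps)
    qed
    then show ?thesis
      using s by simp
  qed
  also have "(a1\<^sup>2 + b1\<^sup>2) / s\<^sup>2 = a\<^sup>2 + b\<^sup>2 - \<tau>\<^sup>2"
  proof -
    have "a1\<^sup>2 + b1\<^sup>2 = s\<^sup>2 * (a\<^sup>2 + b\<^sup>2 - 2 * \<tau> * s * (A * a + B * b) + \<tau>\<^sup>2 * s\<^sup>2 * (A\<^sup>2 + B\<^sup>2))"
      unfolding a1_def b1_def by algebra
    also have "\<tau>\<^sup>2 * s\<^sup>2 * (A\<^sup>2 + B\<^sup>2) = \<tau>\<^sup>2 * (s * (T - 1))"
      using n n' by (simp add: mult.assoc)
    also have "a\<^sup>2 + b\<^sup>2 - 2 * \<tau> * s * (A * a + B * b) + \<tau>\<^sup>2 * (s * (T - 1)) = a\<^sup>2 + b\<^sup>2 - \<tau>\<^sup>2 * (s * (1 + T))"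
      unfolding assms(3)[symmetric] by (simp add: power2_eq_square algebra_simps)
    finally show ?thesis
      using s by simp
  qed
  finally show "4 * slice_metric q \<alpha> \<alpha> = a\<^sup>2 + b\<^sup>2 - \<tau>\<^sup>2 + B\<^sup>2 / (1 + B\<^sup>2) * (K \<bullet> K)" .
qed

text \<open>Inverse stereographic projection. The sign of \<open>B\<close> places all points in one
  half-plane; for real \<open>x\<close> the unit \<open>J\<close> is an arbitrary choice.\<close>

lemma hyperboloid_coords:
  assumes "x \<in> Bq"
  obtains A B J where "0 \<le> B" "J $ 1 = 0" "norm J = 1" "(cosh_dist x)\<^sup>2 = 1 + A\<^sup>2 + B\<^sup>2"
    "x = (1 / (1 + cosh_dist x)) *\<^sub>R (A *\<^sub>R qone + B *\<^sub>R J)" "x $ 1 = 0 \<Longrightarrow> A = 0"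
proof -
  define v where "v = x - x $ 1 *\<^sub>R qone"
  obtain J where J: "J $ 1 = 0" "norm J = 1" "v = norm v *\<^sub>R J"
  proof (cases "v = 0")
    case True
    then show ?thesis
      by (intro that[of "axis 2 1"]) (simp_all add: axis_def norm_eq_sqrt_inner inner_quat)
  next
    case False
    then show ?thesis
      by (intro that[of "v /\<^sub>R norm v"]) (auto simp: v_def)
  qed
  define m where "m = 1 - (norm x)\<^sup>2"
  have m: "m > 0"
    using assms by (simp add: m_def Bq_norm_sq)
  have T: "1 + cosh_dist x = 2 / m"
    using m by (simp add: cosh_dist_def m_def field_simps)
  have nv: "(norm v)\<^sup>2 = (norm x)\<^sup>2 - (x $ 1)\<^sup>2"
    unfolding norm_quat_sq by (simp add: v_def)
  have T': "cosh_dist x = (2 - m) / m"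
    by (simp add: cosh_dist_def m_def)
  have "(cosh_dist x)\<^sup>2 = 1 + (2 * x $ 1 / m)\<^sup>2 + (2 * norm v / m)\<^sup>2"
  proof -
    have "(2 - m)\<^sup>2 = m\<^sup>2 + (2 * x $ 1)\<^sup>2 + (2 * norm v)\<^sup>2"
      unfolding power_mult_distrib nv m_def by algebra
    then have "(2 - m)\<^sup>2 / m\<^sup>2 = (m\<^sup>2 + (2 * x $ 1)\<^sup>2 + (2 * norm v)\<^sup>2) / m\<^sup>2"
      by simp
    then show ?thesis
      using m by (simp add: T' power_divide add_divide_distrib)
  qed
  moreover have "x = (1 / (1 + cosh_dist x)) *\<^sub>R ((2 * x $ 1 / m) *\<^sub>R qone + (2 * norm v / m) *\<^sub>R J)"
  proof -
    have "(1 / (1 + cosh_dist x)) *\<^sub>R ((2 * x $ 1 / m) *\<^sub>R qone + (2 * norm v / m) *\<^sub>R J)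
        = x $ 1 *\<^sub>R qone + norm v *\<^sub>R J"
      using m by (simp add: T scaleR_add_right)
    also have "\<dots> = x"
      using J(3) by (metis v_def add.commute diff_add_cancel)
    finally show ?thesis
      by simp
  qed
  ultimately show thesis
    using that[of "2 * norm v / m" J "2 * x $ 1 / m"] J m by simp
qed

text \<open>Moving along a curve of speed \<open>l\<close> in the hyperbolic half-plane while rotating the imaginary unit
  at speed at most \<open>\<pi>\<close>.\<close>
lemma reach_hyperboloid:
  fixes T A B T' A' B' :: "real \<Rightarrow> real" and J J' :: "real \<Rightarrow> quat"
  assumes deriv: "\<And>t. t \<in> {0..1} \<Longrightarrow> (T has_real_derivative T' t) (at t within {0..1})"
      "\<And>t. t \<in> {0..1} \<Longrightarrow> (A has_real_derivative A' t) (at t within {0..1})"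
      "\<And>t. t \<in> {0..1} \<Longrightarrow> (B has_real_derivative B' t) (at t within {0..1})"
      "\<And>t. t \<in> {0..1} \<Longrightarrow> (J has_vector_derivative J' t) (at t within {0..1})"
    and T: "\<And>t. t \<in> {0..1} \<Longrightarrow> T t \<ge> 1" "\<And>t. t \<in> {0..1} \<Longrightarrow> (T t)\<^sup>2 = 1 + (A t)\<^sup>2 + (B t)\<^sup>2"
      "\<And>t. t \<in> {0..1} \<Longrightarrow> T t * T' t = A t * A' t + B t * B' t"
    and J: "\<And>t. t \<in> {0..1} \<Longrightarrow> J t $ 1 = 0" "\<And>t. t \<in> {0..1} \<Longrightarrow> norm (J t) = 1"
      "\<And>t. t \<in> {0..1} \<Longrightarrow> J' t $ 1 = 0" "\<And>t. t \<in> {0..1} \<Longrightarrow> J t \<bullet> J' t = 0"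
      "\<And>t. t \<in> {0..1} \<Longrightarrow> norm (J' t) \<le> pi"
    and speed: "\<And>t. t \<in> {0..1} \<Longrightarrow> (A' t)\<^sup>2 + (B' t)\<^sup>2 - (T' t)\<^sup>2 \<le> l\<^sup>2"
    and ends: "x = (1 / (1 + T 0)) *\<^sub>R (A 0 *\<^sub>R qone + B 0 *\<^sub>R J 0)"
      "y = (1 / (1 + T 1)) *\<^sub>R (A 1 *\<^sub>R qone + B 1 *\<^sub>R J 1)"
  shows "reach (sqrt (l\<^sup>2 + pi\<^sup>2)) x y"
proof -
  define c where "c t = (1 / (1 + T t)) *\<^sub>R (A t *\<^sub>R qone + B t *\<^sub>R J t)" for t
  define c' where "c' t = (1 / (1 + T t)) *\<^sub>R (A' t *\<^sub>R qone + B' t *\<^sub>R J t + B t *\<^sub>R J' t)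
      - (T' t / (1 + T t)\<^sup>2) *\<^sub>R (A t *\<^sub>R qone + B t *\<^sub>R J t)" for t
  show ?thesis
  proof (rule reachI[where c = c and c' = c'])
    fix t :: real assume t: "t \<in> {0..1}"
    note metric = slice_metric_hyperboloid[OF T(1)[OF t] T(2)[OF t] T(3)[OF t] J(1)[OF t] J(2)[OF t] J(3)[OF t] J(4)[OF t]]
    show "c t \<in> Bq"
      unfolding c_def by (rule metric(3))
    have T0: "1 + T t \<noteq> 0"
      using T(1)[OF t] by simp
    have 1: "((\<lambda>t. 1 / (1 + T t)) has_real_derivative - (T' t / (1 + T t)\<^sup>2)) (at t within {0..1})"
      using DERIV_inverse'[OF DERIV_add[OF DERIV_const deriv(1)[OF t]] T0]
      by (simp add: inverse_eq_divide power2_eq_square)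
    have 2: "((\<lambda>t. A t *\<^sub>R qone + B t *\<^sub>R J t) has_vector_derivative
        (A t *\<^sub>R 0 + A' t *\<^sub>R qone + (B t *\<^sub>R J' t + B' t *\<^sub>R J t))) (at t within {0..1})"
      by (intro has_vector_derivative_add has_vector_derivative_scaleR deriv t has_vector_derivative_const)
    show "(c has_vector_derivative c' t) (at t within {0..1})"
      using has_vector_derivative_scaleR[OF 1 2] unfolding c_def[abs_def] c'_def
      by (simp add: algebra_simps)
    \<comment> \<open>The warping factor is at most 1, so the rotation contributes at most
      \<open>pi^2\<close> to the squared speed.\<close>
    have "(B t)\<^sup>2 / (1 + (B t)\<^sup>2) \<le> 1"
      by (subst pos_divide_le_eq) (auto intro: add_pos_nonneg)
    moreover have "J' t \<bullet> J' t \<le> pi\<^sup>2"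
      using J(5)[OF t] by (simp add: power_mono flip: power2_norm_eq_inner)
    ultimately have "(B t)\<^sup>2 / (1 + (B t)\<^sup>2) * (J' t \<bullet> J' t) \<le> 1 * pi\<^sup>2"
      by (intro mult_mono) auto
    then show "4 * slice_metric (c t) (c' t) (c' t) \<le> (sqrt (l\<^sup>2 + pi\<^sup>2))\<^sup>2"
      unfolding c_def c'_def metric(1) using speed[OF t] by simp
  qed (simp_all add: c_def ends)
qed

text \<open>The great circle arc from \<open>I1\<close> to \<open>I2\<close>, run through with
  constant speed equal to the angle \<open>\<theta> \<le> pi\<close>. \<open>K\<close> is its
  initial direction.\<close>

lemma rotation_curve:
  fixes I1 I2 :: quat
  assumes "I1 $ 1 = 0" "norm I1 = 1" "I2 $ 1 = 0" "norm I2 = 1"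
  obtains J J' where "J (0::real) = I1" "J 1 = I2"
    "\<And>t S. (J has_vector_derivative J' t) (at t within S)"
    "\<And>t. J t $ 1 = 0" "\<And>t. norm (J t) = 1" "\<And>t. J' t $ 1 = 0" "\<And>t. J t \<bullet> J' t = 0" "\<And>t. norm (J' t) \<le> pi"
proof -
  define c where "c = I1 \<bullet> I2"
  define \<theta> where "\<theta> = arccos c"
  have I: "I1 \<bullet> I1 = 1" "I2 \<bullet> I2 = 1"
    using assms by (simp_all flip: power2_norm_eq_inner)
  have "\<bar>c\<bar> \<le> 1"
    using Cauchy_Schwarz_ineq2[of I1 I2] assms by (simp add: c_def)
  then have c: "-1 \<le> c" "c \<le> 1" "cos \<theta> = c" "sin \<theta> = sqrt (1 - c\<^sup>2)" "0 \<le> \<theta>" "\<theta> \<le> pi"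
    by (simp_all add: \<theta>_def sin_arccos_abs arccos_lbound arccos_ubound)
  define R where "R = I2 - c *\<^sub>R I1"
  have R: "R \<bullet> R = 1 - c\<^sup>2" "I1 \<bullet> R = 0" "R $ 1 = 0"
    using I assms by (simp_all add: R_def inner_diff_left inner_diff_right c_def inner_commute power2_eq_square)
  then have nR: "norm R = sin \<theta>"
    by (simp add: c norm_eq_sqrt_inner)
  obtain K where K: "K $ 1 = 0" "norm K = 1" "I1 \<bullet> K = 0" "R = sin \<theta> *\<^sub>R K"
  proof (cases "R = 0")
    case True
    \<comment> \<open>Here \<open>I2\<close> is \<open>I1\<close> or \<open>- I1\<close> and
      \<open>sin \<theta> = 0\<close>, so any unit vector orthogonal to \<open>qone\<close> and
      \<open>I1\<close> may serve as \<open>K\<close>.\<close>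
    have "dim {qone, I1} < DIM(quat)"
      using dim_le_card[of "{qone, I1}" "{qone, I1}"] card_insert_le_m1[of 2 "{I1}" qone]
      by (simp add: span_superset)
    then obtain Z where Z: "Z \<noteq> 0" "\<And>y. y \<in> span {qone, I1} \<Longrightarrow> orthogonal Z y"
      using orthogonal_to_subspace_exists by metis
    have "Z \<bullet> qone = 0" "Z \<bullet> I1 = 0"
      using Z(2)[of qone] Z(2)[of I1] by (auto simp: orthogonal_def span_base)
    moreover have "Z \<bullet> qone = Z $ 1"
      by (simp add: inner_quat)
    ultimately have "Z $ 1 = 0" "I1 \<bullet> Z = 0"
      by (simp_all add: inner_commute)
    then show ?thesis
      using Z(1) True nR by (intro that[of "Z /\<^sub>R norm Z"]) auto
  next
    case False
    then have "sin \<theta> > 0"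
      by (simp flip: nR)
    then show ?thesis
      using R nR by (intro that[of "R /\<^sub>R norm R"]) auto
  qed
  have KK: "K \<bullet> K = 1" "K \<bullet> I1 = 0"
    using K by (simp_all add: inner_commute flip: power2_norm_eq_inner)
  define J where "J t = cos (\<theta> * t) *\<^sub>R I1 + sin (\<theta> * t) *\<^sub>R K" for t
  define J' where "J' t = \<theta> *\<^sub>R (cos (\<theta> * t) *\<^sub>R K - sin (\<theta> * t) *\<^sub>R I1)" for t
  have "(J has_vector_derivative J' t) (at t within S)" for t S
  proof -
    have 1: "((\<lambda>t. cos (\<theta> * t)) has_real_derivative - (\<theta> * sin (\<theta> * t))) (at t within S)"
      "((\<lambda>t. sin (\<theta> * t)) has_real_derivative \<theta> * cos (\<theta> * t)) (at t within S)"
      by (auto intro!: derivative_eq_intros)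
    have "(J has_vector_derivative (cos (\<theta> * t) *\<^sub>R 0 + (- (\<theta> * sin (\<theta> * t))) *\<^sub>R I1)
        + (sin (\<theta> * t) *\<^sub>R 0 + (\<theta> * cos (\<theta> * t)) *\<^sub>R K)) (at t within S)"
      unfolding J_def[abs_def]
      by (intro has_vector_derivative_add has_vector_derivative_scaleR 1 has_vector_derivative_const)
    then show ?thesis
      by (simp add: J'_def algebra_simps)
  qed
  moreover have "J 0 = I1" "J 1 = I2"
    by (simp_all add: J_def c(3) flip: K(4)) (simp add: R_def)
  moreover have "J t $ 1 = 0" "J' t $ 1 = 0" for t
    using K(1) assms by (simp_all add: J_def J'_def)
  moreover have "J t \<bullet> J t = 1" "J t \<bullet> J' t = 0" for t
    using I KK K(3) by (simp_all add: J_def J'_def inner_add_left inner_add_right inner_diff_right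
        flip: power2_eq_square)
  moreover have "J' t \<bullet> J' t = \<theta>\<^sup>2" for t
  proof -
    have "J' t \<bullet> J' t = \<theta> * \<theta> * cos (\<theta> * t) * cos (\<theta> * t) + \<theta> * \<theta> * sin (\<theta> * t) * sin (\<theta> * t)"
      using I KK K(3) by (simp add: J'_def inner_diff_left inner_diff_right algebra_simps)
    also have "\<dots> = \<theta>\<^sup>2 * ((cos (\<theta> * t))\<^sup>2 + (sin (\<theta> * t))\<^sup>2)"
      by algebra
    finally show ?thesis
      by simp
  qed
  ultimately show thesis
    using c(5,6) by (intro that[of J J']) (simp_all add: norm_eq_sqrt_inner)
qed

text \<open>A right-angled hyperbolic triangle with legs \<open>\<rho>\<close> and \<open>r\<close>
  has a hypotenuse shorter than \<open>\<rho> + r\<close> by an amount bounded below as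
  \<open>r\<close> grows, while passing from \<open>l\<close> to \<open>sqrt (l^2 + pi^2)\<close>
  adds less and less.\<close>

lemma cosh_sum_le:
  fixes \<rho> :: real
  assumes "\<rho> > 0"
  obtains r where "r \<ge> 0" "pi < \<rho> + r"
    "\<And>l. 0 \<le> l \<Longrightarrow> cosh l \<le> cosh \<rho> * cosh r \<Longrightarrow> sqrt (l\<^sup>2 + pi\<^sup>2) < \<rho> + r"
proof -
  have ch: "cosh \<rho> < exp \<rho>"
    using assms by (simp add: cosh_field_def)
  \<comment> \<open>A number strictly between \<open>ln (cosh \<rho>)\<close> and
    \<open>\<rho>\<close>: the lower gap absorbs \<open>exp (- (2 * r))\<close>, the upper gap
    absorbs \<open>pi^2\<close>.\<close>
  define m where "m = ln ((cosh \<rho> + exp \<rho>) / 2)"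
  have em: "exp m = (cosh \<rho> + exp \<rho>) / 2"
    unfolding m_def by (intro exp_ln) (auto intro: add_pos_pos)
  have "(cosh \<rho> + exp \<rho>) / 2 < exp \<rho>"
    using ch by simp
  then have "exp m < exp \<rho>"
    by (simp only: em)
  then have m: "m < \<rho>"
    by simp
  have gap: "exp m - cosh \<rho> > 0"
    unfolding em using ch by simp
  \<comment> \<open>The bound \<open>\<rho> + 4\<close> gives \<open>pi < \<rho> + r\<close>, the
    second entry gives \<open>l \<le> r + m\<close>, and the third makes
    \<open>2 * (\<rho> - m) * (r - |m|)\<close> at least \<open>pi^2\<close>.\<close>
  define r where "r = max (max (\<rho> + 4) (cosh \<rho> / (exp m - cosh \<rho>))) (pi\<^sup>2 / (2 * (\<rho> - m)) + \<bar>m\<bar>)"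
  have r: "r \<ge> 4" "r \<ge> cosh \<rho> / (exp m - cosh \<rho>)" "r \<ge> pi\<^sup>2 / (2 * (\<rho> - m)) + \<bar>m\<bar>"
    using assms by (auto simp: r_def)
  have "cosh \<rho> * exp (- (2 * r)) \<le> exp m - cosh \<rho>"
  proof -
    have "cosh \<rho> \<le> (exp m - cosh \<rho>) * r"
      using r(2) gap by (simp add: divide_le_eq mult.commute)
    also have "r \<le> exp (2 * r)"
      using exp_ge_add_one_self[of "2 * r"] r(1) by linarith
    finally have "cosh \<rho> \<le> (exp m - cosh \<rho>) * exp (2 * r)"
      using gap by simp
    then show ?thesis
      by (simp add: exp_minus field_simps)
  qed
  then have E: "cosh \<rho> * (1 + exp (- (2 * r))) \<le> exp m"
    by (simp add: algebra_simps)
  have bound: "sqrt (l\<^sup>2 + pi\<^sup>2) < \<rho> + r" if l: "0 \<le> l" "cosh l \<le> cosh \<rho> * cosh r" for l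
  proof -
    have "exp l \<le> 2 * cosh l"
      by (simp add: cosh_field_def)
    also have "\<dots> \<le> cosh \<rho> * (2 * cosh r)"
      using l(2) by simp
    also have "2 * cosh r = exp r * (1 + exp (- (2 * r)))"
      by (simp add: cosh_field_def algebra_simps flip: exp_add)
    also have "cosh \<rho> * (exp r * (1 + exp (- (2 * r)))) = exp r * (cosh \<rho> * (1 + exp (- (2 * r))))"
      by simp
    also have "\<dots> \<le> exp r * exp m"
      using E by (intro mult_left_mono) auto
    finally have "l \<le> r + m"
      by (simp flip: exp_add)
    then have "l\<^sup>2 \<le> (r + m)\<^sup>2"
      using l(1) by (intro power_mono)
    moreover have "pi\<^sup>2 < (\<rho> - m) * (2 * (r - \<bar>m\<bar>)) + (\<rho> - m)\<^sup>2"
    proof -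
      have "pi\<^sup>2 / (2 * (\<rho> - m)) \<le> r - \<bar>m\<bar>"
        using r(3) by simp
      moreover have "0 < 2 * (\<rho> - m)"
        using m by simp
      ultimately have "pi\<^sup>2 \<le> (r - \<bar>m\<bar>) * (2 * (\<rho> - m))"
        by (simp only: pos_divide_le_eq)
      also have "\<dots> = (\<rho> - m) * (2 * (r - \<bar>m\<bar>))"
        by algebra
      also have "\<dots> < \<dots> + (\<rho> - m)\<^sup>2"
        using m by simp
      finally show ?thesis .
    qed
    moreover have "(\<rho> - m) * (2 * (r - \<bar>m\<bar>)) \<le> (\<rho> - m) * (2 * (r + m))"
      using m by (intro mult_left_mono) auto
    moreover have "(\<rho> + r)\<^sup>2 = (r + m)\<^sup>2 + (\<rho> - m) * (2 * (r + m)) + (\<rho> - m)\<^sup>2"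
      by algebra
    ultimately have "l\<^sup>2 + pi\<^sup>2 < (\<rho> + r)\<^sup>2"
      by linarith
    then show ?thesis
      using assms r(1) by (intro real_less_lsqrt) auto
  qed
  show thesis
    by (rule that[OF _ _ bound]) (use r(1) assms pi_less_4 in auto)
qed

text \<open>The hyperbolic analogue of spherical linear interpolation. Both end points have
  Minkowski square -1 and their product is \<open>- cosh l\<close>; hence the three identities for
  the curve reduce to \<open>id1\<close>, \<open>id2\<close>, \<open>id3\<close>, which involve only
  \<open>X\<close>, \<open>Y\<close>, their derivatives and \<open>C\<close>.\<close>

lemma hyperboloid_geodesic:
  fixes T0 A0 B0 T1 A1 B1 l :: real
  assumes "T0 \<ge> 1" "T1 \<ge> 1" "T0\<^sup>2 = 1 + A0\<^sup>2 + B0\<^sup>2" "T1\<^sup>2 = 1 + A1\<^sup>2 + B1\<^sup>2"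
    and l: "l > 0" "cosh l = T0 * T1 - A0 * A1 - B0 * B1"
  obtains X Y X' Y' where
    "X 0 = 1" "X 1 = 0" "Y 0 = 0" "Y 1 = (1::real)"
    "\<And>t S. (X has_real_derivative X' t) (at t within S)" "\<And>t S. (Y has_real_derivative Y' t) (at t within S)"
    "\<And>t. (X t * T0 + Y t * T1)\<^sup>2 = 1 + (X t * A0 + Y t * A1)\<^sup>2 + (X t * B0 + Y t * B1)\<^sup>2"
    "\<And>t. (X t * T0 + Y t * T1) * (X' t * T0 + Y' t * T1)
        = (X t * A0 + Y t * A1) * (X' t * A0 + Y' t * A1) + (X t * B0 + Y t * B1) * (X' t * B0 + Y' t * B1)"
    "\<And>t. (X' t * A0 + Y' t * A1)\<^sup>2 + (X' t * B0 + Y' t * B1)\<^sup>2 - (X' t * T0 + Y' t * T1)\<^sup>2 = l\<^sup>2"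
    "\<And>t. t \<in> {0..1} \<Longrightarrow> X t * T0 + Y t * T1 \<ge> 1"
proof -
  define s where "s = sinh l"
  have s: "s > 0"
    using l(1) by (simp add: s_def)
  define X where "X t = sinh ((1 - t) * l) / s" for t
  define Y where "Y t = sinh (t * l) / s" for t
  define X' where "X' t = - (l * cosh ((1 - t) * l)) / s" for t
  define Y' where "Y' t = l * cosh (t * l) / s" for t
  define C where "C = cosh l"
  have add: "s = sinh ((1 - t) * l) * cosh (t * l) + cosh ((1 - t) * l) * sinh (t * l)"
    "C = cosh ((1 - t) * l) * cosh (t * l) + sinh ((1 - t) * l) * sinh (t * l)" for t
    unfolding s_def C_def sinh_add[symmetric] cosh_add[symmetric] by (simp_all add: algebra_simps)
  have id1: "(X t)\<^sup>2 + (Y t)\<^sup>2 + 2 * X t * Y t * C = 1"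
    and id2: "X t * X' t + Y t * Y' t + (X t * Y' t + X' t * Y t) * C = 0"
    and id3: "(X' t)\<^sup>2 + (Y' t)\<^sup>2 + 2 * X' t * Y' t * C = - l\<^sup>2" for t
  proof -
    \<comment> \<open>With the addition theorems for \<open>s\<close> and \<open>C\<close>, the
      identities become polynomial consequences of \<open>b^2 = a^2 + 1\<close> and
      \<open>d^2 = c^2 + 1\<close>.\<close>
    define a b c d where "a = sinh ((1 - t) * l)" and "b = cosh ((1 - t) * l)"
      and "c = sinh (t * l)" and "d = cosh (t * l)"
    have bd: "b\<^sup>2 = a\<^sup>2 + 1" "d\<^sup>2 = c\<^sup>2 + 1"
      by (simp_all add: a_def b_def c_def d_def cosh_square_eq)
    have sC: "s = a * d + b * c" "C = b * d + a * c"
      using add[of t] by (simp_all add: a_def b_def c_def d_def)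
    have XY: "s * X t = a" "s * Y t = c" "s * X' t = - l * b" "s * Y' t = l * d"
      using s by (simp_all add: X_def Y_def X'_def Y'_def a_def b_def c_def d_def)
    have "s\<^sup>2 * ((X t)\<^sup>2 + (Y t)\<^sup>2 + 2 * X t * Y t * C) = a\<^sup>2 + c\<^sup>2 + 2 * a * c * C"
      unfolding XY[symmetric] by algebra
    also have "\<dots> = s\<^sup>2 * 1"
      using bd unfolding sC by algebra
    finally show "(X t)\<^sup>2 + (Y t)\<^sup>2 + 2 * X t * Y t * C = 1"
      using s by simp
    have "s\<^sup>2 * (X t * X' t + Y t * Y' t + (X t * Y' t + X' t * Y t) * C)
        = (s * X t) * (s * X' t) + (s * Y t) * (s * Y' t) + ((s * X t) * (s * Y' t) + (s * X' t) * (s * Y t)) * C"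
      by algebra
    also have "\<dots> = 0"
      unfolding XY using bd unfolding sC by algebra
    finally show "X t * X' t + Y t * Y' t + (X t * Y' t + X' t * Y t) * C = 0"
      using s by simp
    have "s\<^sup>2 * ((X' t)\<^sup>2 + (Y' t)\<^sup>2 + 2 * X' t * Y' t * C)
        = (s * X' t)\<^sup>2 + (s * Y' t)\<^sup>2 + 2 * (s * X' t) * (s * Y' t) * C"
      by algebra
    also have "\<dots> = s\<^sup>2 * (- l\<^sup>2)"
      unfolding XY using bd unfolding sC by algebra
    finally show "(X' t)\<^sup>2 + (Y' t)\<^sup>2 + 2 * X' t * Y' t * C = - l\<^sup>2"
      using s by (simp only: mult_cancel_left) simp
  qed
  have C: "C = T0 * T1 - A0 * A1 - B0 * B1"
    by (simp add: C_def l)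
  have "X 0 = 1" "X 1 = 0" "Y 0 = 0" "Y 1 = 1"
    using s by (simp_all add: X_def Y_def s_def)
  moreover have "(X has_real_derivative X' t) (at t within S)" "(Y has_real_derivative Y' t) (at t within S)" for t S
    unfolding X_def[abs_def] X'_def Y_def[abs_def] Y'_def using s by (auto intro!: derivative_eq_intros)
  moreover have sq: "(X t * T0 + Y t * T1)\<^sup>2 = 1 + (X t * A0 + Y t * A1)\<^sup>2 + (X t * B0 + Y t * B1)\<^sup>2" for t
    using id1[of t] assms(3,4) C by algebra
  moreover have "(X t * T0 + Y t * T1) * (X' t * T0 + Y' t * T1)
        = (X t * A0 + Y t * A1) * (X' t * A0 + Y' t * A1) + (X t * B0 + Y t * B1) * (X' t * B0 + Y' t * B1)" for t
    using id2[of t] assms(3,4) C by algebra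
  moreover have "(X' t * A0 + Y' t * A1)\<^sup>2 + (X' t * B0 + Y' t * B1)\<^sup>2 - (X' t * T0 + Y' t * T1)\<^sup>2 = l\<^sup>2" for t
    using id3[of t] assms(3,4) C by algebra
  moreover have "X t * T0 + Y t * T1 \<ge> 1" if t: "t \<in> {0..1}" for t
  proof -
    have "X t \<ge> 0" "Y t \<ge> 0"
      using t s l(1) by (auto simp: X_def Y_def)
    then have "X t * T0 + Y t * T1 \<ge> 0"
      using assms(1,2) by simp
    moreover have "1 \<le> (X t * T0 + Y t * T1)\<^sup>2"
      unfolding sq by simp
    ultimately show ?thesis
      by (metis one_power2 power2_le_imp_le)
  qed
  ultimately show thesis
    by (rule that)
qed

text \<open>Every \<open>y\<close> with \<open>reach r 0 y\<close> can be reached from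
  \<open>p\<close> with less than \<open>\<rho> + r\<close>, so nothing prolongs a minimising path
  from \<open>p\<close> to 0 by \<open>r\<close>.\<close>

lemma not_pole_imaginary:
  assumes p: "p \<in> Bq" "p $ 1 = 0" "p \<noteq> 0"
  shows "\<not> pole p"
proof
  assume "pole p"
  obtain A0 B0 J0 where 0: "0 \<le> B0" "J0 $ 1 = 0" "norm J0 = 1" "(cosh_dist p)\<^sup>2 = 1 + A0\<^sup>2 + B0\<^sup>2"
    "p = (1 / (1 + cosh_dist p)) *\<^sub>R (A0 *\<^sub>R qone + B0 *\<^sub>R J0)" "A0 = 0"
    using hyperboloid_coords[OF p(1)] p(2) by metis
  define \<rho> where "\<rho> = arcosh (cosh_dist p)"
  have T0: "cosh_dist p \<ge> 1"
    by (rule cosh_dist_ge_1[OF p(1)])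
  have "cosh_dist p \<noteq> 1"
    using p 0 by (auto simp: Bq_norm_sq)
  then have \<rho>: "\<rho> > 0" "cosh \<rho> = cosh_dist p"
    using T0 by (simp_all add: \<rho>_def)
  obtain r where r: "r \<ge> 0" "pi < \<rho> + r"
    "\<And>l. 0 \<le> l \<Longrightarrow> cosh l \<le> cosh \<rho> * cosh r \<Longrightarrow> sqrt (l\<^sup>2 + pi\<^sup>2) < \<rho> + r"
    using cosh_sum_le[OF \<rho>(1)] by blast
  have "\<rho> \<le> L" if "0 \<le> L" "reach L p 0" for L
    using reach_lower_bound[OF reach_sym[OF that(2)] that(1)] that(1) \<rho>(1)
    unfolding \<rho>(2)[symmetric] by (simp add: cosh_real_nonneg_le_iff)
  then obtain y where y: "reach r 0 y" "\<And>L. 0 \<le> L \<Longrightarrow> reach L p y \<Longrightarrow> \<rho> + r \<le> L"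
    using \<open>pole p\<close> r(1) unfolding pole_def by (metis Bq_iff norm_zero zero_less_one)
  have yB: "y \<in> Bq"
    using reach_in_Bq(2)[OF y(1)] .
  obtain A1 B1 J1 where 1: "0 \<le> B1" "J1 $ 1 = 0" "norm J1 = 1" "(cosh_dist y)\<^sup>2 = 1 + A1\<^sup>2 + B1\<^sup>2"
    "y = (1 / (1 + cosh_dist y)) *\<^sub>R (A1 *\<^sub>R qone + B1 *\<^sub>R J1)"
    using hyperboloid_coords[OF yB] by metis
  have T1: "cosh_dist y \<ge> 1"
    by (rule cosh_dist_ge_1[OF yB])
  obtain J J' where J: "J 0 = J0" "J 1 = J1" "\<And>t S. (J has_vector_derivative J' t) (at t within S)"
    "\<And>t. J t $ 1 = 0" "\<And>t. norm (J t) = 1" "\<And>t. J' t $ 1 = 0" "\<And>t. J t \<bullet> J' t = 0" "\<And>t. norm (J' t) \<le> pi"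
    using rotation_curve[OF 0(2,3) 1(2,3)] by metis
  define C where "C = cosh_dist p * cosh_dist y - A0 * A1 - B0 * B1"
  \<comment> \<open>The right angle: \<open>A0 = 0\<close> and \<open>B0 * B1 \<ge> 0\<close> in the
    law of cosines.\<close>
  have "C \<le> cosh_dist p * cosh_dist y"
    using 0 1 by (simp add: C_def)
  also have "\<dots> \<le> cosh \<rho> * cosh r"
    unfolding \<rho>(2) using reach_lower_bound[OF y(1) r(1)] T0 by (intro mult_left_mono) auto
  finally have C: "C \<le> cosh \<rho> * cosh r" .
  \<comment> \<open>Lagrange's identity for \<open>(1, A0, B0)\<close> and
    \<open>(1, A1, B1)\<close>. It yields \<open>C \<ge> 1\<close>, so that \<open>arcosh C\<close>
    makes sense, with equality only for equal coordinates.\<close>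
  have C2: "(cosh_dist p * cosh_dist y)\<^sup>2 = (A0 * A1 + B0 * B1 + 1)\<^sup>2 + (A0 - A1)\<^sup>2 + (B0 - B1)\<^sup>2 + (A0 * B1 - A1 * B0)\<^sup>2"
    unfolding power_mult_distrib 0(4) 1(4) by algebra
  have "\<bar>A0 * A1 + B0 * B1 + 1\<bar> \<le> \<bar>cosh_dist p * cosh_dist y\<bar>"
    unfolding abs_le_square_iff C2 by simp
  then have C1: "C \<ge> 1"
    using T0 T1 by (simp add: C_def abs_mult)
  show False
  proof (cases "C = 1")
    \<comment> \<open>The interpolation divides by \<open>sinh l\<close>, so this case stands apart:
      the points differ at most in their imaginary units, and rotation alone, of cost at most
      \<open>pi\<close>, joins them.\<close>
    case True
    then have "cosh_dist p * cosh_dist y = A0 * A1 + B0 * B1 + 1"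
      by (simp add: C_def)
    then have "(A0 - A1)\<^sup>2 + (B0 - B1)\<^sup>2 + (A0 * B1 - A1 * B0)\<^sup>2 = 0"
      using C2 by simp
    then have "(A0 - A1)\<^sup>2 = 0" "(B0 - B1)\<^sup>2 = 0"
      using zero_le_power2[of "A0 - A1"] zero_le_power2[of "B0 - B1"] zero_le_power2[of "A0 * B1 - A1 * B0"]
      by linarith+
    then have eq: "A1 = A0" "B1 = B0"
      by simp_all
    then have "(cosh_dist y)\<^sup>2 = (cosh_dist p)\<^sup>2"
      using 0(4) 1(4) by simp
    then have T: "cosh_dist y = cosh_dist p"
      using T0 T1 by (simp add: power2_eq_iff_nonneg)
    have "reach (sqrt (0\<^sup>2 + pi\<^sup>2)) p y"
      by (rule reach_hyperboloid[where T = "\<lambda>_. cosh_dist p" and A = "\<lambda>_. A0" and B = "\<lambda>_. B0" and J = J and J' = J'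
            and T' = "\<lambda>_. 0" and A' = "\<lambda>_. 0" and B' = "\<lambda>_. 0"])
        (use J T0 0 1 T eq in auto)
    then show False
      using y(2)[of pi] r(2) by simp
  next
    case False
    define l where "l = arcosh C"
    have l: "l > 0" "cosh l = C"
      using C1 False by (simp_all add: l_def)
    have l2: "cosh l = cosh_dist p * cosh_dist y - A0 * A1 - B0 * B1"
      by (simp add: l(2) C_def)
    show False
    proof (rule hyperboloid_geodesic[OF T0 T1 0(4) 1(4) l(1) l2])
      fix X Y X' Y' :: "real \<Rightarrow> real"
      assume XY: "X 0 = 1" "X 1 = 0" "Y 0 = 0" "Y 1 = (1::real)"
      "\<And>t S. (X has_real_derivative X' t) (at t within S)" "\<And>t S. (Y has_real_derivative Y' t) (at t within S)"
      "\<And>t. (X t * cosh_dist p + Y t * cosh_dist y)\<^sup>2 = 1 + (X t * A0 + Y t * A1)\<^sup>2 + (X t * B0 + Y t * B1)\<^sup>2"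
      "\<And>t. (X t * cosh_dist p + Y t * cosh_dist y) * (X' t * cosh_dist p + Y' t * cosh_dist y)
          = (X t * A0 + Y t * A1) * (X' t * A0 + Y' t * A1) + (X t * B0 + Y t * B1) * (X' t * B0 + Y' t * B1)"
      "\<And>t. (X' t * A0 + Y' t * A1)\<^sup>2 + (X' t * B0 + Y' t * B1)\<^sup>2 - (X' t * cosh_dist p + Y' t * cosh_dist y)\<^sup>2 = l\<^sup>2"
      "\<And>t. t \<in> {0..1} \<Longrightarrow> X t * cosh_dist p + Y t * cosh_dist y \<ge> 1"
      have lin: "((\<lambda>t. X t * u + Y t * v) has_real_derivative X' t * u + Y' t * v) (at t within S)" for u v t S
        by (intro DERIV_add DERIV_cmult_right XY)
      have "reach (sqrt (l\<^sup>2 + pi\<^sup>2)) p y"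
        by (rule reach_hyperboloid[where T = "\<lambda>t. X t * cosh_dist p + Y t * cosh_dist y"
              and T' = "\<lambda>t. X' t * cosh_dist p + Y' t * cosh_dist y"
              and A = "\<lambda>t. X t * A0 + Y t * A1" and A' = "\<lambda>t. X' t * A0 + Y' t * A1"
              and B = "\<lambda>t. X t * B0 + Y t * B1" and B' = "\<lambda>t. X' t * B0 + Y' t * B1" and J = J and J' = J'])
          (simp_all add: lin J XY flip: 0(5) 1(5))
      then have "\<rho> + r \<le> sqrt (l\<^sup>2 + pi\<^sup>2)"
        by (intro y) auto
      then show False
        using r(3)[of l] l C by auto
    qed
  qed
qed

text \<open>\<open>h \<tau>\<close> is the real part of \<open>mob \<tau> q\<close> up to a positive
  factor. Since \<open>2 * norm q < 1 + (norm q)^2\<close>, it has opposite signs at -1 and 1. This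
  reduces nonreal points to imaginary ones.\<close>

lemma mob_imaginary:
  assumes "q \<in> Bq"
  obtains \<tau> where "\<bar>\<tau>\<bar> < 1" "mob \<tau> q $ 1 = 0"
proof -
  define n where "n = (norm q)\<^sup>2"
  define h where "h \<tau> = q $ 1 + \<tau> * (1 + n) + \<tau>\<^sup>2 * q $ 1" for \<tau>
  have "(1 - norm q)\<^sup>2 > 0"
    using assms by (simp add: Bq_iff)
  then have "2 * norm q < 1 + n"
    by (simp add: n_def power2_eq_square algebra_simps)
  then have h1: "h (-1) < 0" "h 1 > 0"
    using nth_1_le_norm[of q] by (auto simp: h_def)
  have "continuous_on {-1..1} h"
    unfolding h_def by (intro continuous_intros)
  then obtain \<tau> where \<tau>: "-1 \<le> \<tau>" "\<tau> \<le> 1" "h \<tau> = 0"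
    using IVT'[of h "-1" 0 1] h1 by auto
  then have "\<bar>\<tau>\<bar> < 1"
    using h1 by (cases "\<tau> = 1"; cases "\<tau> = -1") auto
  moreover have "mob \<tau> q $ 1 = 0"
  proof -
    have "qmul (qcnj (qone + \<tau> *\<^sub>R q)) (q + \<tau> *\<^sub>R qone) $ 1 = h \<tau>"
      unfolding h_def n_def norm_quat_sq by (simp add: power2_eq_square algebra_simps)
    then show ?thesis
      by (simp add: mob_def qinv_def qmul.scaleR_left \<tau>(3) del: qmul_nth)
  qed
  ultimately show thesis
    using that by blast
qed

lemma act_tanh: "act qone 1 t q = mob (tanh t) q"
  by (simp add: act_mob)

lemma grp_translation: "(qone, 1, t) \<in> grp"
  by (simp add: grp_def Sp1_def)

text \<open>Translations carry any pole to an imaginary pole, which must be 0, and carry the pole 0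
  to every real point of the ball.\<close>

lemma pole_iff_real:
  assumes "p \<in> Bq"
  shows "pole p \<longleftrightarrow> (\<exists>x. p = x *\<^sub>R qone)"
proof
  assume "pole p"
  obtain \<tau> where \<tau>: "\<bar>\<tau>\<bar> < 1" "mob \<tau> p $ 1 = 0"
    using mob_imaginary[OF assms] .
  obtain t where t: "tanh t = \<tau>"
    using tanh_surj[OF \<tau>(1)] .
  have "pole (mob \<tau> p)"
    using pole_isometry[OF act_isometry_pair[OF grp_translation] assms \<open>pole p\<close>, of t] by (simp add: act_tanh t)
  then have "mob \<tau> p = 0"
    using not_pole_imaginary mob_in_Bq[OF \<tau>(1) assms] \<tau>(2) by blast
  then have "p = - \<tau> *\<^sub>R qone"
    using one_add_scaleR_neq_0[OF \<tau>(1) assms] by (simp add: mob_def qmul_eq_0 qinv_eq_0 eq_neg_iff_add_eq_0)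
  then show "\<exists>x. p = x *\<^sub>R qone"
    by blast
next
  assume "\<exists>x. p = x *\<^sub>R qone"
  then obtain x where x: "p = x *\<^sub>R qone"
    by blast
  then have "\<bar>x\<bar> < 1"
    using assms by (simp add: Bq_iff)
  then obtain t where "tanh t = x"
    using tanh_surj by metis
  then have "act qone 1 t 0 = p"
    by (simp add: act_tanh mob_def x)
  then show "pole p"
    using pole_isometry[OF act_isometry_pair[OF grp_translation] _ pole_0, of t] by (simp add: Bq_def)
qed

lemma isometry_preserves_axis:
  assumes "isometry_pair f k" "\<bar>x\<bar> < 1"
  obtains y where "f (x *\<^sub>R qone) = y *\<^sub>R qone" "\<bar>y\<bar> < 1"
proof -
  have x: "x *\<^sub>R qone \<in> Bq"
    using assms(2) by (simp add: Bq_iff)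
  then obtain y where "f (x *\<^sub>R qone) = y *\<^sub>R qone"
    using pole_isometry[OF assms(1)] pole_iff_real isometry_pairD(1)[OF assms(1)] by metis
  moreover have "\<bar>y\<bar> < 1"
    using isometry_pairD(1)[OF assms(1) x] calculation by (simp add: Bq_iff)
  ultimately show thesis
    using that by blast
qed

section \<open>Rigidity\<close>

lemma imaginary_square: "a $ 1 = 0 \<Longrightarrow> norm a = 1 \<Longrightarrow> qmul a a = - qone"
  using norm_quat_sq[of a] by (simp add: quat_eq_iff power2_eq_square)

lemma imaginary_anticommute: "a $ 1 = 0 \<Longrightarrow> b $ 1 = 0 \<Longrightarrow> a \<bullet> b = 0 \<Longrightarrow> qmul a b = - qmul b a"
  by (simp add: quat_eq_iff inner_quat algebra_simps)

text \<open>Take \<open>u\<close> proportional to \<open>1 - b a\<close>, or \<open>u = c\<close> if this vanishes.\<close>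
lemma conjugate_imaginary_units:
  assumes "a $ 1 = 0" "norm a = 1" "b $ 1 = 0" "norm b = 1" "norm c = 1" "qmul c a = - qmul a c"
  obtains u where "norm u = 1" "qmul u a = qmul b u"
    "\<And>w. qmul w c = qmul c w \<Longrightarrow> qmul w (qmul b a) = qmul (qmul b a) w \<Longrightarrow> qmul w u = qmul u w"
proof (cases "qmul b a = qone")
  case True
  then have "b = - a"
    by (metis assms(1,2) imaginary_square qmul.minus_left minus_equation_iff norm_zero qmul_right_cancel zero_neq_one)
  then show ?thesis
    using that[of c] assms(5,6) by (simp add: qmul.minus_left)
next
  case False
  define v where "v = qone - qmul b a"
  have v: "v \<noteq> 0"
    using False by (simp add: v_def)
  \<comment> \<open>Both sides equal \<open>a + b\<close>, as \<open>a\<close> and \<open>b\<close>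
    square to -1.\<close>
  have "qmul v a = qmul b v"
    by (simp add: v_def qmul.diff_left qmul.diff_right qmul_assoc imaginary_square assms qmul.minus_right)
      (simp add: imaginary_square assms qmul.minus_left flip: qmul_assoc)
  then show ?thesis
    using v by (intro that[of "v /\<^sub>R norm v"])
      (simp_all add: qmul.scaleR_left qmul.scaleR_right v_def qmul.diff_left qmul.diff_right)
qed

lemma det_comp_pos:
  fixes f g :: "real^'n \<Rightarrow> real^'n"
  assumes "linear f" "linear g" "det (matrix f) > 0" "det (matrix g) > 0"
  shows "det (matrix (g \<circ> f)) > 0"
  using assms by (simp add: matrix_compose det_mul)

lemma linear_conj: "linear (\<lambda>x. qmul (qmul u x) w)"
  by (intro bounded_linear.linear bounded_linear_compose[OF qmul.bounded_linear_left qmul.bounded_linear_right])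

lemma det_conj_pos: "u \<noteq> 0 \<Longrightarrow> w \<noteq> 0 \<Longrightarrow> det (matrix (\<lambda>x. qmul (qmul u x) w)) > 0"
  using det_qmul_qmul_pos[of u w] by (simp add: qmul_assoc)

text \<open>A rotation of the imaginary quaternions, extended by the identity on the reals. Norm and
  real part are what distances to real points control; orthogonality follows.\<close>

definition so3_like :: "(quat \<Rightarrow> quat) \<Rightarrow> bool" where
  "so3_like L \<longleftrightarrow> linear L \<and> (\<forall>q. norm (L q) = norm q \<and> L q $ 1 = q $ 1) \<and> det (matrix L) > 0"

lemma so3_like_conj:
  assumes "so3_like L" "norm u = 1"
  shows "so3_like (\<lambda>q. qmul (qmul (qcnj u) (L q)) u)"
proof -
  have u: "norm (qcnj u) = 1" "u \<noteq> 0" "qcnj u \<noteq> 0"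
    using assms(2) norm_qcnj[of u] by fastforce+
  have Re: "qmul (qmul (qcnj u) x) u $ 1 = x $ 1" for x
  proof -
    have "qmul (qmul (qcnj u) x) u $ 1 = (norm u)\<^sup>2 * x $ 1"
      unfolding norm_quat_sq by (simp add: power2_eq_square algebra_simps)
    then show ?thesis
      by (simp add: assms(2))
  qed
  have L: "linear L" "det (matrix L) > 0"
    using assms(1) by (auto simp: so3_like_def)
  have "det (matrix ((\<lambda>x. qmul (qmul (qcnj u) x) u) \<circ> L)) > 0"
    by (rule det_comp_pos[OF L(1) linear_conj L(2) det_conj_pos[OF u(3,2)]])
  moreover have "linear ((\<lambda>x. qmul (qmul (qcnj u) x) u) \<circ> L)"
    by (rule linear_compose[OF L(1) linear_conj])
  ultimately show ?thesis
    using assms(1) by (simp add: so3_like_def o_def Re norm_qmul assms(2) del: qmul_nth)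
qed

lemma so3_like_inner:
  assumes "so3_like L"
  shows "L x \<bullet> L y = x \<bullet> y"
proof -
  have "orthogonal_transformation L"
    using assms by (simp add: so3_like_def orthogonal_transformation)
  then show ?thesis
    by (simp add: orthogonal_transformation_def)
qed

text \<open>One conjugation brings \<open>L i\<close> back to \<open>i\<close>; a second one, by a
  unit commuting with \<open>i\<close>, brings the image of \<open>j\<close> back to
  \<open>j\<close>. The remaining orthogonal map fixes 1, \<open>i\<close>, \<open>j\<close> and
  sends \<open>k\<close> to \<open>c *\<^sub>R k\<close>, and its determinant \<open>c\<close> is
  positive.\<close>

lemma so3_like_imp_conj:
  assumes L: "so3_like L"
  obtains u where "norm u = 1" "\<And>q. L q = qmul (qmul u q) (qcnj u)"
proof -
  define i j k :: quat where "i = axis 2 1" and "j = axis 3 1" and "k = axis 4 1"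
  note ijk = i_def j_def k_def
  have im: "i $ 1 = 0" "j $ 1 = 0" "k $ 1 = 0" "norm i = 1" "norm j = 1" "norm k = 1"
    and anti: "qmul j i = - qmul i j" "qmul i j = - qmul j i"
    by (simp_all add: ijk axis_def norm_eq_sqrt_inner inner_quat quat_eq_iff)
  have Lim: "M x $ 1 = 0" "norm (M x) = 1" if "so3_like M" "x $ 1 = 0" "norm x = 1" for M x
    using that by (auto simp: so3_like_def)
  obtain u where u: "norm u = 1" "qmul u i = qmul (L i) u"
    using conjugate_imaginary_units[OF im(1,4) Lim[OF L im(1,4)] im(5) anti(1)] by metis
  define M where "M q = qmul (qmul (qcnj u) (L q)) u" for q
  have M: "so3_like M"
    unfolding M_def[abs_def] by (rule so3_like_conj[OF L u(1)])
  have Mi: "M i = i"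
    using u by (simp add: M_def qmul_assoc qmul_qcnj_unit flip: u(2))
  have "M j \<bullet> i = 0"
    using so3_like_inner[OF M, of j i] unfolding Mi by (simp add: ijk inner_axis_axis)
  then have MjI: "qmul i (M j) = - qmul (M j) i"
    using imaginary_anticommute Lim(1)[OF M im(2,5)] im(1) by (metis inner_commute)
  \<comment> \<open>\<open>i\<close> anticommutes with \<open>M j\<close>, being orthogonal to it,
    and with \<open>j\<close>, hence commutes with their product. Therefore \<open>v\<close>
    commutes with \<open>i\<close>, and conjugation by \<open>v\<close> does not disturb
    \<open>i\<close>.\<close>
  have comm: "qmul i (qmul (M j) j) = qmul (qmul (M j) j) i"
    by (simp add: MjI anti qmul_assoc qmul.minus_left qmul.minus_right flip: qmul_assoc)
      (simp add: anti(1) qmul_assoc qmul.minus_right)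
  obtain v where v: "norm v = 1" "qmul v j = qmul (M j) v"
    "qmul i i = qmul i i \<Longrightarrow> qmul i (qmul (M j) j) = qmul (qmul (M j) j) i \<Longrightarrow> qmul i v = qmul v i"
    using conjugate_imaginary_units[OF im(2,5) Lim[OF M im(2,5)] im(4) anti(2)] by metis
  have vi: "qmul i v = qmul v i"
    using v(3) comm by simp
  define N where "N q = qmul (qmul (qcnj v) (M q)) v" for q
  have N: "so3_like N"
    unfolding N_def[abs_def] by (rule so3_like_conj[OF M v(1)])
  have Nj: "N j = j" and Ni: "N i = i"
    by (simp_all add: N_def Mi qmul_assoc qmul_qcnj_unit v(1) vi flip: v(2))
  have comps: "N q $ 2 = q $ 2" "N q $ 3 = q $ 3" "N q $ 1 = q $ 1" for q
    using so3_like_inner[OF N, of q i] so3_like_inner[OF N, of q j] N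
    unfolding Ni Nj by (simp_all add: ijk inner_axis so3_like_def)
  define c where "c = N k $ 4"
  have lin: "linear N"
    using N by (simp add: so3_like_def)
  have kc: "N k = c *\<^sub>R k"
    using comps[of k] by (simp add: quat_eq_iff c_def) (simp add: ijk axis_def)
  have "norm (N k) = 1"
    using N im(6) by (simp add: so3_like_def)
  then have "\<bar>c\<bar> = 1"
    by (simp add: kc im(6))
  have N4: "N q $ 4 = c * q $ 4" for q
  proof -
    have "N q \<bullet> N k = q \<bullet> k"
      by (rule so3_like_inner[OF N])
    then have "c * N q $ 4 = q $ 4"
      by (simp add: kc) (simp add: ijk inner_axis)
    then have "c * (c * N q $ 4) = c * q $ 4"
      by simp
    moreover have "c * c = 1"
      using \<open>\<bar>c\<bar> = 1\<close> by (metis abs_mult_self_eq mult_1)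
    ultimately show ?thesis
      by (simp flip: mult.assoc)
  qed
  have "det (matrix N) = (\<Prod>m\<in>UNIV. matrix N $ m $ m)"
  proof (rule det_diagonal)
    fix m n :: 4 assume "m \<noteq> n"
    then show "matrix N $ m $ n = 0"
      using comps N4 exhaust_4[of m] by (auto simp: matrix_def axis_def)
  qed
  also have "\<dots> = c"
  proof -
    have "matrix N $ 1 $ 1 = 1" "matrix N $ 2 $ 2 = 1" "matrix N $ 3 $ 3 = 1" "matrix N $ 4 $ 4 = c"
      by (simp_all add: matrix_def comps N4)
    moreover have "prod g UNIV = g 1 * g 2 * g 3 * g 4" for g :: "4 \<Rightarrow> real"
      unfolding UNIV_4 by (simp add: ac_simps)
    ultimately show ?thesis
      by simp
  qed
  finally have "c = 1"
    using N \<open>\<bar>c\<bar> = 1\<close> by (simp add: so3_like_def)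
  then have Nq: "N q = q" for q
    using comps N4 by (simp add: quat_eq_iff)
  have "L q = qmul (qmul (qmul u v) q) (qcnj (qmul u v))" for q
  proof -
    have "L q = qmul u (qmul (qmul v (qmul (N q) (qcnj v))) (qcnj u))"
      by (simp add: N_def M_def qmul_assoc qmul_qcnj_unit u v)
    then show ?thesis
      by (simp add: Nq qcnj_mul qmul_assoc)
  qed
  then show thesis
    by (intro that[of "qmul u v"]) (simp_all add: norm_qmul u v)
qed

section \<open>From fixed points to linearity\<close>

lemma cosh_dist_eq_iff: "x \<in> Bq \<Longrightarrow> y \<in> Bq \<Longrightarrow> cosh_dist x = cosh_dist y \<longleftrightarrow> norm x = norm y"
proof -
  assume "x \<in> Bq" "y \<in> Bq"
  then have "1 - (norm x)\<^sup>2 > 0" "1 - (norm y)\<^sup>2 > 0"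
    by (simp_all add: Bq_norm_sq)
  then have "cosh_dist x = cosh_dist y \<longleftrightarrow> (norm x)\<^sup>2 = (norm y)\<^sup>2"
    unfolding cosh_dist_def by (simp add: frac_eq_eq algebra_simps)
  then show ?thesis
    by (simp add: power2_eq_iff_nonneg)
qed

text \<open>By \<open>reach_0_iff\<close> the norm encodes the distance from 0. An isometry fixing 0
  cannot increase it, and neither can its inverse.\<close>

lemma isometry_fix_0_norm:
  assumes "isometry_pair f k" "f 0 = 0" "x \<in> Bq"
  shows "norm (f x) = norm x"
proof -
  have le: "cosh_dist (h y) \<le> cosh_dist y" if "isometry_pair h h'" "h 0 = 0" "y \<in> Bq" for h h' y
  proof -
    have "cosh_dist y \<ge> 1"
      by (rule cosh_dist_ge_1[OF that(3)])
    then have "0 \<le> arcosh (cosh_dist y)" "reach (arcosh (cosh_dist y)) 0 y"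
      using that(3) by (simp_all add: reach_0_iff)
    then show ?thesis
      using reach_lower_bound[OF _ \<open>0 \<le> arcosh (cosh_dist y)\<close>, of "h y"] reach_isometry[OF that(1), of _ 0 y]
        that(2) \<open>cosh_dist y \<ge> 1\<close> by simp
  qed
  have 0: "0 \<in> Bq"
    by (simp add: Bq_iff)
  note D = isometry_pairD[OF assms(1)]
  have "k 0 = 0"
    using D(2)[OF 0] assms(2) by simp
  then have "cosh_dist (k (f x)) \<le> cosh_dist (f x)"
    by (rule le[OF isometry_pair_inverse[OF assms(1)] _ D(1)[OF assms(3)]])
  then have "cosh_dist (f x) = cosh_dist x"
    using le[OF assms] D(2)[OF assms(3)] by simp
  then show ?thesis
    using cosh_dist_eq_iff D(1) assms(3) by blast
qed

text \<open>Conjugating by the translation \<open>m\<close> from \<open>1/2\<close> to 0 shows that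
  \<open>norm (m q)\<close> is preserved too. By \<open>norm_mob\<close> and the invariance of
  \<open>norm q\<close> this preserves the norm of \<open>1 - q/2\<close>, whose square is affine in
  the real part.\<close>

lemma isometry_fix_axis_Re:
  assumes f: "isometry_pair f k" "f 0 = 0" "f ((1/2) *\<^sub>R qone) = (1/2) *\<^sub>R qone" and x: "x \<in> Bq"
  shows "f x $ 1 = x $ 1"
proof -
  obtain s :: real where s: "tanh s = 1/2"
    using tanh_surj[of "1/2"] by auto
  define m where "m = act qone 1 (- s)"
  have m: "isometry_pair m (act qone 1 s)"
    using act_isometry_pair[OF grp_translation, of "- s"] by (simp add: m_def)
  have m1: "m q = mob (- (1/2)) q" for q
    by (simp add: m_def act_tanh s)
  have "isometry_pair (m \<circ> f \<circ> act qone 1 s) (m \<circ> (k \<circ> act qone 1 s))"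
    by (rule isometry_pair_comp[OF isometry_pair_inverse[OF m] isometry_pair_comp[OF f(1) m]])
  moreover have "(m \<circ> f \<circ> act qone 1 s) 0 = 0"
  proof -
    have "act qone 1 s 0 = (1/2) *\<^sub>R qone"
      by (simp add: act_tanh s mob_def)
    then show ?thesis
      by (simp add: f m1 mob_def qmul.zero_right)
  qed
  moreover have "m x \<in> Bq"
    using isometry_pairD(1)[OF m x] .
  ultimately have "norm ((m \<circ> f \<circ> act qone 1 s) (m x)) = norm (m x)"
    by (rule isometry_fix_0_norm)
  then have "norm (m (f x)) = norm (m x)"
    using isometry_pairD(2)[OF m x] by simp
  moreover have fx: "f x \<in> Bq" "norm (f x) = norm x"
    using isometry_pairD(1)[OF f(1) x] isometry_fix_0_norm[OF f(1,2) x] by auto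
  moreover have half: "\<bar>- (1/2) :: real\<bar> < 1"
    by simp
  moreover have "1 - (norm (mob (- (1/2)) (f x)))\<^sup>2 = 1 - (norm (mob (- (1/2)) x))\<^sup>2"
    using calculation(1) by (simp add: m1)
  ultimately have eq: "(1 - (- (1/2))\<^sup>2) * (1 - (norm x)\<^sup>2) / (norm (qone + (- (1/2)) *\<^sub>R f x))\<^sup>2
     = (1 - (- (1/2))\<^sup>2) * (1 - (norm x)\<^sup>2) / (norm (qone + (- (1/2)) *\<^sub>R x))\<^sup>2"
    by (simp only: norm_mob[OF half fx(1)] norm_mob[OF half x] fx(2))
  have "(1 - (- (1/2))\<^sup>2) * (1 - (norm x)\<^sup>2) \<noteq> 0"
    using x by (simp add: Bq_norm_sq power2_eq_square)
  then have "inverse ((norm (qone + (- (1/2)) *\<^sub>R f x))\<^sup>2) = inverse ((norm (qone + (- (1/2)) *\<^sub>R x))\<^sup>2)"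
    using eq unfolding divide_inverse by (simp only: mult_cancel_left) simp
  then have "(norm (qone + (- (1/2)) *\<^sub>R f x))\<^sup>2 = (norm (qone + (- (1/2)) *\<^sub>R x))\<^sup>2"
    by (rule inverse_eq_imp_eq)
  then show ?thesis
    unfolding norm_one_add_scaleR by (simp add: fx)
qed

text \<open>An isometry that preserves norm and real part maps the radial vector field to itself, by the
  equality case of the Cauchy-Schwarz inequality.\<close>
lemma isometry_radial:
  assumes f: "isometry_pair f k" and inv: "\<And>x. x \<in> Bq \<Longrightarrow> norm (f x) = norm x" "\<And>x. x \<in> Bq \<Longrightarrow> f x $ 1 = x $ 1"
    and q: "q \<in> Bq"
  shows "frechet_derivative f (at q) q = f q"
proof -
  define D where "D = frechet_derivative f (at q)"
  have D: "(f has_derivative D) (at q)"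
    unfolding D_def by (rule isometry_pairD(5)[OF f q])
  have "((\<lambda>x. f x \<bullet> f x) has_derivative (\<lambda>v. f q \<bullet> D v + D v \<bullet> f q)) (at q)"
    by (rule has_derivative_inner[OF D D])
  then have "((\<lambda>x. x \<bullet> x) has_derivative (\<lambda>v. f q \<bullet> D v + D v \<bullet> f q)) (at q)"
    by (rule has_derivative_transform_within_open[OF _ open_Bq q]) (simp add: inv flip: power2_norm_eq_inner)
  moreover have "((\<lambda>x. x \<bullet> x) has_derivative (\<lambda>v. q \<bullet> v + v \<bullet> q)) (at q)"
    by (rule has_derivative_inner[OF has_derivative_ident has_derivative_ident])
  ultimately have "(\<lambda>v. f q \<bullet> D v + D v \<bullet> f q) = (\<lambda>v. q \<bullet> v + v \<bullet> q)"
    by (rule has_derivative_unique)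
  then have "f q \<bullet> D q + D q \<bullet> f q = q \<bullet> q + q \<bullet> q"
    by metis
  then have 1: "f q \<bullet> D q = q \<bullet> q"
    by (simp add: inner_commute)
  have "((\<lambda>x. f x $ 1) has_derivative (\<lambda>v. D v $ 1)) (at q)"
    by (rule bounded_linear.has_derivative[OF bounded_linear_vec_nth D])
  then have "((\<lambda>x. x $ 1) has_derivative (\<lambda>v. D v $ 1)) (at q)"
    by (rule has_derivative_transform_within_open[OF _ open_Bq q]) (simp add: inv)
  moreover have "((\<lambda>x. x $ 1) has_derivative (\<lambda>v. v $ 1)) (at q)" for q :: quat
    by (rule bounded_linear_imp_has_derivative[OF bounded_linear_vec_nth])
  ultimately have "(\<lambda>v. D v $ 1) = (\<lambda>v. v $ 1)"
    using has_derivative_unique by blast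
  then have 2: "D q $ 1 = q $ 1"
    by metis
  define n where "n = (1 - (norm q)\<^sup>2)\<^sup>2"
  define w where "w = (norm q)\<^sup>2 - (q $ 1)\<^sup>2"
  have "w \<ge> 0" "n > 0"
    using q nth_1_sq_le[of q] by (auto simp: w_def n_def Bq_norm_sq)
  then have "(n + 4 * w) * n \<noteq> 0"
    by simp
  moreover have "slice_metric (f q) (D q) (D q) = slice_metric q q q"
    unfolding D_def by (rule isometry_pairD(7)[OF f q])
  \<comment> \<open>The base point enters the metric through its norm, its real part and its product
    with the vector; all three agree, so only the terms \<open>D q \<bullet> D q\<close> and
    \<open>q \<bullet> q\<close> are left.\<close>
  ultimately have "n * (D q \<bullet> D q) = n * (q \<bullet> q)"
    unfolding slice_metric_explicit inv(1)[OF q] inv(2)[OF q] 1 2 n_def[symmetric] w_def[symmetric]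
    by simp
  then have 3: "D q \<bullet> D q = q \<bullet> q"
    using \<open>n > 0\<close> by simp
  have 4: "f q \<bullet> f q = q \<bullet> q"
    using inv(1)[OF q] by (simp flip: power2_norm_eq_inner)
  have "(D q - f q) \<bullet> (D q - f q) = 0"
    by (simp add: inner_diff_left inner_diff_right 1 3 4 inner_commute[of "D q" "f q"])
  then show ?thesis
    by (simp add: D_def)
qed

text \<open>Euler's argument for homogeneous functions: by \<open>isometry_radial\<close> the
  quotient \<open>f (t q) / t\<close> has derivative zero on \<open>{0<..1}\<close>, so
  \<open>f\<close> is linear along each radius and its value is the radial derivative at 0.\<close>

lemma isometry_linear:
  assumes f: "isometry_pair f k" and inv: "\<And>x. x \<in> Bq \<Longrightarrow> norm (f x) = norm x" "\<And>x. x \<in> Bq \<Longrightarrow> f x $ 1 = x $ 1"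
    and q: "q \<in> Bq"
  shows "f q = frechet_derivative f (at 0) q"
proof -
  have tq: "t *\<^sub>R q \<in> Bq" if "t \<in> {0..1}" for t
    using q that mult_le_one[of t "norm q"] mult_left_le_one_le[of "norm q" t] by (auto simp: Bq_iff)
  have line: "((\<lambda>t. f (t *\<^sub>R q)) has_vector_derivative frechet_derivative f (at (t *\<^sub>R q)) q) (at t within S)"
    if "t \<in> {0..1}" for t S
  proof -
    have D: "(f has_derivative frechet_derivative f (at (t *\<^sub>R q))) (at (t *\<^sub>R q))"
      using isometry_pairD(5)[OF f tq[OF that]] .
    have "((\<lambda>t. t *\<^sub>R q) has_derivative (\<lambda>s. s *\<^sub>R q)) (at t within S)"
      by (intro bounded_linear_imp_has_derivative bounded_linear_scaleR_left)
    from has_derivative_compose[OF this D] show ?thesis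
      unfolding has_vector_derivative_def using linear_scale[OF has_derivative_linear[OF D]] by simp
  qed
  have "\<exists>c. \<forall>t\<in>{0<..1}. (1 / t) *\<^sub>R f (t *\<^sub>R q) = c"
  proof -
    have deriv: "((\<lambda>t. (1 / t) *\<^sub>R f (t *\<^sub>R q)) has_vector_derivative 0) (at t within {0<..1})" if t: "t \<in> {0<..1}" for t
    proof -
      have t': "t \<in> {0..1}" "t \<noteq> 0"
        using t by auto
      have D: "linear (frechet_derivative f (at (t *\<^sub>R q)))"
        using isometry_pairD(5)[OF f tq[OF t'(1)]] has_derivative_linear by blast
      have "t *\<^sub>R frechet_derivative f (at (t *\<^sub>R q)) q = f (t *\<^sub>R q)"
        using isometry_radial[OF f inv tq[OF t'(1)]] linear_scale[OF D] by simp
      then have "frechet_derivative f (at (t *\<^sub>R q)) q = (1 / t) *\<^sub>R f (t *\<^sub>R q)"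
        using t'(2) by (metis divide_inverse_commute divideR_right mult.right_neutral)
      moreover have "((\<lambda>t. 1 / t) has_real_derivative - (1 / t\<^sup>2)) (at t within {0<..1})"
        using t'(2) by (auto intro!: derivative_eq_intros simp: power2_eq_square)
      ultimately show ?thesis
        using has_vector_derivative_scaleR[OF _ line[OF t'(1)]] by (fastforce simp: power2_eq_square)
    qed
    obtain c where "\<And>t. t \<in> {0<..1} \<Longrightarrow> (1 / t) *\<^sub>R f (t *\<^sub>R q) = c"
      using has_vector_derivative_zero_constant[OF convex_real_interval(6) deriv] by blast
    then show ?thesis
      by blast
  qed
  then obtain c where const: "\<forall>t\<in>{0<..1}. (1 / t) *\<^sub>R f (t *\<^sub>R q) = c"
    by blast
  have c: "(1 / t) *\<^sub>R f (t *\<^sub>R q) = f q" if "t \<in> {0<..1}" for t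
    using bspec[OF const that] bspec[OF const, of 1] by simp
  have 0: "f 0 = 0"
    using inv(1)[of 0] by (simp add: Bq_iff)
  have hom: "f (t *\<^sub>R q) = t *\<^sub>R f q" if "t \<in> {0..1}" for t
  proof (cases "t = 0")
    case False
    then have "f q = (1 / t) *\<^sub>R f (t *\<^sub>R q)"
      using c[of t] that by auto
    then show ?thesis
      using False by simp
  qed (simp add: 0)
  have "((\<lambda>t. f (t *\<^sub>R q)) has_vector_derivative frechet_derivative f (at 0) q) (at 0 within {0..1})"
    using line[of 0] by simp
  then have "((\<lambda>t. t *\<^sub>R f q) has_vector_derivative frechet_derivative f (at 0) q) (at 0 within {0..1})"
    by (rule has_vector_derivative_transform[rotated 2]) (auto simp: hom)
  moreover have "((\<lambda>t. t *\<^sub>R f q) has_vector_derivative f q) (at 0 within {0..1})"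
    by (auto intro!: derivative_eq_intros)
  ultimately show ?thesis
    using vector_derivative_unique_within_closed_interval[of 0 1 0] by (metis box_real(2) atLeastAtMost_iff order_refl zero_le_one zero_less_one)
qed

lemma Iso_plus_imp_act:
  assumes "f \<in> Iso_plus"
  obtains u e t where "(u, e, t) \<in> grp" "\<And>q. q \<in> Bq \<Longrightarrow> f q = act u e t q"
proof -
  define k where "k = inv_into Bq f"
  have f: "isometry_pair f k"
    using assms isometry_B_pair by (simp add: Iso_plus_def k_def)
  have 0: "0 \<in> Bq"
    by (simp add: Bq_iff)
  obtain y where y: "f 0 = y *\<^sub>R qone" "\<bar>y\<bar> < 1"
    using isometry_preserves_axis[OF f, of 0] by auto
  obtain t where t: "tanh t = y"
    using tanh_surj[OF y(2)] .
  \<comment> \<open>The translation undoes the displacement of 0 along the real axis.\<close>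
  define f1 where "f1 = act qone 1 (- t) \<circ> f"
  have f1: "isometry_pair f1 (k \<circ> act qone 1 t)"
    using isometry_pair_comp[OF f act_isometry_pair[OF grp_translation, of "- t"]] by (simp add: f1_def)
  have f10: "f1 0 = 0"
    by (simp add: f1_def y act_tanh t mob_def qmul.zero_right)
  obtain z where z: "f1 ((1/2) *\<^sub>R qone) = z *\<^sub>R qone"
    using isometry_preserves_axis[OF f1, of "1/2"] by auto
  have "norm (f1 ((1/2) *\<^sub>R qone)) = 1/2"
    using isometry_fix_0_norm[OF f1 f10, of "(1/2) *\<^sub>R qone"] by (simp add: Bq_iff)
  then have "\<bar>z\<bar> = 1/2"
    by (simp add: z)
  \<comment> \<open>\<open>f1\<close> sends \<open>1/2\<close> to \<open>1/2\<close> or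
    \<open>- 1/2\<close>; the sign \<open>e\<close> corrects this.\<close>
  then obtain e where e: "e \<in> {1, -1}" "e * z = 1/2"
    by (cases "z = 1/2") (auto intro: that[of 1] that[of "-1"])
  have ge: "(qone, e, 0) \<in> grp"
    using e by (simp add: grp_def Sp1_def)
  define h where "h = act qone e 0 \<circ> f1"
  define k' where "k' = (k \<circ> act qone 1 t) \<circ> act (qcnj qone) e (- (e * 0))"
  have h: "isometry_pair h k'"
    unfolding h_def k'_def by (rule isometry_pair_comp[OF f1 act_isometry_pair[OF ge]])
  have h0: "h 0 = 0" "h ((1/2) *\<^sub>R qone) = (1/2) *\<^sub>R qone"
    using e(2) by (simp_all add: h_def f10 z act_mob)
  have inv: "norm (h x) = norm x" "h x $ 1 = x $ 1" if "x \<in> Bq" for x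
    using isometry_fix_0_norm[OF h h0(1) that] isometry_fix_axis_Re[OF h h0 that] by auto
  define L where "L = frechet_derivative h (at 0)"
  have hL: "h q = L q" if "q \<in> Bq" for q
    unfolding L_def by (rule isometry_linear[OF h inv that])
  have linL: "linear L"
    unfolding L_def using isometry_pairD(5)[OF h 0] has_derivative_linear by blast
  have "norm (L q) = norm q \<and> L q $ 1 = q $ 1" for q
  proof -
    \<comment> \<open>\<open>h\<close> agrees with \<open>L\<close> on the ball only, so
      \<open>q\<close> is scaled into it.\<close>
    define s where "s = 1 / (1 + norm q)"
    have s: "s > 0"
      by (simp add: s_def add_pos_nonneg)
    have "s *\<^sub>R q \<in> Bq"
      by (simp add: Bq_iff s_def add_pos_nonneg)
    then have "norm (L (s *\<^sub>R q)) = norm (s *\<^sub>R q)" "L (s *\<^sub>R q) $ 1 = (s *\<^sub>R q) $ 1"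
      using inv hL by metis+
    then show ?thesis
      using s by (simp add: linear_scale[OF linL])
  qed
  moreover have "det (matrix L) > 0"
  proof -
    define D0 where "D0 = frechet_derivative f (at 0)"
    define D1 where "D1 = frechet_derivative (act qone 1 (- t)) (at (f 0))"
    define D2 where "D2 = frechet_derivative (act qone e 0) (at (f1 0))"
    have B: "f 0 \<in> Bq" "f1 0 \<in> Bq"
      using isometry_pairD(1)[OF f 0] isometry_pairD(1)[OF f1 0] by auto
    have d: "(f has_derivative D0) (at 0)" "(act qone 1 (- t) has_derivative D1) (at (f 0))"
      "(act qone e 0 has_derivative D2) (at (f1 0))"
      unfolding D0_def D1_def D2_def
      using isometry_pairD(5)[OF f 0] isometry_pairD(5)[OF act_isometry_pair[OF grp_translation] B(1)]
        isometry_pairD(5)[OF act_isometry_pair[OF ge] B(2)] by auto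
    have "(h has_derivative D2 \<circ> (D1 \<circ> D0)) (at 0)"
      \<comment> \<open>By the chain rule \<open>L\<close> is a composition of derivatives that all
        have positive determinant.\<close>
      unfolding h_def f1_def by (intro diff_chain_at d d[unfolded f1_def])
    then have "L = D2 \<circ> (D1 \<circ> D0)"
      unfolding L_def by (rule frechet_derivative_eqI)
    moreover have "det (matrix D0) > 0"
      using assms 0 by (simp add: Iso_plus_def orient_pres_B_def D0_def)
    moreover have "det (matrix D1) > 0" "det (matrix D2) > 0"
      using act_in_Iso_plus[OF grp_translation] act_in_Iso_plus[OF ge] B
      by (simp_all add: Iso_plus_def orient_pres_B_def D1_def D2_def)
    ultimately show ?thesis
      using det_comp_pos linear_compose has_derivative_linear d by metis
  qed
  ultimately have "so3_like L"
    using linL by (simp add: so3_like_def)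
  then obtain u where u: "norm u = 1" "\<And>q. L q = qmul (qmul u q) (qcnj u)"
    using so3_like_imp_conj by blast
  have gu: "(u, 1, 0) \<in> grp"
    using u(1) by (simp add: grp_def Sp1_def)
  have "f q = act qone 1 t (act qone e 0 (act u 1 0 q))" if q: "q \<in> Bq" for q
  proof -
    have fq: "f q \<in> Bq" "f1 q \<in> Bq"
      using isometry_pairD(1)[OF f q] isometry_pairD(1)[OF f1 q] by auto
    have "act u 1 0 q = h q"
      by (simp add: act_mob hL[OF q] u(2))
    moreover have "act qone e 0 (h q) = f1 q"
      using act_inverse(2)[OF ge fq(2)] by (simp add: h_def)
    moreover have "act qone 1 t (f1 q) = f q"
      using act_inverse(1)[OF grp_translation fq(1)] by (simp add: f1_def)
    ultimately show ?thesis
      by simp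
  qed
  moreover have gue: "(u, e, 0) \<in> grp" "(u, e, e * t) \<in> grp"
    using e u by (simp_all add: grp_def Sp1_def)
  moreover have "act qone e 0 (act u 1 0 q) = act u e 0 q" "act qone 1 t (act u e 0 q) = act u e (e * t) q"
    if "q \<in> Bq" for q
    using act_act[OF ge gu that] act_act[OF grp_translation gue(1) that, of t] by simp_all
  ultimately show thesis
    by (intro that[of u e "e * t"]) simp_all
qed

lemma act_maps_same_Iso_plus: "same_on_B act_maps Iso_plus"
  unfolding same_on_B_def
proof (intro conjI ballI)
  fix f assume "f \<in> act_maps"
  then have "f \<in> Iso_plus"
    unfolding act_maps_def using act_in_Iso_plus by blast
  then show "\<exists>h\<in>Iso_plus. \<forall>q\<in>Bq. f q = h q"
    by blast
next
  fix h assume "h \<in> Iso_plus"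
  then obtain u e t where "(u, e, t) \<in> grp" "\<And>q. q \<in> Bq \<Longrightarrow> h q = act u e t q"
    using Iso_plus_imp_act by blast
  then show "\<exists>f\<in>act_maps. \<forall>q\<in>Bq. f q = h q"
    unfolding act_maps_def by (intro bexI[of _ "act u e t"]) auto
qed

section \<open>The identification with the double coset space\<close>

lemma qmat_mul_nth [simp]: "qmat_mul A B $ i $ j = qmul (A $ i $ 1) (B $ 1 $ j) + qmul (A $ i $ 2) (B $ 2 $ j)"
  by (simp add: qmat_mul_def sum_2)

lemma qmat_adj_nth [simp]: "qmat_adj A $ i $ j = qcnj (A $ j $ i)"
  by (simp add: qmat_adj_def)

lemma qmat_diag_nth [simp]:
  "qmat_diag x y $ 1 $ 1 = x" "qmat_diag x y $ 1 $ 2 = 0" "qmat_diag x y $ 2 $ 1 = 0" "qmat_diag x y $ 2 $ 2 = y"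
  by (simp_all add: qmat_diag_def)

lemma I11_nth [simp]: "I11 $ 1 $ 1 = qone" "I11 $ 1 $ 2 = 0" "I11 $ 2 $ 1 = 0" "I11 $ 2 $ 2 = - qone"
  by (simp_all add: I11_def)

lemma qmat_eq_iff: "(A::qmat) = B \<longleftrightarrow> A $ 1 $ 1 = B $ 1 $ 1 \<and> A $ 1 $ 2 = B $ 1 $ 2 \<and> A $ 2 $ 1 = B $ 2 $ 1 \<and> A $ 2 $ 2 = B $ 2 $ 2"
  by (auto simp: vec_eq_iff forall_2)

lemmas qmul_zero [simp] = qmul.zero_left qmul.zero_right

lemma qmat_mul_assoc: "qmat_mul (qmat_mul A B) C = qmat_mul A (qmat_mul B C)"
  by (simp add: qmat_eq_iff qmul.add_left qmul.add_right qmul_assoc)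

lemma qmat_adj_mul: "qmat_adj (qmat_mul A B) = qmat_mul (qmat_adj B) (qmat_adj A)"
  by (simp add: qmat_eq_iff qcnj_add qcnj_mul)

lemma Sp11_mul:
  assumes "A \<in> Sp11" "B \<in> Sp11"
  shows "qmat_mul A B \<in> Sp11"
proof -
  have "qmat_mul (qmat_adj (qmat_mul A B)) (qmat_mul I11 (qmat_mul A B))
    = qmat_mul (qmat_adj B) (qmat_mul (qmat_mul (qmat_adj A) (qmat_mul I11 A)) B)"
    by (simp only: qmat_adj_mul qmat_mul_assoc)
  then show ?thesis
    using assms by (simp add: Sp11_def)
qed

lemma Sp11_iff:
  "A \<in> Sp11 \<longleftrightarrow> (norm (A $ 1 $ 1))\<^sup>2 = 1 + (norm (A $ 2 $ 1))\<^sup>2 \<and> (norm (A $ 2 $ 2))\<^sup>2 = 1 + (norm (A $ 1 $ 2))\<^sup>2 \<and>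
    qmul (qcnj (A $ 1 $ 1)) (A $ 1 $ 2) = qmul (qcnj (A $ 2 $ 1)) (A $ 2 $ 2)"
proof -
  have real: "r *\<^sub>R qone - s *\<^sub>R qone = qone \<longleftrightarrow> r = 1 + s" "r *\<^sub>R qone - s *\<^sub>R qone = - qone \<longleftrightarrow> s = 1 + r" for r s
    by (auto simp: quat_eq_iff)
  have cnj: "qmul (qcnj (A $ 1 $ 2)) (A $ 1 $ 1) = qmul (qcnj (A $ 2 $ 2)) (A $ 2 $ 1)
    \<longleftrightarrow> qmul (qcnj (A $ 1 $ 1)) (A $ 1 $ 2) = qmul (qcnj (A $ 2 $ 1)) (A $ 2 $ 2)"
    by (metis qcnj_mul qcnj_qcnj)
  show ?thesis
    unfolding Sp11_def mem_Collect_eq qmat_eq_iff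
    by (auto simp: qmul.minus_left qmul.minus_right qmul_qcnj_left real cnj)
qed

text \<open>\<open>Sp11\<close> relates the columns, while \<open>Phi\<close> depends on the second
  row, so the row relations are derived. Norms in the off-diagonal relation give
  \<open>norm a = norm d\<close>; multiplying by \<open>a\<close> then gives the product
  relation.\<close>

lemma Sp11_rows:
  assumes "A \<in> Sp11"
  shows "A $ 1 $ 1 \<noteq> 0" "A $ 2 $ 2 \<noteq> 0" "norm (A $ 1 $ 1) = norm (A $ 2 $ 2)" "norm (A $ 2 $ 1) = norm (A $ 1 $ 2)"
    "qmul (A $ 1 $ 1) (qcnj (A $ 2 $ 1)) = qmul (A $ 1 $ 2) (qcnj (A $ 2 $ 2))"
    "norm (A $ 2 $ 1) < norm (A $ 2 $ 2)"
proof -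
  define a b c d where "a = A $ 1 $ 1" and "b = A $ 2 $ 1" and "c = A $ 1 $ 2" and "d = A $ 2 $ 2"
  note defs = a_def[symmetric] b_def[symmetric] c_def[symmetric] d_def[symmetric]
  have A: "(norm a)\<^sup>2 = 1 + (norm b)\<^sup>2" "(norm d)\<^sup>2 = 1 + (norm c)\<^sup>2" "qmul (qcnj a) c = qmul (qcnj b) d"
    using assms by (simp_all add: Sp11_iff defs)
  have pos: "(norm a)\<^sup>2 > 0" "(norm d)\<^sup>2 > 0"
    unfolding A by (simp_all add: add_pos_nonneg)
  then show a: "A $ 1 $ 1 \<noteq> 0" and d: "A $ 2 $ 2 \<noteq> 0"
    by (auto simp: a_def d_def)
  have "norm a * norm c = norm b * norm d"
    using arg_cong[OF A(3), of norm] by (simp add: norm_qmul)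
  then have "(norm a)\<^sup>2 * (norm c)\<^sup>2 = (norm b)\<^sup>2 * (norm d)\<^sup>2"
    by (metis power_mult_distrib)
  then have "(norm a)\<^sup>2 * ((norm d)\<^sup>2 - 1) = ((norm a)\<^sup>2 - 1) * (norm d)\<^sup>2"
    using A(1,2) by simp
  then have ad: "(norm a)\<^sup>2 = (norm d)\<^sup>2"
    by (simp add: algebra_simps)
  then show "norm (A $ 1 $ 1) = norm (A $ 2 $ 2)"
    by (simp add: defs)
  have "(norm b)\<^sup>2 = (norm c)\<^sup>2"
    using A ad by simp
  then show bc: "norm (A $ 2 $ 1) = norm (A $ 1 $ 2)"
    by (simp add: defs)
  have "qmul (qmul a (qcnj b)) d = qmul a (qmul (qcnj a) c)"
    by (simp add: qmul_assoc A(3))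
  also have "\<dots> = (norm a)\<^sup>2 *\<^sub>R c"
    by (simp add: qmul_qcnj_right qmul.scaleR_left flip: qmul_assoc)
  also have "\<dots> = qmul (qmul c (qcnj d)) d"
    by (simp add: qmul_assoc qmul_qcnj_left qmul.scaleR_right ad)
  finally show "qmul (A $ 1 $ 1) (qcnj (A $ 2 $ 1)) = qmul (A $ 1 $ 2) (qcnj (A $ 2 $ 2))"
    using d by (simp add: defs qmul_right_cancel)
  have "(norm b)\<^sup>2 < (norm d)\<^sup>2"
    using A ad by simp
  then show "norm (A $ 2 $ 1) < norm (A $ 2 $ 2)"
    unfolding defs by (rule power_less_imp_less_base) simp
qed

section \<open>The map \<open>Phi\<close> in terms of matrix entries\<close>

lemma seval_quadratic:
  assumes "\<And>n. n \<ge> 3 \<Longrightarrow> a n = 0"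
  shows "seval a q = a 0 + qmul q (a 1) + qmul q (qmul q (a 2))"
proof -
  have "seval a q = (\<Sum>n\<in>{0,1,2}. qmul (qpow q n) (a n))"
    unfolding seval_def
  proof (rule sum.mono_neutral_left)
    show "{n. a n \<noteq> 0} \<subseteq> {0, 1, 2}"
    proof
      fix n assume "n \<in> {n. a n \<noteq> 0}"
      then have "n < 3"
        using assms[of n] by (meson mem_Collect_eq not_le)
      then show "n \<in> {0, 1, 2}"
        by auto
    qed
  qed auto
  then show ?thesis
    by (simp add: numeral_2_eq_2 qmul_assoc)
qed

text \<open>With \<open>F\<close> the value of the left factor this is \<open>F d + q F c\<close>, which replaces the usual formula
  \<open>(f * g)(q) = f(q) g(f(q)\<^sup>-\<^sup>1 q f(q))\<close> without dividing by \<open>F\<close>.\<close>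
lemma seval_star_linear:
  "seval (sstar (ell a b) (ell c d)) q = qmul (b + qmul q a) d + qmul q (qmul (b + qmul q a) c)"
proof -
  have "sstar (ell a b) (ell c d) n = 0" if "n \<ge> 3" for n
    unfolding sstar_def using that by (intro sum.neutral) (auto simp: ell_def)
  then show ?thesis
    by (subst seval_quadratic)
      (simp_all add: sstar_def ell_def numeral_2_eq_2 qmul.add_left qmul.add_right qmul_assoc)
qed

lemma scnj_ell: "scnj (ell a b) = ell (qcnj a) (qcnj b)"
  by (auto simp: scnj_def ell_def fun_eq_iff)

text \<open>The symmetrisation has no zero in the ball, so only the numerator
  \<open>q F cnj a - F cnj c\<close> matters. The row relation eliminates \<open>c\<close>, and with
  \<open>b = p d\<close> and \<open>F = (1 - q p) d\<close> the condition becomes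
  \<open>q - p = q (q - p) p\<close>. As \<open>q\<close> and \<open>p\<close> have norm below 1,
  this forces \<open>q = p\<close>.\<close>

lemma regMob_sp11_inv_eq_0_iff:
  assumes X: "X \<in> Sp11" and q: "q \<in> Bq"
  shows "regMob (sp11_inv X) q = 0 \<longleftrightarrow> q = qmul (X $ 2 $ 1) (qinv (X $ 2 $ 2))"
proof -
  define a b c d where "a = X $ 1 $ 1" and "b = X $ 2 $ 1" and "c = X $ 1 $ 2" and "d = X $ 2 $ 2"
  note defs = a_def[symmetric] b_def[symmetric] c_def[symmetric] d_def[symmetric]
  note rows = Sp11_rows[OF X, unfolded defs]
  define p where "p = qmul b (qinv d)"
  have b: "b = qmul p d"
    using rows(2) by (simp add: p_def qmul_assoc qinv_qmul)
  have np: "norm p < 1"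
    using rows(2,6) by (simp add: p_def norm_qmul norm_qinv field_simps)
  have nq: "norm q < 1"
    using q by (simp add: Bq_iff)
  have less: "norm q * norm b < norm d"
    using mult_right_mono[of "norm q" 1 "norm b"] nq rows(6) by simp
  have nonzero: "x - qmul q y \<noteq> 0" if "norm x = norm d" "norm y = norm b" for x y
  proof
    assume "x - qmul q y = 0"
    then have "norm x = norm (qmul q y)"
      by simp
    then show False
      using less that by (simp add: norm_qmul)
  qed
  define F where "F = d - qmul q b"
  define G where "G = qcnj d - qmul q (qcnj b)"
  have F: "F \<noteq> 0" and G: "G \<noteq> 0"
    unfolding F_def G_def by (intro nonzero; simp)+
  have inv: "sp11_inv X $ 1 $ 1 = qcnj a" "sp11_inv X $ 1 $ 2 = - qcnj b" "sp11_inv X $ 2 $ 1 = - qcnj c" "sp11_inv X $ 2 $ 2 = qcnj d"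
    by (simp_all add: sp11_inv_def a_def b_def c_def d_def qmul.minus_left qmul.minus_right)
  have "seval (ssym (ell (- qcnj b) (qcnj d))) q = qmul G d - qmul q (qmul G b)"
    by (simp add: ssym_def scnj_ell seval_star_linear G_def qmul.minus_right qmul.minus_left qcnj_minus)
  moreover have "norm (qmul q (qmul G b)) < norm (qmul G d)"
    using less G by (simp add: norm_qmul)
  ultimately have sym: "seval (ssym (ell (- qcnj b) (qcnj d))) q \<noteq> 0"
    by auto
  have num: "seval (sstar (scnj (ell (- qcnj b) (qcnj d))) (ell (qcnj a) (- qcnj c))) q
      = qmul q (qmul F (qcnj a)) - qmul F (qcnj c)"
    by (simp add: scnj_ell seval_star_linear F_def qmul.minus_right qcnj_minus)
  have "qmul b (qcnj a) = qmul d (qcnj c)"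
    using arg_cong[OF rows(5), of qcnj] by (simp add: qcnj_mul)
  then have c: "qcnj c = qmul (qinv d) (qmul b (qcnj a))"
    using rows(2) by (simp add: qinv_qmul_assoc)
  have a: "qcnj a \<noteq> 0"
    using rows(1) by (metis norm_eq_zero norm_qcnj)
  have "regMob (sp11_inv X) q = 0 \<longleftrightarrow> qmul q (qmul F (qcnj a)) = qmul F (qcnj c)"
    using sym by (simp add: regMob_def star_inv_star_def inv num qmul_eq_0 qinv_eq_0)
  also have "qmul F (qcnj c) = qmul (qmul (qmul F (qinv d)) b) (qcnj a)"
    by (simp add: c qmul_assoc)
  also have "qmul q (qmul F (qcnj a)) = qmul (qmul (qmul F (qinv d)) b) (qcnj a) \<longleftrightarrow> qmul q F = qmul (qmul F (qinv d)) b"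
    using qmul_right_cancel[OF a] by (simp flip: qmul_assoc)
  also have "F = qmul (qone - qmul q p) d"
    by (simp add: F_def b qmul.diff_left qmul_assoc)
  also have "qmul (qmul (qmul (qone - qmul q p) d) (qinv d)) b = qmul (qmul (qone - qmul q p) p) d"
    using rows(2) by (simp add: b qmul_assoc qmul_qinv_assoc)
  also have "qmul q (qmul (qone - qmul q p) d) = qmul (qmul (qone - qmul q p) p) d
      \<longleftrightarrow> qmul q (qone - qmul q p) = qmul (qone - qmul q p) p"
    using qmul_right_cancel[OF rows(2)] by (simp flip: qmul_assoc)
  also have "\<dots> \<longleftrightarrow> q - p = qmul q (qmul (q - p) p)"
    by (simp add: qmul.diff_left qmul.diff_right qmul_assoc algebra_simps)
  also have "\<dots> \<longleftrightarrow> q = p"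
  proof
    assume "q - p = qmul q (qmul (q - p) p)"
    then have "norm (q - p) = norm q * norm p * norm (q - p)"
      by (metis norm_qmul mult.assoc mult.commute)
    moreover have "norm q * norm p < 1"
      using np nq by (metis mult_le_one norm_ge_zero less_le_not_le mult_strict_mono' mult_1)
    ultimately show "q = p"
      by (metis eq_iff_diff_eq_0 less_irrefl mult_cancel_right1 norm_eq_zero)
  qed simp
  finally show ?thesis
    by (simp add: p_def b_def d_def)
qed

lemma Phi_eq:
  assumes "X \<in> Sp11"
  shows "Phi X = qmul (X $ 2 $ 1) (qinv (X $ 2 $ 2))" and "Phi X \<in> Bq"
proof -
  have B: "qmul (X $ 2 $ 1) (qinv (X $ 2 $ 2)) \<in> Bq"
    using Sp11_rows(2,6)[OF assms] by (simp add: Bq_iff norm_qmul norm_qinv field_simps)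
  show Phi: "Phi X = qmul (X $ 2 $ 1) (qinv (X $ 2 $ 2))"
    unfolding Phi_def by (rule the_equality) (use regMob_sp11_inv_eq_0_iff[OF assms] B in auto)
  then show "Phi X \<in> Bq"
    using B by simp
qed

definition qmat2 :: "quat \<Rightarrow> quat \<Rightarrow> quat \<Rightarrow> quat \<Rightarrow> qmat" where
  "qmat2 a c b d = (\<chi> i j. if i = 1 then (if j = 1 then a else c) else (if j = 1 then b else d))"

lemma qmat2_nth [simp]:
  "qmat2 a c b d $ 1 $ 1 = a" "qmat2 a c b d $ 1 $ 2 = c" "qmat2 a c b d $ 2 $ 1 = b" "qmat2 a c b d $ 2 $ 2 = d"
  by (simp_all add: qmat2_def)

text \<open>Surjectivity makes \<open>induced_by\<close> determine a map on the whole ball.\<close>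

lemma Phi_surj:
  assumes "q \<in> Bq"
  obtains X where "X \<in> Sp11" "Phi X = q"
proof -
  define n where "n = 1 / sqrt (1 - (norm q)\<^sup>2)"
  have q: "1 - (norm q)\<^sup>2 > 0"
    using assms by (simp add: Bq_norm_sq)
  then have n: "n\<^sup>2 = 1 / (1 - (norm q)\<^sup>2)" "n \<noteq> 0"
    by (simp_all add: n_def power_divide)
  \<comment> \<open>The second row is proportional to \<open>(q, 1)\<close>, as
    \<open>Phi X = q\<close> demands; the first row is its Hermitian completion and \<open>n\<close>
    normalises.\<close>
  define X where "X = qmat2 (n *\<^sub>R qone) (n *\<^sub>R qcnj q) (n *\<^sub>R q) (n *\<^sub>R qone)"
  have "n\<^sup>2 = 1 + n\<^sup>2 * (norm q)\<^sup>2"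
    using q unfolding n by (simp add: field_simps)
  then have "X \<in> Sp11"
    by (simp add: Sp11_iff X_def power_mult_distrib qcnj_scaleR qmul.scaleR_left qmul.scaleR_right)
  moreover have "Phi X = q"
    unfolding Phi_eq(1)[OF \<open>X \<in> Sp11\<close>] using n(2)
    by (simp add: X_def qinv_scaleR qmul.scaleR_left qmul.scaleR_right)
  ultimately show thesis
    using that by blast
qed

lemma Phi_left_diag:
  assumes "norm x = 1" "norm y = 1" "X \<in> Sp11"
  shows "Phi (qmat_mul (qmat_diag x y) X) = act y 1 0 (Phi X)"
proof -
  have "qmat_diag x y \<in> Sp11"
    using assms by (simp add: Sp11_iff)
  then have "qmat_mul (qmat_diag x y) X \<in> Sp11"
    using assms Sp11_mul by blast
  then show ?thesis
    by (simp add: Phi_eq assms act_mob qinv_qmul_distrib qinv_unit qmul_assoc)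
qed

text \<open>Real entries commute with \<open>d\<close>, so for \<open>b = q d\<close> the new second
  row is a real-affine expression in \<open>q\<close> times \<open>d\<close> in each entry, and
  \<open>d\<close> cancels in the quotient.\<close>

lemma Phi_right_real:
  assumes X: "X \<in> Sp11" and A: "A \<in> Sp11"
    and real: "A $ 1 $ 1 = (e * \<delta>) *\<^sub>R qone" "A $ 1 $ 2 = \<gamma> *\<^sub>R qone" "A $ 2 $ 1 = (e * \<gamma>) *\<^sub>R qone" "A $ 2 $ 2 = \<delta> *\<^sub>R qone"
    and t: "tanh t = \<gamma> / \<delta>"
  shows "Phi (qmat_mul X A) = act qone e t (Phi X)"
proof -
  define b d where "b = X $ 2 $ 1" and "d = X $ 2 $ 2"
  define q where "q = Phi X"
  have \<delta>: "\<delta> \<noteq> 0"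
    using Sp11_rows(2)[OF A] real by auto
  have d: "d \<noteq> 0"
    using Sp11_rows(2)[OF X] by (simp add: d_def)
  have q: "q \<in> Bq" "b = qmul q d"
    using Phi_eq[OF X] d by (simp_all add: q_def b_def d_def qmul_assoc qinv_qmul)
  define N D where "N = q + tanh t *\<^sub>R qone" and "D = qone + tanh t *\<^sub>R q"
  have D: "D \<noteq> 0"
    unfolding D_def using one_add_scaleR_neq_0 tanh_abs_less_1 q(1) by blast
  have g: "\<gamma> = \<delta> * tanh t"
    using \<delta> by (simp add: t)
  have "qmat_mul X A $ 2 $ 1 = (e * \<delta>) *\<^sub>R qmul N d" "qmat_mul X A $ 2 $ 2 = \<delta> *\<^sub>R qmul D d"
    by (simp_all add: real N_def D_def q(2) g flip: b_def d_def)
      (simp_all add: qmul.add_left qmul.scaleR_left qmul.scaleR_right algebra_simps)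
  then have "Phi (qmat_mul X A) = e *\<^sub>R qmul N (qinv D)"
    unfolding Phi_eq(1)[OF Sp11_mul[OF X A]] using \<delta> d
    by (simp add: qinv_scaleR qinv_qmul_distrib qmul.scaleR_left qmul.scaleR_right qmul_assoc qmul_qinv_assoc del: qmat_mul_nth)
  also have "qmul N (qinv D) = qmul (qinv D) N"
    by (rule qinv_commute) (simp add: N_def D_def qmul_simps algebra_simps)
  finally show ?thesis
    by (simp add: act_mob mob_def N_def D_def q_def)
qed

lemma Sp11_identity: "qmat_diag qone qone \<in> Sp11"
  by (simp add: Sp11_iff)

text \<open>Test elements: commuting with the left action of -1 forces a diagonal matrix, and the
  quaternions commuting with \<open>i\<close> and \<open>j\<close> are the reals.\<close>

lemma Sp1_generators: "axis 2 1 \<in> Sp1" "axis 3 1 \<in> Sp1" "- qone \<in> Sp1"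
  unfolding Sp1_def by simp_all

lemma translation_maps_imp_act:
  assumes "f \<in> translation_maps"
  obtains u e t where "(u, e, t) \<in> grp" "\<And>q. q \<in> Bq \<Longrightarrow> f q = act u e t q"
proof -
  obtain A where A: "A \<in> Sp11" and
    "(commutes_actions (\<lambda>X. qmat_mul A X) \<and> induced_by (\<lambda>X. qmat_mul A X) f) \<or>
      (commutes_actions (\<lambda>X. qmat_mul X A) \<and> induced_by (\<lambda>X. qmat_mul X A) f)"
    using assms unfolding translation_maps_def by blast
  then show thesis
  proof (elim disjE conjE)
    assume com: "commutes_actions (\<lambda>X. qmat_mul A X)" and ind: "induced_by (\<lambda>X. qmat_mul A X) f"
    \<comment> \<open>The commutation condition is evaluated at the identity matrix with
      \<open>u = - qone\<close>.\<close>
    have "qmat_mul A (qmat_mul (qmat_diag (- qone) qone) (qmat_diag qone qone))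
        = qmat_mul (qmat_diag (- qone) qone) (qmat_mul A (qmat_diag qone qone))"
      using com Sp1_generators(3) Sp11_identity unfolding commutes_actions_def by blast
    then have "A $ 1 $ 2 = - A $ 1 $ 2" "- A $ 2 $ 1 = A $ 2 $ 1"
      unfolding qmat_eq_iff by (auto simp: qmul.minus_left qmul.minus_right)
    then have 0: "A $ 1 $ 2 = 0" "A $ 2 $ 1 = 0"
      by (auto simp: quat_eq_iff)
    then have diag: "A = qmat_diag (A $ 1 $ 1) (A $ 2 $ 2)"
      by (simp add: qmat_eq_iff)
    have n: "norm (A $ 1 $ 1) = 1" "norm (A $ 2 $ 2) = 1"
      using A 0 by (simp_all add: Sp11_iff power2_eq_1_iff) (smt (verit) norm_ge_zero)+
    have "f q = act (A $ 2 $ 2) 1 0 q" if "q \<in> Bq" for q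
    proof -
      obtain X where X: "X \<in> Sp11" "Phi X = q"
        using Phi_surj[OF \<open>q \<in> Bq\<close>] .
      then have "f q = Phi (qmat_mul A X)"
        using ind unfolding induced_by_def by blast
      then show ?thesis
        using Phi_left_diag[OF n X(1)] X(2) diag by simp
    qed
    then show thesis
      using n by (intro that[of "A $ 2 $ 2" 1 0]) (auto simp: grp_def Sp1_def)
  next
    assume com: "commutes_actions (\<lambda>X. qmat_mul X A)" and ind: "induced_by (\<lambda>X. qmat_mul X A) f"
    have comm: "qmat_mul (qmat_mul (qmat_diag qone qone) (qmat_diag u u)) A
        = qmat_mul (qmat_mul (qmat_diag qone qone) A) (qmat_diag u u)" if "u \<in> Sp1" for u
      using com that Sp11_identity unfolding commutes_actions_def by blast
    have "\<forall>i j. qmul u (A $ i $ j) = qmul (A $ i $ j) u" if "u \<in> Sp1" for u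
      using comm[OF that] unfolding qmat_eq_iff by (simp add: forall_2)
    moreover have "x = x $ 1 *\<^sub>R qone" if "\<And>u. u \<in> Sp1 \<Longrightarrow> qmul u x = qmul x u" for x
      using that[OF Sp1_generators(1)] that[OF Sp1_generators(2)] by (simp add: quat_eq_iff axis_def)
    ultimately have real: "A $ i $ j = A $ i $ j $ 1 *\<^sub>R qone" for i j
      by blast
    define \<alpha> \<beta> \<gamma> \<delta> where "\<alpha> = A $ 1 $ 1 $ 1" and "\<beta> = A $ 2 $ 1 $ 1" and "\<gamma> = A $ 1 $ 2 $ 1" and "\<delta> = A $ 2 $ 2 $ 1"
    have entries: "A $ 1 $ 1 = \<alpha> *\<^sub>R qone" "A $ 2 $ 1 = \<beta> *\<^sub>R qone" "A $ 1 $ 2 = \<gamma> *\<^sub>R qone" "A $ 2 $ 2 = \<delta> *\<^sub>R qone"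
      unfolding \<alpha>_def \<beta>_def \<gamma>_def \<delta>_def using real by auto
    have \<delta>: "\<delta> \<noteq> 0" "\<bar>\<gamma>\<bar> < \<bar>\<delta>\<bar>" "\<bar>\<alpha>\<bar> = \<bar>\<delta>\<bar>" "\<alpha> * \<gamma> = \<beta> * \<delta>"
      using Sp11_rows[OF A] A by (auto simp: entries Sp11_iff qcnj_scaleR qmul.scaleR_left qmul.scaleR_right mult.commute)
    \<comment> \<open>The diagonal entries have equal absolute value, so \<open>e\<close> is a sign,
      and \<open>\<alpha> * \<gamma> = \<beta> * \<delta>\<close> gives
      \<open>\<beta> = e * \<gamma>\<close>.\<close>
    define e where "e = \<alpha> / \<delta>"
    have e: "e \<in> {1, -1}" "\<alpha> = e * \<delta>" "\<beta> = e * \<gamma>"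
      using \<delta> by (auto simp: e_def field_simps abs_eq_iff)
    have "\<bar>\<gamma> / \<delta>\<bar> < 1"
      using \<delta> by simp
    then obtain t where t: "tanh t = \<gamma> / \<delta>"
      using tanh_surj by metis
    have "f q = act qone e t q" if "q \<in> Bq" for q
    proof -
      obtain X where X: "X \<in> Sp11" "Phi X = q"
        using Phi_surj[OF \<open>q \<in> Bq\<close>] .
      then have "f q = Phi (qmat_mul X A)"
        using ind unfolding induced_by_def by blast
      then show ?thesis
        using Phi_right_real[OF X(1) A _ _ _ _ t, of e] X(2) e(2,3) entries by simp
    qed
    then show thesis
      using e(1) by (intro that[of qone e t]) (auto simp: grp_def Sp1_def)
  qed
qed

lemma act_conj_translation:
  assumes "norm u = 1"
  shows "act u 1 0 \<in> translation_maps"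
proof -
  have "qmat_diag qone u \<in> Sp11"
    using assms by (simp add: Sp11_iff)
  moreover have "commutes_actions (\<lambda>X. qmat_mul (qmat_diag qone u) X)"
    unfolding commutes_actions_def
    by (simp add: qmat_mul_assoc) (simp add: qmat_eq_iff)
  moreover have "induced_by (\<lambda>X. qmat_mul (qmat_diag qone u) X) (act u 1 0)"
    unfolding induced_by_def using Phi_left_diag[of qone u] assms by simp
  ultimately show ?thesis
    unfolding translation_maps_def by blast
qed

lemma act_boost_translation:
  assumes "e \<in> {1, -1}"
  shows "act qone e t \<in> translation_maps"
proof -
  \<comment> \<open>This is \<open>H(t)\<close> times \<open>diag(e, 1)\<close>, the shape required
    by \<open>Phi_right_real\<close>.\<close>
  define A where "A = qmat2 ((e * cosh t) *\<^sub>R qone) (sinh t *\<^sub>R qone) ((e * sinh t) *\<^sub>R qone) (cosh t *\<^sub>R qone)"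
  have e: "e\<^sup>2 = 1" "\<bar>e\<bar> = 1"
    using assms by auto
  have A: "A \<in> Sp11"
    by (simp add: Sp11_iff A_def abs_mult e cosh_square_eq power_mult_distrib qcnj_scaleR qmul.scaleR_left qmul.scaleR_right)
  moreover have "qmat_mul (qmat_diag u u) A = qmat_mul A (qmat_diag u u)" for u
    by (simp add: qmat_eq_iff A_def qmul.scaleR_left qmul.scaleR_right)
  then have "commutes_actions (\<lambda>X. qmat_mul X A)"
    unfolding commutes_actions_def by (simp add: qmat_mul_assoc)
  moreover have "induced_by (\<lambda>X. qmat_mul X A) (act qone e t)"
    unfolding induced_by_def
  proof
    fix X assume "X \<in> Sp11"
    then show "act qone e t (Phi X) = Phi (qmat_mul X A)"
      using Phi_right_real[OF _ A, of X e "cosh t" "sinh t" t] by (simp add: A_def tanh_def)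
  qed
  ultimately show ?thesis
    unfolding translation_maps_def by blast
qed

lemma gen_group_translation_maps_imp_act:
  assumes "f \<in> gen_group translation_maps"
  shows "\<exists>u e t. (u, e, t) \<in> grp \<and> (\<forall>q\<in>Bq. f q = act u e t q)"
  using assms
proof induction
  case (gen f)
  then show ?case
    using translation_maps_imp_act by metis
next
  case ident
  show ?case
    by (intro exI[of _ qone] exI[of _ 1] exI[of _ 0]) (simp add: grp_def Sp1_def)
next
  case (comp f h)
  then obtain u e t u' e' t' where g: "(u, e, t) \<in> grp" "(u', e', t') \<in> grp"
    and eq: "\<forall>q\<in>Bq. f q = act u e t q" "\<forall>q\<in>Bq. h q = act u' e' t' q"
    by blast
  then have "(f \<circ> h) q = act (qmul u u') (e * e') (e' * t + t') q" if "q \<in> Bq" for q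
    using that act_in_Bq[OF g(2)] act_act[OF g] by simp
  moreover have "(qmul u u', e * e', e' * t + t') \<in> grp"
    using grp_mult_closed[OF g] by (simp add: grp_mult_def)
  ultimately show ?case
    by blast
next
  case (inv f)
  then obtain u e t where g: "(u, e, t) \<in> grp" and eq: "\<forall>q\<in>Bq. f q = act u e t q"
    by blast
  \<comment> \<open>\<open>inv_into Bq\<close> chooses among points of the ball, so it depends only
    on the values there and the two functions agree everywhere.\<close>
  have "inv_into Bq f = inv_into Bq (act u e t)"
    using eq by (auto simp: inv_into_def fun_eq_iff intro!: arg_cong[of _ _ Eps])
  then show ?case
    using inv_into_act[OF g] grp_inverse[OF g] by auto
qed

lemma act_maps_same_gen_group: "same_on_B act_maps (gen_group translation_maps)"
  unfolding same_on_B_def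
proof (intro conjI ballI)
  fix f assume "f \<in> act_maps"
  then obtain u e t where f: "f = act u e t" and g: "norm u = 1" "e \<in> {1, -1}"
    by (auto simp: act_maps_def grp_def Sp1_def)
  \<comment> \<open>Each action map is a product of two generators, one from a left and one from a
    right translation.\<close>
  have "act u 1 0 \<circ> act qone e t \<in> gen_group translation_maps"
    by (intro gen_group.comp gen_group.gen act_conj_translation act_boost_translation g)
  moreover have "f q = (act u 1 0 \<circ> act qone e t) q" for q
    by (simp add: f act_mob qmul.scaleR_left qmul.scaleR_right)
  ultimately show "\<exists>h\<in>gen_group translation_maps. \<forall>q\<in>Bq. f q = h q"
    by blast
next
  fix h assume "h \<in> gen_group translation_maps"
  then obtain u e t where "(u, e, t) \<in> grp" "\<forall>q\<in>Bq. h q = act u e t q"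
    using gen_group_translation_maps_imp_act by blast
  then show "\<exists>f\<in>act_maps. \<forall>q\<in>Bq. f q = h q"
    unfolding act_maps_def by (intro bexI[of _ "act u e t"]) auto
qed

theorem theorem3p12:
  shows "(\<forall>x\<in>grp. \<forall>q\<in>Bq. (case x of (u, e, t) \<Rightarrow> act u e t q) \<in> Bq)
       \<and> (\<forall>q\<in>Bq. act qone 1 0 q = q)
       \<and> (\<forall>x\<in>grp. \<forall>y\<in>grp. grp_mult x y \<in> grp \<and>
            (\<forall>q\<in>Bq. (case grp_mult x y of (u, e, t) \<Rightarrow> act u e t q)
                   = (case x of (u, e, t) \<Rightarrow> act u e t ((case y of (u', e', t') \<Rightarrow> act u' e' t' q)))))
       \<and> same_on_B act_maps Iso_plus
       \<and> same_on_B act_maps (gen_group translation_maps)"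
proof (intro conjI ballI)
  fix x y q assume "x \<in> grp" "y \<in> grp" "q \<in> Bq"
  then show "(case grp_mult x y of (u, e, t) \<Rightarrow> act u e t q)
      = (case x of (u, e, t) \<Rightarrow> act u e t ((case y of (u', e', t') \<Rightarrow> act u' e' t' q)))"
    by (cases x; cases y) (simp add: grp_mult_def act_act)
qed (auto simp: act_in_Bq grp_mult_closed act_maps_same_Iso_plus act_maps_same_gen_group)

end
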